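(* Let $(\Omega,d,\mu)$ be a metric measure space, let $X$ be an r.i. space on $\Omega$, let $\phi,v\in\mathcal A_0$ with $v$ strictly increasing, and assume that $$h_\mu(r):=\inf_{x\in\Omega}\mu(B(x,r))\ge v(r),\qquad r>0 .$$ (i) Let $0<\eta\le1$ be such that $\overline\alpha_X<1/\eta$ (such an $\eta$ can always be chosen with $0<\eta<1$, and if $\overline\alpha_X<1$ one may take $\eta=1$). Put $\omega_H(t):=\phi(v^{-1}(t))$, $t>0$. Then there is a constant $C>0$ such that for every $f\in L^\eta(\mu)+L^\infty(\mu)$, $$\left\|\frac{O(|f|^\eta,\cdot)^{1/\eta}}{\omega_H(\cdot)}\right\|_X\le C\,\|f\|_{\dot M^{\phi,X}} .$$ (ii) Let $0<p<\infty$, $p_0:=\min\{1,p\}$, $0<q\le\infty$ and $0<\theta<\infty$. Then there is a constant $C>0$ such that for every $f\in L^p_{\mathrm{loc}}(\Omega)\cap(L^{p_0}(\mu)+L^\infty(\mu))$, $$\left(\int_0^\infty\left(\frac{\varphi_X(t)\,O(|f|^{p_0},t)^{1/p_0}}{v^{-1}(t)^\theta}\right)^q\frac{dt}t\right)^{1/q}\le C\,\|f\|_{\dot{\mathcal B}^{\theta,p}_{X,q}},$$ with the integral replaced by a supremum over $t>0$ when $q=\infty$. (The right-hand sides may be $+\infty$, in which case there is nothing to prove.)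
   Context: Metric measure space: $(\Omega,d)$ is a separable metric space, $\mu$ is a nonatomic Borel measure on $\Omega$ (in particular $\mu(\{x\})=0$ for all $x$) with $\mu(\Omega)=\infty$ and $0<\mu(B)<\infty$ for every open ball $B=B(x,r)=\{y:d(x,y)<r\}$. Rearrangements: for measurable $f$, $f^*(t)=\inf\{\lambda\ge0:\mu\{|f|>\lambda\}\le t\}$, $f^{**}(t)=\frac1t\int_0^tf^*(s)\,ds$, $O(f,t)=f^{**}(t)-f^*(t)$. R.i. space: a Banach space $X$ of ($\mu$-a.e. classes of) measurable functions with the lattice property ($|f|\le|g|$, $g\in X$ imply $f\in X$, $\|f\|_X\le\|g\|_X$), the Fatou property ($0\le f_n\uparrow f$ a.e. implies $\|f_n\|_X\uparrow\|f\|_X$), and rearrangement invariance ($f^*=g^*$, $f\in X$ imply $g\in X$, $\|g\|_X=\|f\|_X$); one has $L^1\cap L^\infty\subset X\subset L^1+L^\infty$ continuously. $X$ has a representation space $\overline X$ on $(0,\infty)$ with Lebesgue measure, with $\|f\|_X=\|f^*\|_{\overline X}$; for functions $F$ on $(0,\infty)$, $\|F\|_X$ means $\|F\|_{\overline X}$. Norms are $+\infty$ outside the space. Fundamental function: $\varphi_X(t)=\|\chi_E\|_X$ for $\mu(E)=t$. Upper Boyd index: $\overline\alpha_X=\inf_{s>1}\frac{\log h_X(s)}{\log s}$, where $h_X(s)$ is the operator norm on $\overline X$ of $E_sF(t)=F(t/s)$. Class $\mathcal A_0$: continuous increasing $\phi:[0,\infty)\to[0,\infty)$ with $\phi(0)=0$,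 $\phi(t)>0$ for $t>0$, $M_\phi(\lambda):=\sup_{s>0}\phi(\lambda s)/\phi(s)<\infty$ for all $\lambda>0$, and $0<\underline\beta_\phi\le\overline\beta_\phi<\infty$, where $\underline\beta_\phi=\lim_{\lambda\to0^+}\frac{\log M_\phi(\lambda)}{\log\lambda}$, $\overline\beta_\phi=\lim_{\lambda\to\infty}\frac{\log M_\phi(\lambda)}{\log\lambda}$. Functions in $\mathcal A_0$ are considered up to equivalence; convenient representatives are chosen (strictly increasing when inverses are used, and, whenever needed, differentiable with $t\phi'(t)\simeq\phi(t)$, e.g. $\int_0^t\phi(s)\,ds/s\simeq\phi(t)$). Haj\l asz seminorm: $D^\phi(f)$ is the set of nonnegative measurable $g$ with $|f(x)-f(y)|\le\phi(d(x,y))(g(x)+g(y))$ for $\mu$-a.e. $x,y$, and $\|f\|_{\dot M^{\phi,X}}=\inf_{g\in D^\phi(f)}\|g\|_X$. Averaged Besov seminorm: $\nabla_r^pf(x)=\Big(\frac1{\mu(B(x,r))}\int_{B(x,r)}|f(x)-f(y)|^p\,d\mu(y)\Big)^{1/p}$, $E_X^p(f,r)=\|\nabla_r^pf\|_X$, and $\|f\|_{\dot{\mathcal B}^{\theta,p}_{X,q}}=\Big(\int_0^\infty\big(r^{-\theta}E_X^p(f,r)\big)^q\frac{dr}r\Big)^{1/q}$ (for $q=\infty$: $\sup_{r>0}r^{-\theta}E_X^p(f,r)$). *)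

theory Defs
  imports "HOL-Analysis.Analysis" "HOL-Probability.Essential_Supremum"
begin

text \<open>The power \<open>x\<^sup>a\<close> for \<open>0 \<le> x \<le> \<infinity>\<close>; it is only used with exponents \<open>a > 0\<close>.\<close>

definition epowr :: "ennreal \<Rightarrow> real \<Rightarrow> ennreal" where
  "epowr x a = (if x = \<infinity> then \<infinity> else ennreal (enn2real x powr a))"

definition eln :: "ennreal \<Rightarrow> ereal" where
  "eln x = (if x = 0 then -\<infinity> else if x = \<infinity> then \<infinity> else ereal (ln (enn2real x)))"

text \<open>The norm of \<open>L\<^sup>q((0,\<infinity>), dt/t)\<close> for \<open>0 < q \<le> \<infinity>\<close>. For \<open>q = \<infinity>\<close> it is the pointwise
  supremum, not an essential one.\<close>

definition Lq_haar :: "ennreal \<Rightarrow> (real \<Rightarrow> ennreal) \<Rightarrow> ennreal" where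
  "Lq_haar q G =
    (if q = \<infinity> then (SUP t\<in>{0<..}. G t)
     else epowr (\<integral>\<^sup>+t\<in>{0<..}. epowr (G t) (enn2real q) / ennreal t \<partial>lborel) (1 / enn2real q))"

definition nonatomic :: "'a measure \<Rightarrow> bool" where
  "nonatomic M \<longleftrightarrow>
    (\<forall>A\<in>sets M. 0 < emeasure M A \<longrightarrow>
      (\<exists>B\<in>sets M. B \<subseteq> A \<and> 0 < emeasure M B \<and> emeasure M B < emeasure M A))"

text \<open>For metric spaces, separability is second countability, for which there is a type class.\<close>

locale metric_measure_space =
  fixes M :: "'a::{metric_space, second_countable_topology} measure"
  assumes sets_eq_borel: "sets M = sets borel"
    and nonatomic: "nonatomic M"
    and emeasure_UNIV: "emeasure M UNIV = \<infinity>"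
    and ball_pos: "0 < r \<Longrightarrow> 0 < emeasure M (ball x r)"
    and ball_finite: "0 < r \<Longrightarrow> emeasure M (ball x r) < \<infinity>"

definition h_mu :: "'a::metric_space measure \<Rightarrow> real \<Rightarrow> ennreal" where
  "h_mu M r = (INF x. emeasure M (ball x r))"

definition half_line :: "real measure" where
  "half_line = restrict_space lborel {0<..}"

definition rearr :: "'a measure \<Rightarrow> ('a \<Rightarrow> real) \<Rightarrow> real \<Rightarrow> ennreal" where
  "rearr M f t =
    (INF l\<in>{l::real. 0 \<le> l \<and> emeasure M {x\<in>space M. l < \<bar>f x\<bar>} \<le> ennreal t}. ennreal l)"

definition rearr_avg :: "'a measure \<Rightarrow> ('a \<Rightarrow> real) \<Rightarrow> real \<Rightarrow> ennreal" where
  "rearr_avg M f t = (\<integral>\<^sup>+s\<in>{0<..<t}. rearr M f s \<partial>lborel) / ennreal t"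

definition osc :: "'a measure \<Rightarrow> ('a \<Rightarrow> real) \<Rightarrow> real \<Rightarrow> ennreal" where
  "osc M f t = rearr_avg M f t - rearr M f t"

definition L1_norm :: "'a measure \<Rightarrow> ('a \<Rightarrow> real) \<Rightarrow> ennreal" where
  "L1_norm M f = (\<integral>\<^sup>+x. ennreal \<bar>f x\<bar> \<partial>M)"

definition Linf_norm :: "'a measure \<Rightarrow> ('a \<Rightarrow> real) \<Rightarrow> ennreal" where
  "Linf_norm M f = esssup M (\<lambda>x. ennreal \<bar>f x\<bar>)"

definition L1_plus_Linf_norm :: "'a measure \<Rightarrow> ('a \<Rightarrow> real) \<Rightarrow> ennreal" where
  "L1_plus_Linf_norm M f =
    (INF (g, h)\<in>{(g, h). g \<in> borel_measurable M \<and> h \<in> borel_measurable M \<and>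
                         f = (\<lambda>x. g x + h x)}.
      L1_norm M g + Linf_norm M h)"

definition Lp_plus_Linf :: "'a measure \<Rightarrow> real \<Rightarrow> ('a \<Rightarrow> real) set" where
  "Lp_plus_Linf M p =
    {f. \<exists>g\<in>borel_measurable M. \<exists>h\<in>borel_measurable M.
          f = (\<lambda>x. g x + h x) \<and>
          (\<integral>\<^sup>+x. ennreal (\<bar>g x\<bar> powr p) \<partial>M) < \<infinity> \<and> Linf_norm M h < \<infinity>}"

text \<open>Local integrability means integrability on some neighbourhood of each point; this is implied
  by integrability on all balls.\<close>

definition Lp_loc :: "'a::metric_space measure \<Rightarrow> real \<Rightarrow> ('a \<Rightarrow> real) set" where
  "Lp_loc M p =
    {f\<in>borel_measurable M.
      \<forall>x. \<exists>r>0. (\<integral>\<^sup>+y\<in>ball x r. ennreal (\<bar>f y\<bar> powr p) \<partial>M) < \<infinity>}"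

text \<open>A space \<open>X\<close> is given by its norm, extended by \<open>\<infinity>\<close> to all functions outside \<open>X\<close>, so that
  \<open>X = {f. N f < \<infinity>}\<close>. That functions equal almost everywhere are identified is expressed by
  \<open>norm_eq_0_iff\<close> and \<open>lattice\<close>. The last two axioms are the continuous embeddings
  \<open>L\<^sup>1 \<inter> L\<^sup>\<infinity> \<subseteq> X \<subseteq> L\<^sup>1 + L\<^sup>\<infinity>\<close>.\<close>

locale ri_space =
  fixes M :: "'a measure" and N :: "('a \<Rightarrow> real) \<Rightarrow> ennreal"
  assumes not_measurable: "f \<notin> borel_measurable M \<Longrightarrow> N f = \<infinity>"
    and norm_eq_0_iff: "f \<in> borel_measurable M \<Longrightarrow> N f = 0 \<longleftrightarrow> (AE x in M. f x = 0)"
    and norm_scale: "f \<in> borel_measurable M \<Longrightarrow> N (\<lambda>x. c * f x) = ennreal \<bar>c\<bar> * N f"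
    and norm_triangle:
      "\<lbrakk>f \<in> borel_measurable M; g \<in> borel_measurable M\<rbrakk> \<Longrightarrow> N (\<lambda>x. f x + g x) \<le> N f + N g"
    and complete:
      "\<lbrakk>\<And>n. N (u n) < \<infinity>;
        \<And>e::real. 0 < e \<Longrightarrow> \<exists>k. \<forall>m\<ge>k. \<forall>n\<ge>k. N (\<lambda>x. u m x - u n x) < ennreal e\<rbrakk>
       \<Longrightarrow> \<exists>w. N w < \<infinity> \<and> (\<lambda>n::nat. N (\<lambda>x. u n x - w x)) \<longlonglongrightarrow> 0"
    and lattice:
      "\<lbrakk>f \<in> borel_measurable M; g \<in> borel_measurable M; AE x in M. \<bar>f x\<bar> \<le> \<bar>g x\<bar>\<rbrakk>
       \<Longrightarrow> N f \<le> N g"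
    and fatou:
      "\<lbrakk>\<And>n. u n \<in> borel_measurable M; f \<in> borel_measurable M;
        AE x in M. (\<forall>n. 0 \<le> u n x) \<and> incseq (\<lambda>n. u n x) \<and> (\<lambda>n. u n x) \<longlonglongrightarrow> f x\<rbrakk>
       \<Longrightarrow> (\<lambda>n. N (u n)) \<longlonglongrightarrow> N f"
    and rearrangement_invariant:
      "\<lbrakk>f \<in> borel_measurable M; g \<in> borel_measurable M; \<And>t. 0 < t \<Longrightarrow> rearr M f t = rearr M g t\<rbrakk>
       \<Longrightarrow> N f = N g"
    and L1_Int_Linf_embedding:
      "\<exists>C::real>0. \<forall>f\<in>borel_measurable M. N f \<le> ennreal C * max (L1_norm M f) (Linf_norm M f)"
    and L1_plus_Linf_embedding:
      "\<exists>C::real>0. \<forall>f\<in>borel_measurable M. L1_plus_Linf_norm M f \<le> ennreal C * N f"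

text \<open>The norm of a \<open>[0,\<infinity>]\<close>-valued function, which lies in \<open>X\<close> only if it is finite almost
  everywhere.\<close>

definition xnorm :: "'a measure \<Rightarrow> (('a \<Rightarrow> real) \<Rightarrow> ennreal) \<Rightarrow> ('a \<Rightarrow> ennreal) \<Rightarrow> ennreal" where
  "xnorm M N g = (if AE x in M. g x < \<infinity> then N (\<lambda>x. enn2real (g x)) else \<infinity>)"

definition representation_space ::
  "'a measure \<Rightarrow> (('a \<Rightarrow> real) \<Rightarrow> ennreal) \<Rightarrow> ((real \<Rightarrow> real) \<Rightarrow> ennreal) \<Rightarrow> bool" where
  "representation_space M N Nbar \<longleftrightarrow>
    ri_space half_line Nbar \<and>
    (\<forall>f\<in>borel_measurable M. N f = xnorm half_line Nbar (rearr M f))"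

text \<open>The choice of the set does not matter by rearrangement invariance.\<close>

definition fundamental_function ::
  "'a measure \<Rightarrow> (('a \<Rightarrow> real) \<Rightarrow> ennreal) \<Rightarrow> real \<Rightarrow> ennreal" where
  "fundamental_function M N t = N (indicator (SOME E. E \<in> sets M \<and> emeasure M E = ennreal t))"

definition dilation_norm :: "((real \<Rightarrow> real) \<Rightarrow> ennreal) \<Rightarrow> real \<Rightarrow> ennreal" where
  "dilation_norm Nbar s =
    (SUP F\<in>{F\<in>borel_measurable half_line. Nbar F \<le> 1}. Nbar (\<lambda>t. F (t / s)))"

definition upper_boyd_index :: "((real \<Rightarrow> real) \<Rightarrow> ennreal) \<Rightarrow> ereal" where
  "upper_boyd_index Nbar = (INF s\<in>{1<..}. eln (dilation_norm Nbar s) / ereal (ln s))"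

definition dilation_sup :: "(real \<Rightarrow> real) \<Rightarrow> real \<Rightarrow> real" where
  "dilation_sup \<phi> l = (SUP s\<in>{0<..}. \<phi> (l * s) / \<phi> s)"

text \<open>Functions on \<open>[0,\<infinity>)\<close> are given as total functions whose values on negative arguments are
  irrelevant. The numbers \<open>a\<close> and \<open>b\<close> are the lower and the upper index; both limits always exist
  and are finite, since \<open>dilation_sup \<phi>\<close> is submultiplicative.\<close>

definition class_A0 :: "(real \<Rightarrow> real) set" where
  "class_A0 =
    {\<phi>. continuous_on {0..} \<phi> \<and> mono_on {0..} \<phi> \<and> \<phi> 0 = 0 \<and> (\<forall>t>0. 0 < \<phi> t) \<and>
        (\<forall>l>0. bdd_above ((\<lambda>s. \<phi> (l * s) / \<phi> s) ` {0<..})) \<and>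
        (\<exists>a b. ((\<lambda>l. ln (dilation_sup \<phi> l) / ln l) \<longlongrightarrow> a) (at_right 0) \<and>
               ((\<lambda>l. ln (dilation_sup \<phi> l) / ln l) \<longlongrightarrow> b) at_top \<and>
               0 < a \<and> a \<le> b)}"

text \<open>For Borel functions the iterated quantification is the same as almost everywhere with respect
  to the product measure. It is implied by the inequality for all \<open>x\<close>, \<open>y\<close> outside a null set.\<close>

definition hajlasz_gradients ::
  "'a::metric_space measure \<Rightarrow> (real \<Rightarrow> real) \<Rightarrow> ('a \<Rightarrow> real) \<Rightarrow> ('a \<Rightarrow> real) set" where
  "hajlasz_gradients M \<phi> f =
    {g\<in>borel_measurable M. (\<forall>x. 0 \<le> g x) \<and>
      (AE x in M. AE y in M. \<bar>f x - f y\<bar> \<le> \<phi> (dist x y) * (g x + g y))}"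

definition hajlasz_seminorm ::
  "'a::metric_space measure \<Rightarrow> (('a \<Rightarrow> real) \<Rightarrow> ennreal) \<Rightarrow> (real \<Rightarrow> real) \<Rightarrow> ('a \<Rightarrow> real) \<Rightarrow> ennreal"
  where
  "hajlasz_seminorm M N \<phi> f = (INF g\<in>hajlasz_gradients M \<phi> f. N g)"

definition avg_gradient ::
  "'a::metric_space measure \<Rightarrow> real \<Rightarrow> real \<Rightarrow> ('a \<Rightarrow> real) \<Rightarrow> 'a \<Rightarrow> ennreal" where
  "avg_gradient M p r f x =
    epowr ((\<integral>\<^sup>+y\<in>ball x r. ennreal (\<bar>f x - f y\<bar> powr p) \<partial>M) / emeasure M (ball x r)) (1 / p)"

definition besov_seminorm ::
  "'a::metric_space measure \<Rightarrow> (('a \<Rightarrow> real) \<Rightarrow> ennreal) \<Rightarrow> real \<Rightarrow> real \<Rightarrow> ennreal \<Rightarrow>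
    ('a \<Rightarrow> real) \<Rightarrow> ennreal" where
  "besov_seminorm M N \<theta> p q f =
    Lq_haar q (\<lambda>r. ennreal (r powr (-\<theta>)) * xnorm M N (avg_gradient M p r f))"

end

theory Submission
  imports Defs "HOL-Probability.Distribution_Functions"
begin

text \<open>Let \<open>F = |f|\<^sup>a\<close> with \<open>a \<le> 1\<close> and \<open>E = {F > F\<^sup>*(t)}\<close>, so that \<open>E\<close> has measure at most \<open>t\<close> and
  \<open>t O(F, t)\<close> is the integral of \<open>F - F\<^sup>*(t)\<close> over \<open>E\<close>. If \<open>v(r)\<close> is at least \<open>2t\<close> or \<open>3t\<close>, a large part of
  each ball \<open>B(x, r)\<close> lies outside \<open>E\<close>, and there \<open>F(x) - F\<^sup>*(t) \<le> F(x) - F(y) \<le> |f(x) - f(y)|\<^sup>a\<close>.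

  For (i), \<open>y\<close> can be chosen with \<open>g(y) \<le> g\<^sup>*(t)\<close>, so \<open>O(F, t)\<close> is at most a multiple of
  \<open>\<phi>(v\<^sup>-\<^sup>1(t))\<^sup>a\<close> times the mean of \<open>(g\<^sup>*)\<^sup>a\<close> over \<open>(0, t)\<close>, and the Boyd index condition gives a Hardy inequality.

  For (ii), averaging over \<open>y\<close> bounds \<open>\<phi>\<^sub>X(t) O(F, t)\<^bsup>1/a\<^esup>\<close> by the norm of \<open>\<nabla>\<^sub>r f\<close> for every \<open>r \<ge> v\<^sup>-\<^sup>1(2t)\<close>. This freedom
  in \<open>r\<close> replaces a change of variables: on dyadic blocks one compares with the infimum of the right-hand side,
  and \<open>v(2r) \<le> C v(r)\<close> controls the \<open>dt/t\<close>-measure of the blocks.\<close>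

section \<open>Powers in [0, \<infinity>] and rearrangements\<close>

text \<open>Most of the length goes into what the axioms of the norm do not directly provide. Bounds
  for dilations and averages on the half-line are obtained from rearrangement invariance and the
  triangle inequality alone, by moving pieces of a function around. Two interleaved copies of
  \<open>F\<close> show that dilation by 2 has norm at most 2; hence the upper Boyd index is at most
  1 and every \<open>\<eta> < 1\<close> is admissible in (i). Cyclic shifts of a step function show
  that averaging over \<open>(0, t)\<close> does not increase the norm, which is how the fundamental
  function enters (ii). That function is defined by choosing a set of measure exactly
  \<open>t\<close>, whereas nonatomicity only speaks of smaller positive measure, so such sets have
  to be constructed. In (ii) the norm of the averaged gradient is not known to be a measurable
  function of the radius, and \<open>v\<close> is only continuous and increasing. This is why
  integrals over \<open>dt/t\<close> are compared through infima over blocks and not by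
  substitution.\<close>

lemma epowr_top [simp]: "epowr \<infinity> a = \<infinity>" "epowr top a = top"
  by (simp_all add: epowr_def infinity_ennreal_def)

lemma epowr_ennreal: "0 \<le> x \<Longrightarrow> epowr (ennreal x) a = ennreal (x powr a)"
  by (simp add: epowr_def)

lemma epowr_0 [simp]: "epowr 0 a = 0"
  by (simp add: epowr_def)

lemma epowr_1 [simp]: "epowr x 1 = x"
  by (cases x) (auto simp: epowr_ennreal)

lemma epowr_mono: "\<lbrakk>x \<le> y; 0 \<le> a\<rbrakk> \<Longrightarrow> epowr x a \<le> epowr y a"
  by (cases x; cases y) (auto simp: epowr_ennreal powr_mono2 top_unique intro!: ennreal_leI)

lemma epowr_mult: "0 < a \<Longrightarrow> epowr (x * y) a = epowr x a * epowr y a"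
proof (cases x; cases y)
  fix r s :: real assume "0 \<le> r" "x = ennreal r" "0 \<le> s" "y = ennreal s"
  then show ?thesis
    by (simp add: epowr_ennreal powr_mult flip: ennreal_mult)
next
  fix r :: real assume "0 \<le> r" "x = ennreal r" "y = top"
  then show ?thesis
    by (cases "r = 0") (auto simp: epowr_ennreal ennreal_mult_top)
next
  fix r :: real assume "0 \<le> r" "x = top" "y = ennreal r"
  then show ?thesis
    by (cases "r = 0") (auto simp: epowr_ennreal ennreal_top_mult)
qed simp

lemma epowr_epowr: "epowr (epowr x a) b = epowr x (a * b)"
  by (cases x) (auto simp: epowr_ennreal powr_powr)

lemma epowr_measurable [measurable (raw)]:
  assumes [measurable]: "f \<in> borel_measurable M"
  shows "(\<lambda>x. epowr (f x) a) \<in> borel_measurable M"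
  unfolding epowr_def infinity_ennreal_def by measurable

text \<open>Rests on continuity from below: the sets above the levels \<open>l + 1 / Suc n\<close>
  exhaust the set above \<open>l\<close>, so a measure exceeding \<open>t\<close> persists at a
  slightly higher level, which is then a lower bound for the infimum. It is the main bridge between
  values of the rearrangement and measures of level sets.\<close>

lemma rearr_gt_iff:
  assumes f [measurable]: "f \<in> borel_measurable M" and l: "0 \<le> l"
  shows "ennreal l < rearr M f t \<longleftrightarrow> ennreal t < emeasure M {x\<in>space M. l < \<bar>f x\<bar>}"
proof
  assume "ennreal l < rearr M f t"
  moreover have "rearr M f t \<le> ennreal l"
    if "emeasure M {x\<in>space M. l < \<bar>f x\<bar>} \<le> ennreal t"
    unfolding rearr_def using l that by (intro INF_lower) auto
  ultimately show "ennreal t < emeasure M {x\<in>space M. l < \<bar>f x\<bar>}"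
    by (meson not_le)
next
  assume *: "ennreal t < emeasure M {x\<in>space M. l < \<bar>f x\<bar>}"
  define A where "A n = {x\<in>space M. l + 1 / Suc n < \<bar>f x\<bar>}" for n
  have "{x\<in>space M. l < \<bar>f x\<bar>} = (\<Union>n. A n)"
  proof (intro set_eqI iffI)
    fix x assume x: "x \<in> {x\<in>space M. l < \<bar>f x\<bar>}"
    then obtain n where "1 / Suc n < \<bar>f x\<bar> - l"
      using nat_approx_posE[of "\<bar>f x\<bar> - l"] by auto
    with x show "x \<in> (\<Union>n. A n)" by (auto simp: A_def intro!: exI[of _ n])
  next
    fix x assume "x \<in> (\<Union>n. A n)"
    then obtain n where "x \<in> space M" "l + 1 / Suc n < \<bar>f x\<bar>" by (auto simp: A_def)
    moreover have "0 < 1 / Suc n" by simp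
    ultimately have "l < \<bar>f x\<bar>" by linarith
    with \<open>x \<in> space M\<close> show "x \<in> {x\<in>space M. l < \<bar>f x\<bar>}" by simp
  qed
  moreover have "incseq A"
  proof (rule incseq_SucI, rule subsetI)
    fix n x assume "x \<in> A n"
    moreover have "1 / Suc (Suc n) \<le> 1 / Suc n" by (simp add: field_simps)
    ultimately show "x \<in> A (Suc n)" by (simp add: A_def)
  qed
  moreover have "range A \<subseteq> sets M" by (auto simp: A_def)
  ultimately have "emeasure M {x\<in>space M. l < \<bar>f x\<bar>} = (SUP n. emeasure M (A n))"
    by (simp add: SUP_emeasure_incseq)
  with * obtain n where n: "ennreal t < emeasure M (A n)"
    by (auto simp: less_SUP_iff)
  have "ennreal (l + 1 / Suc n) \<le> rearr M f t"
    unfolding rearr_def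
  proof (intro INF_greatest, clarify)
    fix k assume k: "0 \<le> k" "emeasure M {x\<in>space M. k < \<bar>f x\<bar>} \<le> ennreal t"
    have "l + 1 / Suc n \<le> k"
    proof (rule ccontr)
      assume "\<not> l + 1 / Suc n \<le> k"
      then have "emeasure M (A n) \<le> emeasure M {x\<in>space M. k < \<bar>f x\<bar>}"
        by (intro emeasure_mono) (auto simp: A_def)
      with k n show False by (meson not_le order_trans)
    qed
    then show "ennreal (l + 1 / Suc n) \<le> ennreal k" by (rule ennreal_leI)
  qed
  moreover have "ennreal l < ennreal (l + 1 / Suc n)"
    using l by (intro ennreal_lessI) (auto simp: add_nonneg_pos)
  ultimately show "ennreal l < rearr M f t" by (rule less_le_trans[rotated])
qed

lemma rearr_antimono:
  assumes "s \<le> t"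
  shows "rearr M f t \<le> rearr M f s"
  unfolding rearr_def
proof (rule INF_superset_mono)
  have "ennreal s \<le> ennreal t" using assms by (rule ennreal_leI)
  then show "{l. 0 \<le> l \<and> emeasure M {x\<in>space M. l < \<bar>f x\<bar>} \<le> ennreal s}
    \<subseteq> {l. 0 \<le> l \<and> emeasure M {x\<in>space M. l < \<bar>f x\<bar>} \<le> ennreal t}"
    by (blast intro: order_trans)
qed simp

lemma rearr_cong_distr:
  assumes "\<And>l. 0 \<le> l \<Longrightarrow>
    emeasure M {x\<in>space M. l < \<bar>f x\<bar>} = emeasure M' {x\<in>space M'. l < \<bar>g x\<bar>}"
  shows "rearr M f t = rearr M' g t"
  unfolding rearr_def using assms by (intro INF_cong Collect_cong) (simp_all cong: conj_cong)

lemma borel_measurable_antimono_ennreal: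
  fixes h :: "real \<Rightarrow> ennreal"
  assumes "\<And>s t. s \<le> t \<Longrightarrow> h t \<le> h s"
  shows "h \<in> borel_measurable borel"
proof (rule borel_measurableI_greater)
  fix y
  have "is_interval {t. y < h t}"
    unfolding is_interval_1 using assms less_le_trans by blast
  then show "{x \<in> space borel. y < h x} \<in> sets borel"
    by (simp add: real_interval_borel_measurable)
qed

lemma rearr_measurable [measurable]: "rearr M f \<in> borel_measurable borel"
  by (intro borel_measurable_antimono_ennreal rearr_antimono)

lemma space_half_line [simp]: "space half_line = {0<..}"
  by (simp add: half_line_def space_restrict_space)

lemma sets_half_line [measurable_cong]: "sets half_line = sets (restrict_space borel {0<..})"
  unfolding half_line_def by (rule sets_restrict_space_cong) simp

lemma measurable_half_line [measurable (raw)]: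
  "f \<in> borel_measurable borel \<Longrightarrow> f \<in> borel_measurable half_line"
  by (simp add: measurable_cong_sets[OF sets_half_line refl] measurable_restrict_space1)

text \<open>Functions on the half-line are total functions with arbitrary values at nonpositive
  arguments, so measurability is tested on the extension by zero.\<close>

lemma measurable_half_line_real_iff:
  fixes f :: "real \<Rightarrow> real"
  shows "f \<in> borel_measurable half_line \<longleftrightarrow> (\<lambda>x. if 0 < x then f x else 0) \<in> borel_measurable borel"
proof -
  have "f \<in> borel_measurable half_line \<longleftrightarrow> (\<lambda>x. indicator {0<..} x *\<^sub>R f x) \<in> borel_measurable borel"
    by (simp add: measurable_cong_sets[OF sets_half_line refl] borel_measurable_restrict_space_iff)
  also have "(\<lambda>x. indicator {0<..} x *\<^sub>R f x) = (\<lambda>x. if 0 < x then f x else 0)"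
    by (auto simp: indicator_def)
  finally show ?thesis .
qed

section \<open>Lebesgue measure on the half-line, layer cake formula and integrals of
  rearrangements\<close>

lemma emeasure_half_line:
  "A \<in> sets borel \<Longrightarrow> A \<subseteq> {0<..} \<Longrightarrow> emeasure half_line A = emeasure lborel A"
  unfolding half_line_def by (subst emeasure_restrict_space) auto

lemma AE_half_line: "(AE x in half_line. P x) \<longleftrightarrow> (AE x in lborel. 0 < x \<longrightarrow> P x)"
  unfolding half_line_def by (subst AE_restrict_space_iff) auto

text \<open>Reads an extended number as a length. This supplies the inner integral of the layer cake
  formula and turns values of a distribution function into lengths of superlevel sets of a
  rearrangement.\<close>

lemma emeasure_below: "emeasure lborel {s. 0 < s \<and> ennreal s < m} = m"
proof (cases m)
  case (real r)
  then have "{s. 0 < s \<and> ennreal s < m} = {0<..<r}"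
    by (auto simp: ennreal_less_iff)
  with real show ?thesis by simp
next
  case top
  then have "{s. 0 < s \<and> ennreal s < m} = {0<..}" by auto
  moreover have "emeasure lborel {0::real<..} = \<infinity>"
  proof (rule ccontr)
    assume "emeasure lborel {0::real<..} \<noteq> \<infinity>"
    then obtain r where r: "0 \<le> r" "emeasure lborel {0::real<..} = ennreal r"
      by (cases "emeasure lborel {0::real<..}") (auto simp: infinity_ennreal_def)
    have "emeasure lborel {0<..<r + 1} \<le> emeasure lborel {0::real<..}"
      by (intro emeasure_mono) auto
    with r show False by simp
  qed
  ultimately show ?thesis using top by simp
qed

text \<open>Tonelli applied to the region below the graph of \<open>h\<close>. The guard
  \<open>0 < l\<close> matters because \<open>ennreal l\<close> is \<open>0\<close> for negative
  \<open>l\<close>, so that all these levels would contribute the measure of the support of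
  \<open>h\<close>.\<close>

lemma nn_integral_layer_cake:
  assumes "sigma_finite_measure M" and h [measurable]: "h \<in> borel_measurable M"
  shows "(\<integral>\<^sup>+x. h x \<partial>M) =
    (\<integral>\<^sup>+l. emeasure M {x\<in>space M. 0 < l \<and> ennreal l < h x} \<partial>lborel)"
proof -
  interpret sigma_finite_measure M by fact
  interpret pair_sigma_finite M lborel by standard
  have "(\<integral>\<^sup>+x. h x \<partial>M) = (\<integral>\<^sup>+x. \<integral>\<^sup>+l. indicator {l. 0 < l \<and> ennreal l < h x} l \<partial>lborel \<partial>M)"
    by (intro nn_integral_cong) (simp add: emeasure_below)
  also have "\<dots> = (\<integral>\<^sup>+l. \<integral>\<^sup>+x. indicator {l. 0 < l \<and> ennreal l < h x} l \<partial>M \<partial>lborel)"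
    by (intro Fubini'[symmetric]) measurable
  also have "\<dots> = (\<integral>\<^sup>+l. emeasure M {x\<in>space M. 0 < l \<and> ennreal l < h x} \<partial>lborel)"
  proof (intro nn_integral_cong)
    fix l :: real
    have "(\<integral>\<^sup>+x. indicator {l. 0 < l \<and> ennreal l < h x} l \<partial>M) =
        (\<integral>\<^sup>+x. indicator {x\<in>space M. 0 < l \<and> ennreal l < h x} x \<partial>M)"
      by (intro nn_integral_cong) (auto simp: indicator_def)
    then show "(\<integral>\<^sup>+x. indicator {l. 0 < l \<and> ennreal l < h x} l \<partial>M) =
        emeasure M {x\<in>space M. 0 < l \<and> ennreal l < h x}" by simp
  qed
  finally show ?thesis .
qed

text \<open>Two measure spaces are allowed so that integrals over the metric space and over the
  half-line can be compared, in either direction.\<close>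

lemma nn_integral_mono_distr:
  assumes "sigma_finite_measure M" "sigma_finite_measure M'"
    and "h \<in> borel_measurable M" "h' \<in> borel_measurable M'"
    and le: "\<And>l. 0 < l \<Longrightarrow> emeasure M {x\<in>space M. ennreal l < h x} \<le>
      emeasure M' {x\<in>space M'. ennreal l < h' x}"
  shows "(\<integral>\<^sup>+x. h x \<partial>M) \<le> (\<integral>\<^sup>+x. h' x \<partial>M')"
  unfolding nn_integral_layer_cake[OF assms(1,3)] nn_integral_layer_cake[OF assms(2,4)]
proof (rule nn_integral_mono)
  fix l :: real
  show "emeasure M {x\<in>space M. 0 < l \<and> ennreal l < h x} \<le>
      emeasure M' {x\<in>space M'. 0 < l \<and> ennreal l < h' x}"
    using le[of l] by (cases "0 < l") auto
qed

text \<open>At level \<open>l\<close> the excess of the rearrangement over \<open>T\<close> on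
  \<open>(0, t)\<close> has a superlevel set inside the interval from 0 to the measure of the set
  where \<open>F > T + l\<close>, and the length of this interval is the distribution function of
  \<open>F - T\<close>.\<close>

lemma osc_le_integral_excess:
  assumes sf: "sigma_finite_measure M" and F [measurable]: "F \<in> borel_measurable M"
    and F0: "\<And>x. 0 \<le> F x" and t: "0 < t" and T: "rearr M F t = ennreal T" "0 \<le> T"
  shows "osc M F t \<le> (\<integral>\<^sup>+x. ennreal (F x - T) \<partial>M) / ennreal t"
proof -
  let ?J = "\<integral>\<^sup>+x. ennreal (F x - T) \<partial>M"
  define h where "h s = (rearr M F s - ennreal T) * indicator {0<..<t} s" for s
  have [measurable]: "h \<in> borel_measurable borel" unfolding h_def by measurable
  have "(\<integral>\<^sup>+s. h s \<partial>lborel) \<le> ?J"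
  proof (rule nn_integral_mono_distr[OF _ sf])
    fix l :: real assume l: "0 < l"
    have "{s\<in>space lborel. ennreal l < h s} \<subseteq>
        {s. 0 < s \<and> ennreal s < emeasure M {x\<in>space M. T + l < \<bar>F x\<bar>}}"
    proof safe
      fix s assume s: "ennreal l < h s"
      then show "0 < s" by (cases "0 < s \<and> s < t") (auto simp: h_def)
      have "ennreal l < rearr M F s - ennreal T"
        using s by (cases "0 < s \<and> s < t") (auto simp: h_def)
      then have "ennreal (T + l) < rearr M F s"
        using T(2) l
        by (cases "rearr M F s") (auto simp: ennreal_minus ennreal_less_iff simp del: ennreal_plus)
      then show "ennreal s < emeasure M {x\<in>space M. T + l < \<bar>F x\<bar>}"
        using T(2) l by (subst rearr_gt_iff[symmetric]) auto
    qed
    then have "emeasure lborel {s\<in>space lborel. ennreal l < h s} \<le>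
        emeasure lborel {s. 0 < s \<and> ennreal s < emeasure M {x\<in>space M. T + l < \<bar>F x\<bar>}}"
      by (intro emeasure_mono) auto
    also have "\<dots> = emeasure M {x\<in>space M. T + l < \<bar>F x\<bar>}" by (rule emeasure_below)
    also have "{x\<in>space M. T + l < \<bar>F x\<bar>} = {x\<in>space M. ennreal l < ennreal (F x - T)}"
      using l F0 by (auto simp: ennreal_less_iff)
    finally show "emeasure lborel {s\<in>space lborel. ennreal l < h s} \<le>
        emeasure M {x\<in>space M. ennreal l < ennreal (F x - T)}" .
  qed (auto simp: sigma_finite_lborel)
  \<comment> \<open>On \<open>(0, t)\<close> monotonicity gives \<open>rearr M F s \<ge> T\<close>,
    so adding \<open>T\<close> back undoes the truncated subtraction in \<open>h\<close>.\<close>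
  moreover have "(\<integral>\<^sup>+s\<in>{0<..<t}. rearr M F s \<partial>lborel) =
      (\<integral>\<^sup>+s. h s + ennreal T * indicator {0<..<t} s \<partial>lborel)"
  proof (rule nn_integral_cong)
    fix s
    have "ennreal T \<le> rearr M F s" if "s < t"
      using rearr_antimono[of s t M F] that T by simp
    then show "rearr M F s * indicator {0<..<t} s = h s + ennreal T * indicator {0<..<t} s"
      by (auto simp: h_def indicator_def diff_add_cancel_ennreal)
  qed
  moreover have "\<dots> = (\<integral>\<^sup>+s. h s \<partial>lborel) + ennreal T * ennreal t"
    using t by (simp add: nn_integral_add nn_integral_cmult_indicator)
  ultimately have "rearr_avg M F t \<le> (?J + ennreal T * ennreal t) / ennreal t"
    unfolding rearr_avg_def by (intro divide_right_mono_ennreal) simp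
  also have "\<dots> = ?J / ennreal t + ennreal T"
    using t T(2) by (simp add: add_divide_distrib_ennreal ennreal_mult_divide_eq)
  finally show ?thesis
    unfolding osc_def T(1) by (simp add: ennreal_minus_le_iff add.commute)
qed

lemma less_epowr_iff:
  assumes "0 < l" "0 < a"
  shows "ennreal l < epowr m a \<longleftrightarrow> ennreal (l powr (1 / a)) < m"
proof (cases m)
  case (real r)
  have "l < r powr a \<longleftrightarrow> l powr (1 / a) < r"
  proof
    assume "l < r powr a"
    then have "l powr (1 / a) < (r powr a) powr (1 / a)"
      using assms by (intro powr_less_mono2) auto
    then show "l powr (1 / a) < r" using assms real by (simp add: powr_powr)
  next
    assume "l powr (1 / a) < r"
    then have "(l powr (1 / a)) powr a < r powr a"
      using assms by (intro powr_less_mono2) auto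
    then show "l < r powr a" using assms by (simp add: powr_powr)
  qed
  with real assms show ?thesis by (simp add: epowr_ennreal ennreal_less_iff)
qed (simp_all add: infinity_ennreal_def)

text \<open>Hardy-Littlewood: the superlevel sets of the left integrand have measure at most the
  smaller of \<open>t\<close> and a value of the distribution function of \<open>g\<close>, and this
  minimum is exactly the length of the corresponding superlevel set on the right.\<close>

lemma nn_integral_powr_le_rearr:
  assumes sf: "sigma_finite_measure M" and g [measurable]: "g \<in> borel_measurable M"
    and g0: "\<And>x. 0 \<le> g x" and E [measurable]: "E \<in> sets M"
    and t: "0 < t" "emeasure M E \<le> ennreal t" and a: "0 < a"
  shows "(\<integral>\<^sup>+x\<in>E. ennreal (g x powr a) \<partial>M) \<le> (\<integral>\<^sup>+s\<in>{0<..<t}. epowr (rearr M g s) a \<partial>lborel)"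
proof (rule nn_integral_mono_distr[OF sf])
  fix l :: real assume l: "0 < l"
  let ?m = "emeasure M {x\<in>space M. l powr (1 / a) < \<bar>g x\<bar>}"
  have "{x\<in>space M. ennreal l < ennreal (g x powr a) * indicator E x} =
      {x\<in>E. l powr (1 / a) < \<bar>g x\<bar>}"
    using less_epowr_iff[OF l a, of "ennreal (g _)"] g0 sets.sets_into_space[OF E]
    by (auto simp: indicator_def epowr_ennreal ennreal_less_iff split: if_splits)
  moreover have "emeasure M {x\<in>E. l powr (1 / a) < \<bar>g x\<bar>} \<le> ?m"
    using sets.sets_into_space[OF E] by (intro emeasure_mono) auto
  moreover have "emeasure M {x\<in>E. l powr (1 / a) < \<bar>g x\<bar>} \<le> emeasure M E"
    by (intro emeasure_mono) auto
  ultimately have "emeasure M {x\<in>space M. ennreal l < ennreal (g x powr a) * indicator E x}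
      \<le> min (ennreal t) ?m" using t by auto
  also have "\<dots> = emeasure lborel {s. 0 < s \<and> ennreal s < min (ennreal t) ?m}"
    by (rule emeasure_below[symmetric])
  also have "{s. 0 < s \<and> ennreal s < min (ennreal t) ?m} =
      {s\<in>space lborel. ennreal l < epowr (rearr M g s) a * indicator {0<..<t} s}"
    using less_epowr_iff[OF l a] rearr_gt_iff[OF g, of "l powr (1 / a)"]
    by (auto simp: indicator_def ennreal_less_iff split: if_splits)
  finally show "emeasure M {x\<in>space M. ennreal l < ennreal (g x powr a) * indicator E x} \<le>
      emeasure lborel {s\<in>space lborel. ennreal l < epowr (rearr M g s) a * indicator {0<..<t} s}" .
qed (auto simp: sigma_finite_lborel)

text \<open>Jensen's inequality for a concave power, up to the factor 2. The cases
  \<open>y \<le> c\<close> and \<open>y > c\<close> give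
  \<open>y powr a \<le> c powr a + c powr (a - 1) * y\<close>, and with \<open>c\<close> the
  integral divided by \<open>T\<close> each term contributes at most
  \<open>c powr a * T\<close>.\<close>

lemma nn_integral_epowr_average_le:
  assumes h [measurable]: "h \<in> borel_measurable M" and A [measurable]: "A \<in> sets M"
    and T: "0 < T" "emeasure M A \<le> ennreal T" and a: "0 < a" "a \<le> 1"
  shows "(\<integral>\<^sup>+x\<in>A. epowr (h x) a \<partial>M) / ennreal T
    \<le> 2 * epowr ((\<integral>\<^sup>+x\<in>A. h x \<partial>M) / ennreal T) a"
proof -
  let ?I = "\<integral>\<^sup>+x\<in>A. h x \<partial>M"
  consider "?I = 0" | "?I = top" | r where "?I = ennreal r" "0 < r"
    by (cases ?I) (force simp: ennreal_eq_0_iff)+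
  then show ?thesis
  proof cases
    case 1
    then have "AE x in M. h x * indicator A x = 0"
      by (subst (asm) nn_integral_0_iff_AE) auto
    then have "AE x in M. epowr (h x) a * indicator A x = 0"
      by eventually_elim auto
    then have "(\<integral>\<^sup>+x\<in>A. epowr (h x) a \<partial>M) = 0"
      by (subst nn_integral_0_iff_AE) auto
    then show ?thesis by simp
  next
    case 2
    with T show ?thesis by (simp add: ennreal_top_divide ennreal_mult_top)
  next
    case (3 r)
    define c where "c = r / T"
    have c: "0 < c" using 3 T by (simp add: c_def)
    have pw: "epowr (h x) a \<le> ennreal (c powr a) + ennreal (c powr (a - 1)) * h x" for x
    proof (cases "h x")
      case (real y)
      have "y powr a \<le> c powr a + c powr (a - 1) * y"
      proof (cases "y \<le> c")
        case True
        then have "y powr a \<le> c powr a" using real a by (intro powr_mono2) auto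
        moreover have "0 \<le> c powr (a - 1) * y" using real by simp
        ultimately show ?thesis by linarith
      next
        case False
        then have "y powr a = y powr (a - 1) * y"
          using c by (simp add: powr_diff)
        also have "\<dots> \<le> c powr (a - 1) * y"
          using False c a by (intro mult_right_mono powr_mono2') auto
        finally show ?thesis by (simp add: add_increasing)
      qed
      then show ?thesis
        using real by (simp add: epowr_ennreal ennreal_leI flip: ennreal_mult ennreal_plus)
    qed (use c in \<open>simp add: ennreal_mult_top\<close>)
    have "(\<integral>\<^sup>+x\<in>A. epowr (h x) a \<partial>M) \<le>
        (\<integral>\<^sup>+x. ennreal (c powr a) * indicator A x + ennreal (c powr (a - 1)) * (h x * indicator A x) \<partial>M)"
      using pw by (intro nn_integral_mono) (auto simp: indicator_def)
    also have "\<dots> = ennreal (c powr a) * emeasure M A + ennreal (c powr (a - 1)) * ennreal r"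
      using 3 by (simp add: nn_integral_add nn_integral_cmult nn_integral_cmult_indicator)
    also have "\<dots> \<le> ennreal (c powr a) * ennreal T + ennreal (c powr (a - 1)) * ennreal r"
      using T by (intro add_mono mult_left_mono) auto
    also have "\<dots> = ennreal (2 * c powr a * T)"
    proof -
      have "c powr (a - 1) * r = c powr a * T"
        using c T 3 by (simp add: powr_diff c_def)
      then show ?thesis using c T 3 by (simp flip: ennreal_mult ennreal_plus)
    qed
    finally have "(\<integral>\<^sup>+x\<in>A. epowr (h x) a \<partial>M) / ennreal T \<le> ennreal (2 * c powr a * T) / ennreal T"
      by (rule divide_right_mono_ennreal)
    also have "\<dots> = 2 * ennreal (c powr a)"
      using T by (simp add: ennreal_mult ennreal_mult_divide_eq)
    also have "ennreal (c powr a) = epowr (?I / ennreal T) a"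
      using 3 T by (simp add: divide_ennreal epowr_ennreal c_def)
    finally show ?thesis .
  qed
qed

lemma (in metric_measure_space) space_M [simp]: "space M = UNIV"
  using sets_eq_imp_space_eq[OF sets_eq_borel] by simp

lemma (in metric_measure_space) sigma_finite: "sigma_finite_measure M"
proof
  let ?A = "range (\<lambda>n. ball (undefined :: 'a) (Suc n))"
  have "\<Union>?A = UNIV"
  proof (intro UNIV_eq_I[symmetric])
    fix x :: 'a
    obtain n where "dist undefined x < real n" using reals_Archimedean2 by blast
    then show "x \<in> \<Union>?A" by (auto intro!: exI[of _ n])
  qed
  moreover have "emeasure M a \<noteq> \<infinity>" if "a \<in> ?A" for a
  proof -
    from that obtain n where "a = ball undefined (Suc n)" by auto
    then show ?thesis using ball_finite[of "Suc n" undefined] by (simp del: of_nat_Suc)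
  qed
  ultimately show "\<exists>A. countable A \<and> A \<subseteq> sets M \<and> \<Union>A = space M \<and> (\<forall>a\<in>A. emeasure M a \<noteq> \<infinity>)"
    by (intro exI[of _ ?A]) (auto simp: sets_eq_borel)
qed

lemma Lp_plus_Linf_measurable: "f \<in> Lp_plus_Linf M p \<Longrightarrow> f \<in> borel_measurable M"
  unfolding Lp_plus_Linf_def by auto

text \<open>Makes the level at which the oscillation is cut a real number. Outside a null set,
  \<open>\<bar>f x\<bar> > K + l powr (1 / p)\<close> forces
  \<open>\<bar>g x\<bar> powr p \<ge> l\<close>, and Markov's inequality bounds the measure of that
  set by \<open>I / l\<close>.\<close>

lemma rearr_powr_finite:
  assumes f: "f \<in> Lp_plus_Linf M p" and p: "0 < p" and t: "0 < t"
  shows "rearr M (\<lambda>x. \<bar>f x\<bar> powr p) t < \<infinity>"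
proof -
  from f obtain g h where [measurable]: "g \<in> borel_measurable M" "h \<in> borel_measurable M"
    and f: "f = (\<lambda>x. g x + h x)" and g: "(\<integral>\<^sup>+x. ennreal (\<bar>g x\<bar> powr p) \<partial>M) < \<infinity>"
    and h: "Linf_norm M h < \<infinity>"
    unfolding Lp_plus_Linf_def by auto
  obtain K where K: "0 \<le> K" "Linf_norm M h = ennreal K" using h by (cases "Linf_norm M h") auto
  have hK: "AE x in M. \<bar>h x\<bar> \<le> K"
    using esssup_AE[of "\<lambda>x. ennreal \<bar>h x\<bar>" M] K by (simp add: Linf_norm_def)
  obtain I where I: "0 \<le> I" "(\<integral>\<^sup>+x. ennreal (\<bar>g x\<bar> powr p) \<partial>M) = ennreal I"
    using g by (cases "\<integral>\<^sup>+x. ennreal (\<bar>g x\<bar> powr p) \<partial>M") auto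
  \<comment> \<open>Chosen so that \<open>I / l \<le> t\<close>; the summand 1 keeps
    \<open>l\<close> positive when \<open>I\<close> is 0.\<close>
  define l where "l = (I + 1) / t"
  define L where "L = (K + l powr (1 / p)) powr p"
  have l: "0 < l" using I t by (simp add: l_def)
  have "emeasure M {x\<in>space M. L < \<bar>\<bar>f x\<bar> powr p\<bar>} \<le>
      emeasure M {x\<in>space M. 1 \<le> ennreal (1 / l) * ennreal (\<bar>g x\<bar> powr p)}"
  proof (rule emeasure_mono_AE)
    show "AE x in M. x \<in> {x\<in>space M. L < \<bar>\<bar>f x\<bar> powr p\<bar>} \<longrightarrow>
        x \<in> {x\<in>space M. 1 \<le> ennreal (1 / l) * ennreal (\<bar>g x\<bar> powr p)}"
      using hK
    proof (eventually_elim, safe)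
      fix x assume x: "\<bar>h x\<bar> \<le> K" "L < \<bar>\<bar>f x\<bar> powr p\<bar>"
      have "K + l powr (1 / p) < \<bar>f x\<bar>"
      proof (rule ccontr)
        assume "\<not> K + l powr (1 / p) < \<bar>f x\<bar>"
        then have "\<bar>f x\<bar> powr p \<le> L" unfolding L_def using p by (intro powr_mono2) auto
        with x show False by simp
      qed
      with x have "l powr (1 / p) \<le> \<bar>g x\<bar>" unfolding f by linarith
      then have "(l powr (1 / p)) powr p \<le> \<bar>g x\<bar> powr p" using p by (intro powr_mono2) auto
      then have "1 \<le> 1 / l * \<bar>g x\<bar> powr p" using p l by (simp add: powr_powr field_simps)
      then have "ennreal 1 \<le> ennreal (1 / l * \<bar>g x\<bar> powr p)" by (rule ennreal_leI)
      then show "1 \<le> ennreal (1 / l) * ennreal (\<bar>g x\<bar> powr p)"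
        using l by (subst ennreal_mult[symmetric]) auto
    qed
  qed measurable
  also have "\<dots> \<le> ennreal (1 / l) * ennreal I"
  proof -
    have "emeasure M {x\<in>space M. 1 \<le> ennreal (1 / l) * ennreal (\<bar>g x\<bar> powr p)} \<le>
      ennreal (1 / l) * (\<integral>\<^sup>+x\<in>space M. ennreal (\<bar>g x\<bar> powr p) \<partial>M)"
      using nn_integral_Markov_inequality[of "\<lambda>x. ennreal (\<bar>g x\<bar> powr p)" "space M" M "ennreal (1 / l)"]
      by simp
    also have "(\<integral>\<^sup>+x\<in>space M. ennreal (\<bar>g x\<bar> powr p) \<partial>M) = ennreal I"
      unfolding I(2)[symmetric] by (intro nn_integral_cong) auto
    finally show ?thesis .
  qed
  also have "\<dots> \<le> ennreal t"
    using I t by (auto simp: l_def field_simps ennreal_mult[symmetric] simp del: ennreal_mult' ennreal_mult'' intro!: ennreal_leI)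
  finally have "rearr M (\<lambda>x. \<bar>f x\<bar> powr p) t \<le> ennreal L"
    unfolding rearr_def by (intro INF_lower) (auto simp: L_def)
  then show ?thesis by (simp add: le_less_trans)
qed

section \<open>Doubling functions and exact measures\<close>

lemma class_A0_pos: "\<phi> \<in> class_A0 \<Longrightarrow> 0 < t \<Longrightarrow> 0 < \<phi> t"
  unfolding class_A0_def by auto

lemma class_A0_mono: "\<phi> \<in> class_A0 \<Longrightarrow> 0 \<le> s \<Longrightarrow> s \<le> t \<Longrightarrow> \<phi> s \<le> \<phi> t"
  unfolding class_A0_def by (auto elim: mono_onD)

lemma class_A0_zero: "\<phi> \<in> class_A0 \<Longrightarrow> \<phi> 0 = 0"
  unfolding class_A0_def by auto

lemma class_A0_nonneg: "\<phi> \<in> class_A0 \<Longrightarrow> 0 \<le> t \<Longrightarrow> 0 \<le> \<phi> t"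
  using class_A0_mono[of \<phi> 0 t] by (simp add: class_A0_zero)

lemma class_A0_dilation:
  assumes "\<phi> \<in> class_A0" "0 < l" "0 < s"
  shows "\<phi> (l * s) \<le> dilation_sup \<phi> l * \<phi> s"
proof -
  have "bdd_above ((\<lambda>s. \<phi> (l * s) / \<phi> s) ` {0<..})"
    using assms unfolding class_A0_def by auto
  then have "\<phi> (l * s) / \<phi> s \<le> dilation_sup \<phi> l"
    unfolding dilation_sup_def using assms by (intro cSUP_upper) auto
  then show ?thesis using class_A0_pos[OF assms(1,3)] by (simp add: field_simps)
qed

lemma dilation_sup_pos:
  assumes "\<phi> \<in> class_A0" "0 < l"
  shows "0 < dilation_sup \<phi> l"
proof -
  have "0 < \<phi> (l * 1)" "0 < \<phi> 1" using assms by (auto intro: class_A0_pos)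
  then show ?thesis
    using class_A0_dilation[OF assms, of 1] by (auto dest: less_le_trans simp: zero_less_mult_iff)
qed

text \<open>A positive lower index \<open>a\<close> gives
  \<open>dilation_sup \<phi> l < l powr (a / 2)\<close> for small \<open>l\<close>, and the right
  side tends to 0. Unboundedness of \<open>\<phi>\<close> and doubling of an inverse both come from
  this.\<close>

lemma class_A0_contraction:
  assumes "\<phi> \<in> class_A0" "0 < c"
  obtains l where "0 < l" "l < 1" "\<And>s. 0 < s \<Longrightarrow> \<phi> (l * s) \<le> c * \<phi> s"
proof -
  obtain a where a: "0 < a" "((\<lambda>l. ln (dilation_sup \<phi> l) / ln l) \<longlongrightarrow> a) (at_right 0)"
    using assms unfolding class_A0_def by auto
  have "\<forall>\<^sub>F l in at_right 0. a / 2 < ln (dilation_sup \<phi> l) / ln l"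
    using a by (intro order_tendstoD) auto
  moreover have "\<forall>\<^sub>F l in at_right 0. l \<in> {0<..<min 1 (c powr (2 / a))}"
    using assms by (intro eventually_at_right_real) simp
  \<comment> \<open>The bound \<open>c powr (2 / a)\<close> on \<open>l\<close> is what yields
    \<open>l powr (a / 2) < c\<close>.\<close>
  ultimately have "\<forall>\<^sub>F l in at_right 0. a / 2 < ln (dilation_sup \<phi> l) / ln l \<and>
      l \<in> {0<..<min 1 (c powr (2 / a))}"
    by (rule eventually_conj)
  then obtain l where l: "a / 2 < ln (dilation_sup \<phi> l) / ln l" "l < c powr (2 / a)" "0 < l" "l < 1"
    using eventually_happens'[OF trivial_limit_at_right_real] by fastforce
  have "l powr (a / 2) < (c powr (2 / a)) powr (a / 2)"
    using l a by (intro powr_less_mono2) auto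
  then have lc: "l powr (a / 2) < c" using a assms by (simp add: powr_powr)
  have "ln l < 0" using l by simp
  \<comment> \<open>Here \<open>ln l\<close> is negative, so clearing the denominator reverses the
    inequality.\<close>
  then have "ln (dilation_sup \<phi> l) < a / 2 * ln l" using l(1) by (simp add: field_simps)
  then have "dilation_sup \<phi> l < exp (a / 2 * ln l)"
    using dilation_sup_pos[OF assms(1) l(3)] by (subst exp_ln[symmetric]) (auto simp del: exp_ln)
  then have *: "dilation_sup \<phi> l < c" using l lc by (simp add: powr_def)
  have "\<phi> (l * s) \<le> c * \<phi> s" if "0 < s" for s
    by (rule order_trans[OF class_A0_dilation[OF assms(1) l(3) that] mult_right_mono])
      (use * class_A0_pos[OF assms(1) that] in auto)
  with l show thesis by (intro that) auto
qed

text \<open>Running the contraction by \<open>1 / 2\<close> backwards from 1 at least doubles the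
  value at each step. Together with continuity this makes \<open>v\<close> surjective onto the
  nonnegative reals.\<close>

lemma class_A0_unbounded:
  assumes "\<phi> \<in> class_A0"
  obtains s where "0 < s" "t \<le> \<phi> s"
proof -
  obtain l where l: "0 < l" "l < 1" "\<And>s. 0 < s \<Longrightarrow> \<phi> (l * s) \<le> 1 / 2 * \<phi> s"
    using class_A0_contraction[OF assms, of "1 / 2"] by auto
  have *: "2 ^ n * \<phi> 1 \<le> \<phi> (1 / l ^ n)" for n
  proof (induction n)
    case (Suc n)
    then show ?case using l(3)[of "1 / l ^ Suc n"] l(1) by simp
  qed simp
  obtain n where "t / \<phi> 1 < 2 ^ n" using real_arch_pow[of 2 "t / \<phi> 1"] by auto
  then have "t \<le> 2 ^ n * \<phi> 1" using class_A0_pos[OF assms, of 1] by (simp add: field_simps)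
  with *[of n] l show thesis by (intro that[of "1 / l ^ n"]) auto
qed

locale A0_inverse =
  fixes v :: "real \<Rightarrow> real"
  assumes v: "v \<in> class_A0" and strict: "strict_mono_on {0..} v"
begin

abbreviation "w \<equiv> inv_into {0..} v"

lemma in_range: "0 \<le> t \<Longrightarrow> t \<in> v ` {0..}"
proof -
  assume t: "0 \<le> t"
  obtain s where s: "0 < s" "t \<le> v s" using class_A0_unbounded[OF v] by blast
  have "continuous_on {0..s} v"
    using v unfolding class_A0_def by (auto intro: continuous_on_subset)
  then have "\<exists>x\<ge>0. x \<le> s \<and> v x = t"
    using s t class_A0_zero[OF v] by (intro IVT') auto
  then show ?thesis by auto
qed

lemma v_w: "0 \<le> t \<Longrightarrow> v (w t) = t"
  using in_range by (rule f_inv_into_f)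

lemma w_nonneg: "0 \<le> t \<Longrightarrow> 0 \<le> w t"
  using inv_into_into[OF in_range] by auto

lemma v_less_iff: "0 \<le> s \<Longrightarrow> 0 \<le> t \<Longrightarrow> v s < v t \<longleftrightarrow> s < t"
  using strict_mono_on_less[OF strict] by auto

lemma v_le_iff: "0 \<le> s \<Longrightarrow> 0 \<le> t \<Longrightarrow> v s \<le> v t \<longleftrightarrow> s \<le> t"
  using v_less_iff[of t s] by (auto simp: not_less[symmetric])

lemma le_w_iff: "0 \<le> s \<Longrightarrow> 0 \<le> t \<Longrightarrow> s \<le> w t \<longleftrightarrow> v s \<le> t"
  using v_le_iff[of s "w t"] by (simp add: v_w w_nonneg)

lemma w_le_iff: "0 \<le> s \<Longrightarrow> 0 \<le> t \<Longrightarrow> w t \<le> s \<longleftrightarrow> t \<le> v s"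
  using v_le_iff[of "w t" s] by (simp add: v_w w_nonneg)

lemma w_pos: "0 < t \<Longrightarrow> 0 < w t"
  using v_w[of t] w_nonneg[of t] class_A0_zero[OF v] by (cases "w t = 0") auto

lemma w_mono: "0 \<le> s \<Longrightarrow> s \<le> t \<Longrightarrow> w s \<le> w t"
  by (subst le_w_iff) (simp_all add: w_nonneg v_w)

text \<open>The contraction of \<open>v\<close> by \<open>1 / c\<close> is read through the inverse:
  \<open>v (l * w (c * t)) \<le> t\<close> means \<open>l * w (c * t) \<le> w t\<close>.\<close>

lemma w_doubling:
  assumes "0 < c"
  obtains k where "0 < k" "\<And>t. 0 < t \<Longrightarrow> w (c * t) \<le> k * w t"
proof -
  obtain l where l: "0 < l" "l < 1" "\<And>s. 0 < s \<Longrightarrow> v (l * s) \<le> 1 / c * v s"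
    using class_A0_contraction[OF v, of "1 / c"] assms by auto
  have "w (c * t) \<le> 1 / l * w t" if "0 < t" for t
  proof -
    have "0 < w (c * t)" using that assms by (intro w_pos) simp
    then have "v (l * w (c * t)) \<le> 1 / c * (c * t)"
      using l(3)[of "w (c * t)"] that assms by (simp add: v_w)
    then have "l * w (c * t) \<le> w t"
      using \<open>0 < w (c * t)\<close> assms that l by (subst le_w_iff) auto
    then show ?thesis using l by (simp add: field_simps)
  qed
  then show thesis using l by (intro that[of "1 / l"]) auto
qed

end

text \<open>At the first disagreement the digit weighs \<open>(1 / 3) ^ n\<close>, while all later
  digits together weigh at most half of that. In base 2 the tail could compensate, which is why base
  3 is used.\<close>

lemma sum_ternary_digits_inj:
  fixes d e :: "nat \<Rightarrow> bool"
  assumes "(\<Sum>n. of_bool (d n) * (1 / 3) ^ n) = (\<Sum>n. of_bool (e n) * (1 / 3 :: real) ^ n)"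
  shows "d = e"
proof (rule ccontr)
  assume "d \<noteq> e"
  define n where "n = (LEAST n. d n \<noteq> e n)"
  have "\<exists>n. d n \<noteq> e n" using \<open>d \<noteq> e\<close> by auto
  then have n: "d n \<noteq> e n" unfolding n_def by (rule LeastI_ex)
  have nl: "d m = e m" if "m < n" for m
    using not_less_Least[OF that[unfolded n_def]] by simp
  have sm: "summable (\<lambda>n. (1 / 3 :: real) ^ n)" by (intro summable_geometric) auto
  have sd: "summable (\<lambda>n. of_bool (d n) * (1 / 3 :: real) ^ n)" for d
    by (rule summable_comparison_test'[OF sm, of 0]) auto
  have split: "(\<Sum>n. of_bool (d n) * (1 / 3 :: real) ^ n) =
      (\<Sum>k. of_bool (d (k + Suc n)) * (1 / 3) ^ (k + Suc n)) + of_bool (d n) * (1 / 3) ^ n +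
      (\<Sum>i<n. of_bool (d i) * (1 / 3) ^ i)" for d
    using suminf_split_initial_segment[OF sd, of d "Suc n"] by simp
  have tail: "(\<Sum>k. of_bool (d (k + Suc n)) * (1 / 3 :: real) ^ (k + Suc n)) \<le> (1 / 3) ^ n / 2"
    "0 \<le> (\<Sum>k. of_bool (d (k + Suc n)) * (1 / 3 :: real) ^ (k + Suc n))" for d
  proof -
    have s2: "summable (\<lambda>k. of_bool (d (k + Suc n)) * (1 / 3 :: real) ^ (k + Suc n))"
      using sd[of d] by (subst summable_iff_shift)
    have "(\<Sum>k. of_bool (d (k + Suc n)) * (1 / 3 :: real) ^ (k + Suc n)) \<le>
        (\<Sum>k. (1 / 3) ^ Suc n * (1 / 3) ^ k)"
      by (intro suminf_le s2 summable_mult sm) (auto simp: power_add)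
    also have "\<dots> = (1 / 3) ^ n / 2"
      using suminf_mult[OF sm, of "(1 / 3) ^ Suc n"] suminf_geometric[of "1 / 3 :: real"] by simp
    finally show "(\<Sum>k. of_bool (d (k + Suc n)) * (1 / 3 :: real) ^ (k + Suc n)) \<le> (1 / 3) ^ n / 2" .
    show "0 \<le> (\<Sum>k. of_bool (d (k + Suc n)) * (1 / 3 :: real) ^ (k + Suc n))"
      by (intro suminf_nonneg s2) auto
  qed
  have "(\<Sum>i<n. of_bool (d i) * (1 / 3 :: real) ^ i) = (\<Sum>i<n. of_bool (e i) * (1 / 3) ^ i)"
    using nl by (intro sum.cong) auto
  then have eq: "(\<Sum>k. of_bool (d (k + Suc n)) * (1 / 3 :: real) ^ (k + Suc n)) + of_bool (d n) * (1 / 3) ^ n =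
      (\<Sum>k. of_bool (e (k + Suc n)) * (1 / 3) ^ (k + Suc n)) + of_bool (e n) * (1 / 3) ^ n"
    using assms unfolding split[of d] split[of e] by linarith
  have pos: "0 < (1 / 3 :: real) ^ n" by simp
  show False
  proof (cases "d n")
    case True
    then have "of_bool (d n) * (1 / 3 :: real) ^ n = (1 / 3) ^ n" "of_bool (e n) * (1 / 3 :: real) ^ n = 0"
      using n by auto
    then show False using eq pos tail[of d] tail[of e] by linarith
  next
    case False
    then have "of_bool (d n) * (1 / 3 :: real) ^ n = 0" "of_bool (e n) * (1 / 3 :: real) ^ n = (1 / 3) ^ n"
      using n by auto
    then show False using eq pos tail[of d] tail[of e] by linarith
  qed
qed

text \<open>The fibres of a Borel injection into the reals are null, so the distribution function
  of its restriction to a large ball is continuous.\<close>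

lemma (in metric_measure_space) ex_set_of_measure:
  assumes t: "0 < t"
  obtains E where "E \<in> sets M" "emeasure M E = ennreal t"
proof -
  obtain \<B> :: "'a set set" where \<B>: "countable \<B>" "\<And>C. C \<in> \<B> \<Longrightarrow> open C"
    "\<And>S. open S \<Longrightarrow> \<exists>U. U \<subseteq> \<B> \<and> S = \<Union>U"
    using univ_second_countable by metis
  define U where "U = from_nat_into \<B>"
  have "\<B> \<noteq> {}" using \<B>(3)[of UNIV] by auto
  then have rU: "range U = \<B>" unfolding U_def using \<B>(1) by (rule range_from_nat_into)
  have [measurable]: "U n \<in> sets M" for n
  proof -
    have "U n \<in> \<B>" unfolding rU[symmetric] by (rule rangeI)
    then have "open (U n)" by (rule \<B>(2))
    then show ?thesis by (simp add: sets_eq_borel)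
  qed
  \<comment> \<open>Membership in the sets of a countable base, read as the digits of a ternary
    expansion. It is Borel measurable, and injective because the base separates points.\<close>
  define J where "J x = (\<Sum>n. of_bool (x \<in> U n) * (1 / 3 :: real) ^ n)" for x
  have [measurable]: "J \<in> borel_measurable M"
    unfolding J_def by measurable
  have inj: "inj J"
  proof (rule injI, rule ccontr)
    fix x y assume "J x = J y" "x \<noteq> y"
    then have eq: "(\<lambda>n. x \<in> U n) = (\<lambda>n. y \<in> U n)"
      unfolding J_def by (intro sum_ternary_digits_inj)
    obtain V where "open V" "x \<in> V" "y \<notin> V" using t1_space \<open>x \<noteq> y\<close> by blast
    with \<B>(3)[of V] obtain C where "C \<in> \<B>" "x \<in> C" "y \<notin> C" by blast
    then show False using eq rU by (metis imageE)
  qed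
  have null: "emeasure M {x} = 0" for x
  proof (rule ccontr)
    assume "emeasure M {x} \<noteq> 0"
    then have "0 < emeasure M {x}" "{x} \<in> sets M" by (auto simp: zero_less_iff_neq_zero sets_eq_borel)
    then obtain B where "B \<subseteq> {x}" "0 < emeasure M B" "emeasure M B < emeasure M {x}"
      using nonatomic unfolding nonatomic_def by blast
    then show False by (auto simp: subset_singleton_iff)
  qed
  let ?b = "\<lambda>n. ball (undefined :: 'a) (Suc n)"
  have "(SUP n. emeasure M (?b n)) = emeasure M (\<Union>n. ?b n)"
  proof (intro SUP_emeasure_incseq)
    show "incseq ?b" by (intro incseq_SucI subset_ball) simp
  qed (auto simp: sets_eq_borel)
  also have "(\<Union>n. ?b n) = UNIV"
  proof (intro UNIV_eq_I[symmetric])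
    fix x :: 'a
    obtain n where "dist undefined x < real n" using reals_Archimedean2 by blast
    then show "x \<in> (\<Union>n. ?b n)" by (auto intro!: exI[of _ n])
  qed
  finally have "ennreal t < (SUP n. emeasure M (?b n))"
    by (simp only: emeasure_UNIV infinity_ennreal_def ennreal_less_top)
  then obtain n where n: "ennreal t < emeasure M (?b n)" by (auto simp: less_SUP_iff)
  define A where "A = ?b n"
  have [measurable]: "A \<in> sets M" by (simp add: A_def sets_eq_borel)
  have Afin: "emeasure M A < \<infinity>" unfolding A_def by (intro ball_finite) simp
  define D where "D = distr (restrict_space M A) borel J"
  have emD: "emeasure D S = emeasure M {x\<in>A. J x \<in> S}" if "S \<in> sets borel" for S
  proof -
    have "emeasure D S = emeasure (restrict_space M A) (J -` S \<inter> A)"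
      unfolding D_def using that by (subst emeasure_distr) (auto simp: space_restrict_space measurable_restrict_space1)
    also have "\<dots> = emeasure M {x\<in>A. J x \<in> S}"
      by (subst emeasure_restrict_space) (auto intro!: arg_cong[where f = "emeasure M"])
    finally show ?thesis .
  qed
  have "finite_measure D"
    using emD[of UNIV] Afin by (intro finite_measureI) (simp add: D_def)
  then interpret D: finite_borel_measure D
    by (intro finite_borel_measure.intro finite_borel_measure_axioms.intro) (simp_all add: D_def)
  have "isCont (cdf D) c" for c
  proof (subst D.isCont_cdf)
    have "{x\<in>A. J x \<in> {c}} \<subseteq> {the_inv J c}"
      using inj by (auto simp: the_inv_f_f)
    then have "emeasure M {x\<in>A. J x \<in> {c}} \<le> emeasure M {the_inv J c}"
      by (intro emeasure_mono) (auto simp: sets_eq_borel)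
    then show "measure D {c} = 0" using null by (simp add: measure_def emD)
  qed
  moreover have "emeasure D UNIV = emeasure M A" using emD[of UNIV] by simp
  then have "t < measure D UNIV"
    using n[folded A_def] Afin t
    by (cases "emeasure M A") (auto simp: measure_def ennreal_less_iff)
  then have "\<forall>\<^sub>F c in at_top. t < cdf D c"
    using D.cdf_lim_at_top by (intro order_tendstoD) (simp_all add: D_def)
  then obtain c2 where "t < cdf D c2" using eventually_happens' trivial_limit_at_top_linorder by blast
  moreover have "\<forall>\<^sub>F c in at_bot. cdf D c < t"
    using D.cdf_lim_at_bot t by (intro order_tendstoD)
  then have "\<forall>\<^sub>F c in at_bot. cdf D c < t \<and> c \<le> c2"
    using eventually_le_at_bot[of c2] by eventually_elim auto
  then obtain c1 where "cdf D c1 < t" "c1 \<le> c2"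
    using eventually_happens' trivial_limit_at_bot_linorder by blast
  ultimately obtain c where c: "cdf D c = t"
    using IVT[of "cdf D" c1 t c2] by (auto simp: less_imp_le)
  have "emeasure D {..c} = ennreal t"
    using c by (simp add: cdf_def D.emeasure_eq_measure)
  then have "emeasure M {x\<in>A. J x \<in> {..c}} = ennreal t" by (simp add: emD)
  moreover have "{x\<in>A. J x \<in> {..c}} \<in> sets M" by measurable
  ultimately show thesis by (rule that[rotated])
qed

section \<open>Rearrangement-invariant norms\<close>

lemma xnorm_cases:
  obtains "AE x in M. g x < \<infinity>" "xnorm M N g = N (\<lambda>x. enn2real (g x))" | "xnorm M N g = \<infinity>"
proof (cases "AE x in M. g x < \<infinity>")
  case True
  then show thesis by (intro that(1)) (simp_all add: xnorm_def)
next
  case False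
  then show thesis by (intro that(2)) (simp add: xnorm_def)
qed

context ri_space
begin

lemma norm_cong_AE:
  assumes "f \<in> borel_measurable M" "g \<in> borel_measurable M" "AE x in M. \<bar>f x\<bar> = \<bar>g x\<bar>"
  shows "N f = N g"
proof (rule antisym)
  show "N f \<le> N g" using assms by (intro lattice) auto
  show "N g \<le> N f" using assms by (intro lattice) auto
qed

lemma norm_sum_le:
  assumes "\<And>i. i \<in> I \<Longrightarrow> f i \<in> borel_measurable M"
  shows "N (\<lambda>x. \<Sum>i\<in>I. f i x) \<le> (\<Sum>i\<in>I. N (f i))"
proof (cases "finite I")
  case True
  then show ?thesis using assms
  proof (induction I)
    case (insert i I)
    have "N (\<lambda>x. f i x + (\<Sum>i\<in>I. f i x)) \<le> N (f i) + N (\<lambda>x. \<Sum>i\<in>I. f i x)"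
      using insert by (intro norm_triangle) auto
    also have "\<dots> \<le> N (f i) + (\<Sum>i\<in>I. N (f i))"
      using insert by (intro add_left_mono) auto
    finally show ?case using insert by simp
  qed (simp add: norm_eq_0_iff)
qed (simp add: norm_eq_0_iff)

text \<open>By homogeneity a common bound for all multiples forces the indicator to have norm 0.
  This will exclude that a series with summable norms is infinite on a set of positive
  measure.\<close>

lemma norm_indicator_eq_0:
  assumes A: "A \<in> sets M" and le: "\<And>m::nat. N (\<lambda>x. real m * indicator A x) \<le> R" and R: "R < \<infinity>"
  shows "AE x in M. x \<notin> A"
proof -
  let ?c = "N (indicator A)"
  have m: "ennreal (real m) * ?c \<le> R" for m
    using le[of m] norm_scale[of "indicator A" "real m"] A by simp
  have "?c = 0"
  proof (rule ccontr)
    assume "?c \<noteq> 0"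
    have "?c < top" using m[of 1] R by (simp add: le_less_trans infinity_ennreal_def)
    then obtain c where c: "?c = ennreal c" "0 < c"
      using \<open>?c \<noteq> 0\<close> by (cases ?c) (auto simp: less_le)
    obtain r where r: "0 \<le> r" "R = ennreal r" using R by (cases R) auto
    obtain n where n: "r / c < real n" using reals_Archimedean2 by blast
    have "ennreal (real n * c) \<le> ennreal r" using m[of n] c r by (simp add: ennreal_mult)
    then have "real n * c \<le> r" using r by (simp add: ennreal_le_iff)
    with n c show False by (simp add: field_simps)
  qed
  then have "AE x in M. indicator A x = (0::real)" using A by (subst (asm) norm_eq_0_iff) auto
  then show ?thesis by eventually_elim (auto simp: indicator_def split: if_splits)
qed

lemma norm_le_liminf:
  assumes "\<And>n. u n \<in> borel_measurable M" "f \<in> borel_measurable M"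
    and "AE x in M. (\<forall>n. 0 \<le> u n x) \<and> incseq (\<lambda>n. u n x) \<and> (\<lambda>n. u n x) \<longlonglongrightarrow> f x"
    and "\<And>n. N (u n) \<le> R"
  shows "N f \<le> R"
  using fatou[OF assms(1-3)] assms(4) by (intro LIMSEQ_le_const2) auto

text \<open>The countable triangle inequality follows from the finite one and the Fatou property.
  Since \<open>xnorm\<close> is infinite unless its argument is finite almost everywhere, finiteness
  of the sum needs its own argument.\<close>

lemma xnorm_suminf_le:
  fixes b :: "nat \<Rightarrow> 'a \<Rightarrow> real"
  assumes b [measurable]: "\<And>k. b k \<in> borel_measurable M" and b0: "\<And>k x. 0 \<le> b k x"
  shows "xnorm M N (\<lambda>x. \<Sum>k. ennreal (b k x)) \<le> (\<Sum>k. N (b k))"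
proof (cases "(\<Sum>k. N (b k)) < \<infinity>")
  case True
  let ?R = "\<Sum>k. N (b k)"
  define S where "S x = (\<Sum>k. ennreal (b k x))" for x
  define u where "u n x = (\<Sum>k<n. b k x)" for n x
  have [measurable]: "u n \<in> borel_measurable M" for n unfolding u_def by measurable
  have [measurable]: "S \<in> borel_measurable M" unfolding S_def by measurable
  have u0: "0 \<le> u n x" for n x unfolding u_def by (intro sum_nonneg b0)
  have umono: "incseq (\<lambda>n. u n x)" for x
    by (intro incseq_SucI) (simp add: u_def b0)
  have Nu: "N (u n) \<le> ?R" for n
  proof -
    have "N (u n) \<le> (\<Sum>k<n. N (b k))" unfolding u_def by (intro norm_sum_le) auto
    also have "\<dots> \<le> ?R" by (intro sum_le_suminf) auto
    finally show ?thesis .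
  qed
  have lim: "(\<lambda>n. ennreal (u n x)) \<longlonglongrightarrow> S x" for x
  proof -
    have "(\<lambda>n. \<Sum>k<n. ennreal (b k x)) \<longlonglongrightarrow> S x"
      unfolding S_def by (rule summable_LIMSEQ) simp
    then show ?thesis by (simp add: u_def b0 sum_ennreal)
  qed
  define A where "A = {x\<in>space M. S x = top}"
  have [measurable]: "A \<in> sets M" unfolding A_def by measurable
  have "AE x in M. x \<notin> A"
  proof (rule norm_indicator_eq_0[OF _ _ True])
    fix m :: nat
    \<comment> \<open>On \<open>A\<close> the partial sums truncated at \<open>m\<close> increase to
      \<open>m\<close>, and each of them has norm at most \<open>?R\<close>.\<close>
    show "N (\<lambda>x. real m * indicator A x) \<le> ?R"
    proof (rule norm_le_liminf)
      show "AE x in M. (\<forall>n. 0 \<le> min (u n x) (real m) * indicator A x) \<and>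
          incseq (\<lambda>n. min (u n x) (real m) * indicator A x) \<and>
          (\<lambda>n. min (u n x) (real m) * indicator A x) \<longlonglongrightarrow> real m * indicator A x"
      proof (intro AE_I2 conjI allI)
        fix x n
        show "0 \<le> min (u n x) (real m) * indicator A x" using u0[of n x] by simp
        show "incseq (\<lambda>n. min (u n x) (real m) * indicator A x)"
          using umono[of x] unfolding incseq_def
          by (intro allI impI mult_right_mono min.mono) auto
        show "(\<lambda>n. min (u n x) (real m) * indicator A x) \<longlonglongrightarrow> real m * indicator A x"
        proof (cases "x \<in> A")
          case True
          then have "(\<lambda>n. ennreal (u n x)) \<longlonglongrightarrow> top" using lim[of x] by (simp add: A_def)
          then have "\<forall>\<^sub>F n in sequentially. ennreal (real m) < ennreal (u n x)"
            by (rule order_tendstoD) simp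
          then have "\<forall>\<^sub>F n in sequentially. min (u n x) (real m) = real m"
            by eventually_elim (auto simp: ennreal_less_iff)
          then have "\<forall>\<^sub>F n in sequentially. min (u n x) (real m) * indicator A x = real m * indicator A x"
            by eventually_elim simp
          then show ?thesis by (rule tendsto_eventually)
        qed simp
      qed
      fix n
      have "N (\<lambda>x. min (u n x) (real m) * indicator A x) \<le> N (u n)"
        using u0 by (intro lattice) (auto simp: indicator_def)
      then show "N (\<lambda>x. min (u n x) (real m) * indicator A x) \<le> ?R" using Nu by (rule order_trans)
    qed measurable
  qed simp
  then have fin: "AE x in M. S x < \<infinity>"
    using AE_space by eventually_elim (auto simp: A_def less_top)
  moreover have "N (\<lambda>x. enn2real (S x)) \<le> ?R"
  proof (rule norm_le_liminf[OF _ _ _ Nu])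
    show "AE x in M. (\<forall>n. 0 \<le> u n x) \<and> incseq (\<lambda>n. u n x) \<and> (\<lambda>n. u n x) \<longlonglongrightarrow> enn2real (S x)"
      using fin
    proof eventually_elim
      fix x assume x: "S x < \<infinity>"
      then have "(\<lambda>n. ennreal (u n x)) \<longlonglongrightarrow> ennreal (enn2real (S x))"
        using lim[of x] by simp
      then have "(\<lambda>n. u n x) \<longlonglongrightarrow> enn2real (S x)"
        using u0 by (subst (asm) tendsto_ennreal_iff) auto
      then show "(\<forall>n. 0 \<le> u n x) \<and> incseq (\<lambda>n. u n x) \<and> (\<lambda>n. u n x) \<longlonglongrightarrow> enn2real (S x)"
        using u0 umono by auto
    qed
  qed measurable
  ultimately show ?thesis unfolding xnorm_def S_def by simp
qed (simp add: not_less top_unique)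

lemma xnorm_mono:
  assumes [measurable]: "g \<in> borel_measurable M" "h \<in> borel_measurable M"
    and C: "0 < C" and le: "AE x in M. g x \<le> ennreal C * h x"
  shows "xnorm M N g \<le> ennreal C * xnorm M N h"
proof (cases rule: xnorm_cases[where M = M and g = h and N = N])
  case 1
  have gC: "AE x in M. g x < \<infinity> \<and> \<bar>enn2real (g x)\<bar> \<le> \<bar>C * enn2real (h x)\<bar>"
    using 1(1) le
  proof eventually_elim
    fix x assume x: "h x < \<infinity>" "g x \<le> ennreal C * h x"
    then obtain r where r: "0 \<le> r" "h x = ennreal r" by (cases "h x") auto
    with x C have "g x \<le> ennreal (C * r)" by (simp add: ennreal_mult)
    moreover from this have "g x < \<infinity>" by (simp add: le_less_trans)
    ultimately show "g x < \<infinity> \<and> \<bar>enn2real (g x)\<bar> \<le> \<bar>C * enn2real (h x)\<bar>"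
      using r C by (auto intro: enn2real_leI)
  qed
  then have "N (\<lambda>x. enn2real (g x)) \<le> N (\<lambda>x. C * enn2real (h x))"
    by (intro lattice) auto
  also have "\<dots> = ennreal C * N (\<lambda>x. enn2real (h x))" using C by (subst norm_scale) auto
  finally show ?thesis using 1 gC by (simp add: xnorm_def)
qed (use C in \<open>simp add: ennreal_mult_top\<close>)

end

text \<open>A finite norm gives finiteness of the rearrangement only almost everywhere; monotonicity
  carries it to every \<open>s > 0\<close> from some point \<open>u < s\<close>.\<close>

lemma rearr_eq_real:
  assumes rep: "representation_space M N Nbar" and g: "g \<in> borel_measurable M" and fin: "N g < \<infinity>"
  shows "N g = Nbar (\<lambda>s. enn2real (rearr M g s))"
    and "0 < s \<Longrightarrow> rearr M g s = ennreal (enn2real (rearr M g s))"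
proof -
  have eq: "N g = xnorm half_line Nbar (rearr M g)"
    using rep g by (auto simp: representation_space_def)
  then have AE: "AE s in half_line. rearr M g s < \<infinity>"
    using fin by (auto simp: xnorm_def split: if_splits)
  then show "N g = Nbar (\<lambda>s. enn2real (rearr M g s))" using eq by (simp add: xnorm_def)
  assume s: "0 < s"
  have "\<exists>u. 0 < u \<and> u < s \<and> rearr M g u < \<infinity>"
  proof (rule ccontr)
    assume *: "\<not> (\<exists>u. 0 < u \<and> u < s \<and> rearr M g u < \<infinity>)"
    have "AE u in lborel. u \<notin> {0<..<s}"
      using AE[unfolded AE_half_line] by eventually_elim (use * in auto)
    then have "emeasure lborel {0<..<s} = 0"
      by (subst (asm) AE_iff_null_sets[symmetric]) auto
    with s show False by simp
  qed
  then obtain u where "0 < u" "u < s" "rearr M g u < \<infinity>" by blast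
  then have "rearr M g s < \<infinity>" using rearr_antimono[of u s M g] by (auto intro: le_less_trans)
  then show "rearr M g s = ennreal (enn2real (rearr M g s))" by simp
qed

lemma rearr_indicator:
  assumes E: "E \<in> sets M" "emeasure M E = ennreal t" and t: "0 < t" "0 < s"
  shows "rearr M (indicator E) s = indicator {0<..<t} s"
proof -
  have em: "emeasure M {x\<in>space M. l < \<bar>indicator E x :: real\<bar>} = (if l < 1 then ennreal t else 0)"
    if "0 \<le> l" for l
  proof (cases "l < 1")
    case True
    then have "{x\<in>space M. l < \<bar>indicator E x :: real\<bar>} = E"
      using that sets.sets_into_space[OF E(1)] by (auto simp: indicator_def)
    with True E show ?thesis by simp
  next
    case False
    then have "{x\<in>space M. l < \<bar>indicator E x :: real\<bar>} = {}" by (auto simp: indicator_def)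
    with False show ?thesis by (simp only: emeasure_empty if_False)
  qed
  \<comment> \<open>At \<open>s = t\<close> the level 0 is already admissible, so the resulting
    interval is open on the right.\<close>
  have le: "rearr M (indicator E) s \<le> ennreal l" if "0 \<le> l" "1 \<le> l \<or> t \<le> s" for l
    unfolding rearr_def using em[OF that(1)] that t by (intro INF_lower) (auto simp: ennreal_leI simp del: abs_indicator)
  show ?thesis
  proof (cases "s < t")
    case True
    have "1 \<le> rearr M (indicator E) s"
      unfolding rearr_def
    proof (rule INF_greatest, clarify)
      fix l assume "0 \<le> l" "emeasure M {x\<in>space M. l < \<bar>indicator E x :: real\<bar>} \<le> ennreal s"
      with em[of l] True t have "1 \<le> l" by (auto split: if_splits simp: ennreal_le_iff2)
      then show "1 \<le> ennreal l" by (metis ennreal_1 ennreal_leI)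
    qed
    with le[of 1] True t show ?thesis by (auto intro: antisym)
  next
    case False
    with le[of 0] show ?thesis by simp
  qed
qed

text \<open>The choice inside \<open>fundamental_function\<close> is meaningful because sets of
  every positive measure exist, and harmless because all indicators of sets of measure
  \<open>t\<close> have the same rearrangement.\<close>

lemma fundamental_function_eq:
  assumes mms: "metric_measure_space M" and rep: "representation_space M N Nbar" and t: "0 < t"
  shows "fundamental_function M N t = Nbar (indicator {0<..<t})"
proof -
  interpret metric_measure_space M by fact
  interpret half: ri_space half_line Nbar using rep by (simp add: representation_space_def)
  define E where "E = (SOME E. E \<in> sets M \<and> emeasure M E = ennreal t)"
  have "\<exists>E. E \<in> sets M \<and> emeasure M E = ennreal t" using ex_set_of_measure[OF t] by blast
  then have "E \<in> sets M \<and> emeasure M E = ennreal t" unfolding E_def by (rule someI_ex)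
  then have E: "E \<in> sets M" "emeasure M E = ennreal t" by auto
  have *: "rearr M (indicator E) s = indicator {0<..<t} s" if "0 < s" for s
    using rearr_indicator[OF E t that] .
  have "fundamental_function M N t = N (indicator E)"
    by (simp add: fundamental_function_def E_def)
  also have "\<dots> = xnorm half_line Nbar (rearr M (indicator E))"
    using rep E by (simp add: representation_space_def)
  also have "\<dots> = Nbar (\<lambda>s. enn2real (rearr M (indicator E) s))"
  proof -
    have "AE s in half_line. rearr M (indicator E) s < \<infinity>"
      by (intro AE_I2) (simp add: * indicator_def)
    then show ?thesis by (simp add: xnorm_def)
  qed
  also have "\<dots> = Nbar (indicator {0<..<t})"
    by (rule half.norm_cong_AE) (auto simp: * indicator_def intro!: AE_I2 measurable_half_line)
  finally show ?thesis .
qed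

section \<open>Operators on the half-line\<close>

lemma emeasure_lborel_affine:
  fixes c d :: real
  assumes [measurable]: "A \<in> sets borel" and c: "c \<noteq> 0"
  shows "emeasure lborel A = ennreal \<bar>c\<bar> * emeasure lborel {x. d + c * x \<in> A}"
proof -
  have "(\<integral>\<^sup>+x. indicator A x \<partial>lborel) = ennreal \<bar>c\<bar> * (\<integral>\<^sup>+x. indicator A (d + c * x) \<partial>lborel)"
    using c by (intro nn_integral_real_affine) auto
  also have "(\<integral>\<^sup>+x. indicator A (d + c * x) \<partial>lborel) = (\<integral>\<^sup>+x. indicator {x. d + c * x \<in> A} x \<partial>lborel)"
    by (intro nn_integral_cong) (simp add: indicator_def)
  finally show ?thesis by simp
qed

lemma emeasure_half_line_Collect:
  fixes F :: "real \<Rightarrow> real"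
  assumes "F \<in> borel_measurable half_line"
  shows "emeasure half_line {x\<in>space half_line. l < \<bar>F x\<bar>} = emeasure lborel {x. 0 < x \<and> l < \<bar>F x\<bar>}"
    and "{x. 0 < x \<and> l < \<bar>F x\<bar>} \<in> sets borel"
proof -
  have [measurable]: "(\<lambda>x. if 0 < x then F x else 0) \<in> borel_measurable borel"
    using assms by (simp add: measurable_half_line_real_iff)
  have eq: "{x. 0 < x \<and> l < \<bar>F x\<bar>} = {x\<in>space borel. 0 < x \<and> l < \<bar>if 0 < x then F x else 0\<bar>}"
    by auto
  show *: "{x. 0 < x \<and> l < \<bar>F x\<bar>} \<in> sets borel"
    unfolding eq by measurable
  have "{x\<in>space half_line. l < \<bar>F x\<bar>} = {x. 0 < x \<and> l < \<bar>F x\<bar>}" by auto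
  then show "emeasure half_line {x\<in>space half_line. l < \<bar>F x\<bar>} = emeasure lborel {x. 0 < x \<and> l < \<bar>F x\<bar>}"
    using * by (simp add: emeasure_half_line subset_eq)
qed

text \<open>The condition \<open>pos\<close> keeps \<open>F\<close> from being evaluated at
  nonpositive arguments, where its values are uncontrolled.\<close>

lemma measurable_half_line_comp:
  fixes F :: "real \<Rightarrow> real"
  assumes F: "F \<in> borel_measurable half_line" and T [measurable]: "T \<in> borel_measurable borel"
    and pos: "\<And>x. 0 < x \<Longrightarrow> P x \<Longrightarrow> 0 < T x" and P [measurable]: "Measurable.pred borel P"
  shows "(\<lambda>x. if P x then F (T x) else 0) \<in> borel_measurable half_line"
proof -
  have [measurable]: "(\<lambda>x. if 0 < x then F x else 0) \<in> borel_measurable borel"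
    using F by (simp add: measurable_half_line_real_iff)
  have "(\<lambda>x. if 0 < x \<and> P x then (\<lambda>x. if 0 < x then F x else 0) (T x) else 0) \<in> borel_measurable borel"
    by measurable
  also have "(\<lambda>x. if 0 < x \<and> P x then (\<lambda>x. if 0 < x then F x else 0) (T x) else 0) =
      (\<lambda>x. if 0 < x then if P x then F (T x) else 0 else 0)"
    using pos by auto
  finally show ?thesis by (simp add: measurable_half_line_real_iff)
qed

lemma measurable_half_line_dilate:
  fixes F :: "real \<Rightarrow> real"
  assumes "F \<in> borel_measurable half_line" "0 < s"
  shows "(\<lambda>t. F (t / s)) \<in> borel_measurable half_line"
  using measurable_half_line_comp[OF assms(1), of "\<lambda>t. t / s" "\<lambda>_. True"] assms(2) by simp

text \<open>A bound on the unit ball extends by homogeneity. When \<open>Nbar F = 0\<close> there is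
  nothing to normalise by; then all multiples of \<open>F\<close> stay in the unit ball, which
  forces the dilated function to have norm 0 as well.\<close>

lemma norm_dilate_le:
  assumes "ri_space half_line Nbar" and F: "F \<in> borel_measurable half_line" and s: "0 < s"
    and H: "dilation_norm Nbar s \<le> ennreal H" "0 < H"
  shows "Nbar (\<lambda>t. F (t / s)) \<le> ennreal H * Nbar F"
proof -
  interpret ri_space half_line Nbar by fact
  have Fs: "(\<lambda>t. F (t / s)) \<in> borel_measurable half_line"
    by (rule measurable_half_line_dilate[OF F s])
  have unit: "ennreal c * Nbar (\<lambda>t. F (t / s)) \<le> ennreal H" if "0 \<le> c" "ennreal c * Nbar F \<le> 1" for c
  proof -
    have "ennreal c * Nbar (\<lambda>t. F (t / s)) = Nbar (\<lambda>t. c * F (t / s))"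
      using norm_scale[OF Fs, of c] that by simp
    also have "\<dots> \<le> dilation_norm Nbar s"
      unfolding dilation_norm_def
      using that norm_scale[OF F, of c] F
      by (intro SUP_upper2[of "\<lambda>t. c * F t"]) auto
    finally show ?thesis using H by simp
  qed
  consider "Nbar F = top" | "Nbar F = 0" | r where "Nbar F = ennreal r" "0 < r"
    by (cases "Nbar F") (force simp: ennreal_eq_0_iff)+
  then show ?thesis
  proof cases
    case 1
    with H show ?thesis by (simp add: ennreal_mult_top)
  next
    case 2
    have le: "ennreal (real n) * Nbar (\<lambda>t. F (t / s)) \<le> ennreal H" for n
      using 2 by (intro unit) auto
    have "Nbar (\<lambda>t. F (t / s)) = 0"
    proof (rule ccontr)
      assume "Nbar (\<lambda>t. F (t / s)) \<noteq> 0"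
      moreover have "Nbar (\<lambda>t. F (t / s)) < top" using le[of 1] by (auto simp: le_less_trans)
      ultimately obtain c where c: "Nbar (\<lambda>t. F (t / s)) = ennreal c" "0 < c"
        by (cases "Nbar (\<lambda>t. F (t / s))") (auto simp: less_le)
      obtain n where n: "H / c < real n" using reals_Archimedean2 by blast
      have "ennreal (real n * c) \<le> ennreal H" using le[of n] c by (simp add: ennreal_mult)
      then have "real n * c \<le> H" using H by (simp add: ennreal_le_iff)
      with n c show False by (simp add: field_simps)
    qed
    then show ?thesis by simp
  next
    case (3 r)
    have "ennreal (1 / r) * Nbar F \<le> 1" using 3 by (simp add: ennreal_mult[symmetric])
    then have "ennreal (1 / r) * Nbar (\<lambda>t. F (t / s)) \<le> ennreal H" using 3 by (intro unit) auto
    then have "ennreal r * (ennreal (1 / r) * Nbar (\<lambda>t. F (t / s))) \<le> ennreal r * ennreal H"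
      by (rule mult_left_mono) simp
    also have "ennreal r * (ennreal (1 / r) * Nbar (\<lambda>t. F (t / s))) = Nbar (\<lambda>t. F (t / s))"
      using 3 by (simp add: mult.assoc[symmetric] ennreal_mult[symmetric])
    finally show ?thesis using 3 by (simp add: mult.commute)
  qed
qed

lemma norm_dilate_power_le:
  assumes ri: "ri_space half_line Nbar" and F: "F \<in> borel_measurable half_line" and s: "0 < s"
    and H: "dilation_norm Nbar s \<le> ennreal H" "0 < H"
  shows "Nbar (\<lambda>t. F (t / s ^ k)) \<le> ennreal (H ^ k) * Nbar F"
proof (induction k)
  case (Suc k)
  have "(\<lambda>t. F (t / s ^ k)) \<in> borel_measurable half_line"
    using measurable_half_line_dilate[OF F, of "s ^ k"] s by simp
  from norm_dilate_le[OF ri this s H]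
  have "Nbar (\<lambda>t. F (t / s ^ Suc k)) \<le> ennreal H * Nbar (\<lambda>t. F (t / s ^ k))"
    by (simp add: field_simps)
  also have "\<dots> \<le> ennreal H * (ennreal (H ^ k) * Nbar F)"
    using Suc by (rule mult_left_mono) simp
  finally show ?case using H by (simp add: ennreal_mult mult.assoc)
qed simp

text \<open>With \<open>k\<close> equal to 0 or 1, the parity condition selects the slots
  \<open>(2n + k, 2n + k + 1]\<close>. There \<open>\<lceil>t\<rceil> = 2n + k + 1\<close>, so the
  subtracted term is \<open>n + k\<close> and the slot is translated onto \<open>(n, n + 1]\<close>.
  Summing over \<open>n\<close> gives the equality.\<close>

lemma emeasure_spread:
  fixes A :: "real set" and k :: int
  assumes A [measurable]: "A \<in> sets borel" and A0: "A \<subseteq> {0<..}" and k: "0 \<le> k" "k \<le> 1"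
  shows "emeasure lborel {t. 0 < t \<and> even (\<lceil>t\<rceil> - k - 1) \<and> t - real_of_int (\<lceil>t\<rceil> + k - 1) / 2 \<in> A} =
    emeasure lborel A"
proof -
  define B where "B n = {t. real (2 * n) + k < t \<and> t \<le> real (2 * n) + k + 1 \<and> t - (real n + k) \<in> A}" for n
  define A' where "A' n = A \<inter> {real n<..real n + 1}" for n
  have [measurable]: "B n \<in> sets borel" for n unfolding B_def by measurable
  have [measurable]: "A' n \<in> sets borel" for n unfolding A'_def by measurable
  have dB: "disjoint_family B"
    unfolding disjoint_family_on_def
  proof (intro ballI impI)
    fix m n :: nat assume "m \<noteq> n"
    then have "real m + 1 \<le> real n \<or> real n + 1 \<le> real m" by linarith
    then show "B m \<inter> B n = {}" by (auto simp: B_def)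
  qed
  have dA: "disjoint_family A'"
    unfolding disjoint_family_on_def
  proof (intro ballI impI)
    fix m n :: nat assume "m \<noteq> n"
    then have "real m + 1 \<le> real n \<or> real n + 1 \<le> real m" by linarith
    then show "A' m \<inter> A' n = {}" by (auto simp: A'_def)
  qed
  have B: "{t. 0 < t \<and> even (\<lceil>t\<rceil> - k - 1) \<and> t - real_of_int (\<lceil>t\<rceil> + k - 1) / 2 \<in> A} = (\<Union>n. B n)"
  proof (intro set_eqI iffI)
    fix t assume "t \<in> {t. 0 < t \<and> even (\<lceil>t\<rceil> - k - 1) \<and> t - real_of_int (\<lceil>t\<rceil> + k - 1) / 2 \<in> A}"
    then have t: "0 < t" "even (\<lceil>t\<rceil> - k - 1)" "t - real_of_int (\<lceil>t\<rceil> + k - 1) / 2 \<in> A" by auto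
    from t(2) obtain j where j: "\<lceil>t\<rceil> - k - 1 = 2 * j" by (rule evenE)
    have "1 \<le> \<lceil>t\<rceil>" using t(1) by (simp add: one_le_ceiling)
    with j k have "0 \<le> j" by linarith
    then obtain n where n: "j = int n" using zero_le_imp_eq_int by blast
    have c: "\<lceil>t\<rceil> = 2 * int n + k + 1" using j n by simp
    then have "2 * real n + k < t" "t \<le> 2 * real n + k + 1"
      using ceiling_correct[of t] by auto
    moreover have "t - real_of_int (\<lceil>t\<rceil> + k - 1) / 2 = t - (real n + k)" using c by (simp add: field_simps)
    then have "t - (real n + k) \<in> A" using t(3) by (simp only:)
    ultimately have "t \<in> B n" by (simp add: B_def)
    then show "t \<in> (\<Union>n. B n)" by blast
  next
    fix t assume "t \<in> (\<Union>n. B n)"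
    then obtain n where n: "2 * real n + k < t" "t \<le> 2 * real n + k + 1" "t - (real n + k) \<in> A"
      by (auto simp: B_def)
    have c: "\<lceil>t\<rceil> = 2 * int n + k + 1" using n by (intro ceiling_unique) auto
    have "t - real_of_int (\<lceil>t\<rceil> + k - 1) / 2 = t - (real n + k)" using c by (simp add: field_simps)
    then have "t - real_of_int (\<lceil>t\<rceil> + k - 1) / 2 \<in> A" using n(3) by (simp only:)
    moreover have "0 < t"
    proof -
      have "0 \<le> 2 * real n + k" using k by simp
      with n show ?thesis by linarith
    qed
    ultimately show "t \<in> {t. 0 < t \<and> even (\<lceil>t\<rceil> - k - 1) \<and> t - real_of_int (\<lceil>t\<rceil> + k - 1) / 2 \<in> A}"
      unfolding mem_Collect_eq using c by (intro conjI) simp_all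
  qed
  have A': "A = (\<Union>n. A' n)"
  proof (intro set_eqI iffI)
    fix x assume x: "x \<in> A"
    then have "0 < x" using A0 by auto
    then have "1 \<le> \<lceil>x\<rceil>" by (simp add: one_le_ceiling)
    then obtain n where n: "\<lceil>x\<rceil> - 1 = int n" using zero_le_imp_eq_int[of "\<lceil>x\<rceil> - 1"] by auto
    then have "\<lceil>x\<rceil> = int n + 1" by simp
    then have "real n < x" "x \<le> real n + 1" using ceiling_correct[of x] by auto
    with x show "x \<in> (\<Union>n. A' n)" by (auto simp: A'_def)
  qed (auto simp: A'_def)
  have "emeasure lborel (B n) = emeasure lborel (A' n)" for n
  proof -
    have "emeasure lborel (A' n) = emeasure lborel {x. - (real n + k) + 1 * x \<in> A' n}"
      using emeasure_lborel_affine[of "A' n" 1 "- (real n + k)"] by simp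
    also have "{x. - (real n + k) + 1 * x \<in> A' n} = B n"
      by (auto simp: A'_def B_def algebra_simps)
    finally show ?thesis by simp
  qed
  then have "(\<Sum>n. emeasure lborel (B n)) = (\<Sum>n. emeasure lborel (A' n))" by simp
  moreover have "(\<Sum>n. emeasure lborel (B n)) = emeasure lborel (\<Union>n. B n)"
    using dB by (intro suminf_emeasure) auto
  moreover have "(\<Sum>n. emeasure lborel (A' n)) = emeasure lborel (\<Union>n. A' n)"
    using dA by (intro suminf_emeasure) auto
  ultimately show ?thesis using B A' by metis
qed

text \<open>\<open>F(t/2)\<close> is equimeasurable to the sum of two disjointly supported copies of \<open>F\<close>, obtained
  by moving the pieces of \<open>F\<close> on \<open>(n, n + 1]\<close> to \<open>(2n, 2n + 1]\<close> and to \<open>(2n + 1, 2n + 2]\<close>.\<close>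

lemma dilation_norm_2_le:
  assumes "ri_space half_line Nbar"
  shows "dilation_norm Nbar 2 \<le> 2"
  unfolding dilation_norm_def
proof (rule SUP_least, clarify)
  interpret ri_space half_line Nbar by fact
  fix F :: "real \<Rightarrow> real" assume F: "F \<in> borel_measurable half_line" "Nbar F \<le> 1"
  define G where "G k t = (if even (\<lceil>t\<rceil> - k - 1) then F (t - real_of_int (\<lceil>t\<rceil> + k - 1) / 2) else 0)"
    for k :: int and t
  \<comment> \<open>The shifted argument stays positive, where \<open>F\<close> is controlled; for
    \<open>\<lceil>t\<rceil> = 1\<close> parity excludes \<open>k = 1\<close>.\<close>
  have pos: "0 < t - real_of_int (\<lceil>t\<rceil> + k - 1) / 2"
    if "0 < t" "even (\<lceil>t\<rceil> - k - 1)" "0 \<le> k" "k \<le> 1" for t k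
  proof -
    have "real_of_int \<lceil>t\<rceil> < t + 1" using ceiling_correct[of t] by linarith
    show ?thesis
    proof (cases "\<lceil>t\<rceil> = 1")
      case True
      with that have "k = 0" by (cases "k = 0") (auto dest!: order_antisym[of k 1])
      with True that show ?thesis by simp
    next
      case False
      moreover have "1 \<le> \<lceil>t\<rceil>" using that by (simp add: one_le_ceiling)
      ultimately have "2 \<le> \<lceil>t\<rceil>" by linarith
      then have "1 < t" by (simp add: less_ceiling_iff le_ceiling_iff)
      have "real_of_int k \<le> 1" using that by simp
      then show ?thesis using \<open>real_of_int \<lceil>t\<rceil> < t + 1\<close> \<open>1 < t\<close> by simp
    qed
  qed
  have Gm: "G k \<in> borel_measurable half_line" if "0 \<le> k" "k \<le> 1" for k
    unfolding G_def by (rule measurable_half_line_comp[OF F(1)]) (use pos that in \<open>auto\<close>)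
  have distr: "emeasure half_line {t\<in>space half_line. l < \<bar>G k t\<bar>} =
      emeasure half_line {t\<in>space half_line. l < \<bar>F t\<bar>}" if "0 \<le> l" "0 \<le> k" "k \<le> 1" for l k
  proof -
    have "{t. 0 < t \<and> l < \<bar>G k t\<bar>} = {t. 0 < t \<and> even (\<lceil>t\<rceil> - k - 1) \<and>
        t - real_of_int (\<lceil>t\<rceil> + k - 1) / 2 \<in> {x. 0 < x \<and> l < \<bar>F x\<bar>}}"
      using pos that by (auto simp: G_def split: if_splits)
    moreover have "emeasure lborel \<dots> = emeasure lborel {x. 0 < x \<and> l < \<bar>F x\<bar>}"
      using that by (intro emeasure_spread emeasure_half_line_Collect F) auto
    ultimately show ?thesis
      using emeasure_half_line_Collect(1)[OF F(1), of l] emeasure_half_line_Collect(1)[OF Gm[OF that(2,3)], of l]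
      by (simp only:)
  qed
  have "rearr half_line (G k) t = rearr half_line F t" if "0 \<le> k" "k \<le> 1" for k t
    by (intro rearr_cong_distr distr that)
  then have NG: "Nbar (G k) = Nbar F" if "0 \<le> k" "k \<le> 1" for k
    using that by (intro rearrangement_invariant Gm F)
  have "Nbar (\<lambda>t. F (t / 2)) = Nbar (\<lambda>t. G 0 t + G 1 t)"
  proof (rule rearrangement_invariant)
    show "(\<lambda>t. F (t / 2)) \<in> borel_measurable half_line"
      by (rule measurable_half_line_dilate[OF F(1)]) simp
    have G01: "G 0 t = 0 \<or> G 1 t = 0" for t by (auto simp: G_def)
    have [measurable]: "G 0 \<in> borel_measurable half_line" "G 1 \<in> borel_measurable half_line"
      by (auto intro: Gm)
    show Gs: "(\<lambda>t. G 0 t + G 1 t) \<in> borel_measurable half_line" by measurable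
    fix t :: real
    show "rearr half_line (\<lambda>t. F (t / 2)) t = rearr half_line (\<lambda>t. G 0 t + G 1 t) t"
    proof (rule rearr_cong_distr)
      fix l :: real assume l: "0 \<le> l"
      \<comment> \<open>Both sides have measure \<open>2 * ?m\<close>: dilation by 2 doubles
        lengths, and the two copies of \<open>F\<close> have disjoint supports and contribute
        \<open>?m\<close> each.\<close>
      let ?m = "emeasure lborel {t. 0 < t \<and> l < \<bar>F t\<bar>}"
      have "?m = ennreal (1 / 2) * emeasure lborel {t. 0 < t \<and> l < \<bar>F (t / 2)\<bar>}"
        using emeasure_lborel_affine[OF emeasure_half_line_Collect(2)[OF F(1), of l], of "1 / 2" 0]
        by simp
      then have "2 * ?m = ennreal 2 * (ennreal (1 / 2) * emeasure lborel {t. 0 < t \<and> l < \<bar>F (t / 2)\<bar>})"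
        by simp
      also have "\<dots> = emeasure lborel {t. 0 < t \<and> l < \<bar>F (t / 2)\<bar>}"
        by (subst mult.assoc[symmetric], subst ennreal_mult[symmetric]) auto
      finally have 1: "emeasure half_line {t\<in>space half_line. l < \<bar>F (t / 2)\<bar>} = 2 * ?m"
        using emeasure_half_line_Collect(1)[OF measurable_half_line_dilate[OF F(1), of 2], of l]
        by simp
      have "{t\<in>space half_line. l < \<bar>G 0 t + G 1 t\<bar>} =
          {t\<in>space half_line. l < \<bar>G 0 t\<bar>} \<union> {t\<in>space half_line. l < \<bar>G 1 t\<bar>}"
      proof (intro set_eqI)
        fix t show "t \<in> {t\<in>space half_line. l < \<bar>G 0 t + G 1 t\<bar>} \<longleftrightarrow>
          t \<in> {t\<in>space half_line. l < \<bar>G 0 t\<bar>} \<union> {t\<in>space half_line. l < \<bar>G 1 t\<bar>}"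
          using G01[of t] l by auto
      qed
      moreover have "{t\<in>space half_line. l < \<bar>G 0 t\<bar>} \<inter> {t\<in>space half_line. l < \<bar>G 1 t\<bar>} = {}"
      proof (intro equals0I)
        fix t assume "t \<in> {t\<in>space half_line. l < \<bar>G 0 t\<bar>} \<inter> {t\<in>space half_line. l < \<bar>G 1 t\<bar>}"
        then show False using G01[of t] l by auto
      qed
      moreover have "emeasure half_line ({t\<in>space half_line. l < \<bar>G 0 t\<bar>} \<union> {t\<in>space half_line. l < \<bar>G 1 t\<bar>}) =
          emeasure half_line {t\<in>space half_line. l < \<bar>G 0 t\<bar>} + emeasure half_line {t\<in>space half_line. l < \<bar>G 1 t\<bar>}"
        if "{t\<in>space half_line. l < \<bar>G 0 t\<bar>} \<inter> {t\<in>space half_line. l < \<bar>G 1 t\<bar>} = {}"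
        by (rule plus_emeasure[symmetric, OF _ _ that]) measurable
      ultimately have "emeasure half_line {t\<in>space half_line. l < \<bar>G 0 t + G 1 t\<bar>} =
          emeasure half_line {t\<in>space half_line. l < \<bar>F t\<bar>} + emeasure half_line {t\<in>space half_line. l < \<bar>F t\<bar>}"
        using distr[OF l, of 0] distr[OF l, of 1] by simp
      also have "\<dots> = 2 * ?m"
        using emeasure_half_line_Collect(1)[OF F(1), of l] by (simp add: mult_2)
      finally show "emeasure half_line {t\<in>space half_line. l < \<bar>F (t / 2)\<bar>} =
          emeasure half_line {t\<in>space half_line. l < \<bar>G 0 t + G 1 t\<bar>}" using 1 by simp
    qed
  qed
  also have "\<dots> \<le> Nbar (G 0) + Nbar (G 1)" by (intro norm_triangle Gm) auto
  also have "\<dots> = 2 * Nbar F" by (simp add: NG mult_2)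
  also have "\<dots> \<le> 2" using mult_left_mono[OF F(2), of 2] by simp
  finally show "Nbar (\<lambda>t. F (t / 2)) \<le> 2" .
qed

text \<open>The infimum is tested at \<open>s = 2\<close>, where the bound 2 for the dilation norm
  gives the quotient \<open>ln 2 / ln 2\<close>.\<close>

lemma upper_boyd_index_le_1:
  assumes "ri_space half_line Nbar"
  shows "upper_boyd_index Nbar \<le> 1"
proof -
  have "eln (dilation_norm Nbar 2) \<le> ereal (ln 2)"
  proof (cases "dilation_norm Nbar 2")
    case (real r)
    then have "r \<le> 2" using dilation_norm_2_le[OF assms] by (simp flip: ennreal_numeral add: ennreal_le_iff)
    with real show ?thesis by (auto simp: eln_def less_le)
  qed (use dilation_norm_2_le[OF assms] in \<open>simp add: top_unique\<close>)
  then have "eln (dilation_norm Nbar 2) / ereal (ln 2) \<le> ereal (ln 2) / ereal (ln 2)"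
    by (intro ereal_divide_right_mono) auto
  then have "eln (dilation_norm Nbar 2) / ereal (ln 2) \<le> 1" by (simp add: one_ereal_def)
  then show ?thesis unfolding upper_boyd_index_def by (intro INF_lower2[of 2]) auto
qed

lemma upper_boyd_index_lessE:
  assumes "upper_boyd_index Nbar < ereal (1 / a)" "0 < a"
  obtains s H where "1 < s" "0 < H" "H < s powr (1 / a)" "dilation_norm Nbar s \<le> ennreal H"
proof -
  obtain s where s: "1 < s" "eln (dilation_norm Nbar s) / ereal (ln s) < ereal (1 / a)"
    using assms unfolding upper_boyd_index_def by (auto simp: INF_less_iff)
  have "0 < ln s" using s by simp
  then have lt: "eln (dilation_norm Nbar s) < ereal (1 / a * ln s)"
    using s(2) by (simp add: ereal_divide_less_iff mult.commute)
  have d: "dilation_norm Nbar s < ennreal (s powr (1 / a))"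
  proof (cases "dilation_norm Nbar s")
    case (real r)
    show ?thesis
    proof (cases "r = 0")
      case False
      then have "ln r < 1 / a * ln s" using lt real by (simp add: eln_def)
      then have "exp (ln r) < exp (1 / a * ln s)" by (rule exp_less_mono)
      then have "r < s powr (1 / a)" using False real s by (simp add: powr_def)
      with real show ?thesis by (simp add: ennreal_less_iff)
    qed (use real s in simp)
  qed (use lt in \<open>simp add: eln_def\<close>)
  then obtain r where r: "0 \<le> r" "dilation_norm Nbar s = ennreal r" by (cases "dilation_norm Nbar s") auto
  with d have "r < s powr (1 / a)" by (simp add: ennreal_less_iff)
  \<comment> \<open>The midpoint stays below \<open>s powr (1 / a)\<close> and is positive even if
    the dilation norm is 0.\<close>
  then show thesis
    using s r by (intro that[of s "(r + s powr (1 / a)) / 2"]) (auto intro!: ennreal_leI add_nonneg_pos)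
qed

section \<open>Averaging over an interval by cyclic translates\<close>

lemma sum_mod_shift:
  fixes g :: "nat \<Rightarrow> 'b::comm_monoid_add"
  assumes "0 < n"
  shows "(\<Sum>i<n. g ((i + j) mod n)) = (\<Sum>i<n. g i)"
proof (induction j)
  case (Suc j)
  obtain m where m: "n = Suc m" using assms by (cases n) auto
  have "(\<Sum>i<n. g ((i + Suc j) mod n)) = (\<Sum>i<m. g ((Suc i + j) mod n)) + g ((n + j) mod n)"
    by (simp add: m)
  also have "\<dots> = g ((0 + j) mod n) + (\<Sum>i<m. g ((Suc i + j) mod n))"
    by (simp add: add.commute)
  also have "\<dots> = (\<Sum>i<n. g ((i + j) mod n))"
    unfolding m by (subst sum.lessThan_Suc_shift) simp
  finally show ?case using Suc by simp
qed simp

lemma sum_mult_indicator_eq: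
  fixes a :: "nat \<Rightarrow> real"
  assumes "i < n" "s \<in> I i" and uniq: "\<And>k. s \<in> I k \<Longrightarrow> k = i"
  shows "(\<Sum>k<n. a k * indicator (I k) s) = a i"
proof -
  have "a k * indicator (I k) s = (if k = i then a k else 0)" for k
    using assms(2) uniq[of k] by (cases "k = i") (auto simp: indicator_def)
  then have "(\<Sum>k<n. a k * indicator (I k) s) = (\<Sum>k<n. if k = i then a k else 0)"
    by (intro sum.cong refl)
  with assms(1) show ?thesis by simp
qed

text \<open>The average of the cyclic translates of a step function is constant, and the translates are
  equimeasurable, so the triangle inequality bounds the norm of the constant.\<close>

lemma norm_cyclic_average_le:
  fixes a :: "nat \<Rightarrow> real" and d :: real
  assumes "ri_space half_line Nbar" and n: "0 < n" and d: "0 < d" and a: "\<And>i. 0 \<le> a i"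
  shows "ennreal (\<Sum>i<n. a i) * Nbar (indicator {0<..real n * d}) \<le>
    of_nat n * Nbar (\<lambda>s. \<Sum>i<n. a i * indicator {real i * d<..real (Suc i) * d} s)"
proof -
  interpret ri_space half_line Nbar by fact
  define I where "I i = {real i * d<..real (Suc i) * d}" for i
  \<comment> \<open>\<open>j\<close> counts the places by which the values are shifted cyclically;
    \<open>h 0\<close> is the given step function.\<close>
  define h where "h j s = (\<Sum>i<n. a ((i + j) mod n) * indicator (I i) s)" for j s
  have [measurable]: "h j \<in> borel_measurable half_line" for j
    unfolding h_def I_def by (intro measurable_half_line) measurable
  have Idisj: "i = i'" if "s \<in> I i" "s \<in> I i'" for s i i'
  proof (rule ccontr)
    assume "i \<noteq> i'"
    then have "real (Suc i) \<le> real i' \<or> real (Suc i') \<le> real i" by linarith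
    then have "real (Suc i) * d \<le> real i' * d \<or> real (Suc i') * d \<le> real i * d"
      using d by (auto intro: mult_right_mono)
    with that show False by (auto simp: I_def)
  qed
  have Ipos: "0 < s" if "s \<in> I i" for s i
  proof -
    have "0 \<le> real i * d" using d by simp
    with that show ?thesis unfolding I_def by simp
  qed
  have h: "h j s = a ((i + j) mod n)" if "i < n" "s \<in> I i" for i j s
    unfolding h_def by (rule sum_mult_indicator_eq[where I = I]) (fact that, fact that, rule Idisj[OF _ that(2)])
  have h0: "h j s = 0" if "\<And>i. i < n \<Longrightarrow> s \<notin> I i" for j s
    unfolding h_def using that by (intro sum.neutral) (simp add: indicator_def)
  have Isub: "I i \<subseteq> {0<..}" for i by (intro subsetI greaterThan_iff[THEN iffD2] Ipos)
  have [measurable]: "I i \<in> sets borel" for i by (simp add: I_def)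
  have emI: "emeasure half_line (I i) = ennreal d" for i
  proof -
    have "emeasure half_line (I i) = emeasure lborel (I i)"
      by (intro emeasure_half_line Isub) simp
    also have "\<dots> = ennreal (real (Suc i) * d - real i * d)"
      unfolding I_def using d by (intro emeasure_lborel_Ioc) simp
    finally show ?thesis by (simp add: algebra_simps)
  qed
  have Isets: "I i \<in> sets half_line" for i
    using Isub by (simp add: sets_half_line sets_restrict_space_iff)
  have "emeasure half_line {s\<in>space half_line. l < \<bar>h j s\<bar>} =
      (\<Sum>i<n. (if l < a i then ennreal d else 0))" if l: "0 \<le> l" for l j
  proof -
    have "{s\<in>space half_line. l < \<bar>h j s\<bar>} = (\<Union>i\<in>{i\<in>{..<n}. l < a ((i + j) mod n)}. I i)"
    proof (intro set_eqI iffI)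
      fix s assume s: "s \<in> {s\<in>space half_line. l < \<bar>h j s\<bar>}"
      then obtain i where i: "i < n" "s \<in> I i" using h0[of s j] l by fastforce
      with s h[OF i, of j] a show "s \<in> (\<Union>i\<in>{i\<in>{..<n}. l < a ((i + j) mod n)}. I i)" by auto
    next
      fix s assume "s \<in> (\<Union>i\<in>{i\<in>{..<n}. l < a ((i + j) mod n)}. I i)"
      then obtain i where i: "i < n" "s \<in> I i" "l < a ((i + j) mod n)" by auto
      then show "s \<in> {s\<in>space half_line. l < \<bar>h j s\<bar>}"
        using h[OF i(1,2), of j] Ipos[OF i(2)] by (simp only: space_half_line) auto
    qed
    also have "emeasure half_line \<dots> = (\<Sum>i\<in>{i\<in>{..<n}. l < a ((i + j) mod n)}. emeasure half_line (I i))"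
      using Isets
      by (intro sum_emeasure[symmetric]) (auto simp: disjoint_family_on_def dest: Idisj)
    also have "\<dots> = (\<Sum>i<n. if l < a ((i + j) mod n) then ennreal d else 0)"
      by (simp add: emI sum.inter_filter[symmetric])
    also have "\<dots> = (\<Sum>i<n. if l < a i then ennreal d else 0)"
      by (rule sum_mod_shift[OF n, of "\<lambda>i. if l < a i then ennreal d else 0"])
    finally show ?thesis .
  qed
  then have "rearr half_line (h j) t = rearr half_line (h 0) t" for j t
    by (intro rearr_cong_distr) simp
  then have Nh: "Nbar (h j) = Nbar (h 0)" for j
    by (intro rearrangement_invariant) auto
  have cover: "(\<Sum>i<m. indicator (I i) s) = (indicator {0<..real m * d} s :: real)" for m s
  proof (induction m)
    case (Suc m)
    define p where "p = real m * d"
    have p: "0 \<le> p" "real (Suc m) * d = p + d" using d by (simp_all add: p_def algebra_simps)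
    have "indicator {0<..p} s + indicator {p<..p + d} s = (indicator {0<..p + d} s :: real)"
      using p(1) d by (auto simp: indicator_def)
    then show ?case
      unfolding sum.lessThan_Suc Suc unfolding I_def p(2) p_def[symmetric] .
  qed simp
  \<comment> \<open>Summed over all shifts, each interval receives every value exactly once.\<close>
  have "(\<Sum>j<n. h j s) = (\<Sum>i<n. a i) * indicator {0<..real n * d} s" for s
  proof -
    have "(\<Sum>j<n. h j s) = (\<Sum>i<n. \<Sum>j<n. a ((j + i) mod n) * indicator (I i) s)"
      unfolding h_def by (subst sum.swap) (simp add: add.commute)
    also have "\<dots> = (\<Sum>i<n. (\<Sum>k<n. a k) * indicator (I i) s)"
      by (simp add: sum_distrib_right[symmetric] sum_mod_shift[OF n])
    finally show ?thesis by (simp add: sum_distrib_left[symmetric] cover)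
  qed
  then have "Nbar (\<lambda>s. (\<Sum>i<n. a i) * indicator {0<..real n * d} s) = Nbar (\<lambda>s. \<Sum>j<n. h j s)"
    by simp
  also have "\<dots> \<le> (\<Sum>j<n. Nbar (h j))" by (intro norm_sum_le) simp
  also have "\<dots> = of_nat n * Nbar (h 0)" by (subst Nh) simp
  finally have "Nbar (\<lambda>s. (\<Sum>i<n. a i) * indicator {0<..real n * d} s) \<le> of_nat n * Nbar (h 0)" .
  moreover have "h 0 = (\<lambda>s. \<Sum>i<n. a i * indicator {real i * d<..real (Suc i) * d} s)"
    unfolding h_def I_def by (intro ext sum.cong) auto
  moreover have "Nbar (\<lambda>s. (\<Sum>i<n. a i) * indicator {0<..real n * d} s) =
      ennreal (\<Sum>i<n. a i) * Nbar (indicator {0<..real n * d})"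
    using norm_scale[of "indicator {0<..real n * d}" "\<Sum>i<n. a i"] a
    by (simp add: sum_nonneg measurable_half_line)
  ultimately show ?thesis by simp
qed

text \<open>The cyclic inequality is applied to a step function below \<open>\<gamma>\<close> on
  equal subintervals of \<open>(0, t]\<close>. Its average dominates the part of the mean outside
  the first subinterval, where \<open>\<gamma>\<close> may be unbounded, and that subinterval
  disappears as the partition is refined.\<close>

lemma norm_indicator_average_le:
  fixes \<gamma> :: "real \<Rightarrow> real"
  assumes ri: "ri_space half_line Nbar" and t: "0 < t"
    and \<gamma>: "\<And>s. 0 \<le> \<gamma> s" "\<And>s u. 0 < s \<Longrightarrow> s \<le> u \<Longrightarrow> \<gamma> u \<le> \<gamma> s"
    and \<gamma>m [measurable]: "\<gamma> \<in> borel_measurable borel"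
  shows "Nbar (indicator {0<..<t}) * ((\<integral>\<^sup>+s\<in>{0<..<t}. ennreal (\<gamma> s) \<partial>lborel) / ennreal t) \<le> Nbar \<gamma>"
proof -
  interpret ri_space half_line Nbar by fact
  define J where "J n = (\<integral>\<^sup>+s\<in>{t / real (Suc n)<..<t}. ennreal (\<gamma> s) \<partial>lborel)" for n
  have step: "Nbar (indicator {0<..<t}) * (J n / ennreal t) \<le> Nbar \<gamma>" for n
  proof -
    define m where "m = Suc n"
    define d where "d = t / real m"
    have m: "0 < m" "0 < d" "real m * d = t" using t by (auto simp: m_def d_def)
    \<comment> \<open>The value at the right endpoint bounds the decreasing \<open>\<gamma>\<close>
      from below on its own subinterval and from above on the next one. This shift is why
      \<open>J n\<close> omits the first subinterval.\<close>
    define a where "a i = \<gamma> (real (Suc i) * d)" for i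
    have a: "0 \<le> a i" for i by (simp add: a_def \<gamma>)
    define f where "f s = (\<Sum>i<m. a i * indicator {real i * d<..real (Suc i) * d} s)" for s
    have fm [measurable]: "f \<in> borel_measurable borel" unfolding f_def[abs_def] by measurable
    have gt: "\<gamma> s \<le> a i" if "real (Suc i) * d < s" for i s
      unfolding a_def using that m by (intro \<gamma>(2)) auto
    have disj: "i = i'" if "s \<in> {real i * d<..real (Suc i) * d}" "s \<in> {real i' * d<..real (Suc i') * d}" for s i i'
    proof (rule ccontr)
      assume "i \<noteq> i'"
      then have "real (Suc i) \<le> real i' \<or> real (Suc i') \<le> real i" by linarith
      then have "real (Suc i) * d \<le> real i' * d \<or> real (Suc i') * d \<le> real i * d"
        using m by (auto intro: mult_right_mono)
      with that show False by auto
    qed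
    have "Nbar f \<le> Nbar \<gamma>"
    proof (rule lattice)
      show "AE s in half_line. \<bar>f s\<bar> \<le> \<bar>\<gamma> s\<bar>"
      proof (rule AE_I2)
        fix s assume s: "s \<in> space half_line"
        show "\<bar>f s\<bar> \<le> \<bar>\<gamma> s\<bar>"
        proof (cases "\<exists>i<m. s \<in> {real i * d<..real (Suc i) * d}")
          case True
          then obtain i where i: "i < m" "s \<in> {real i * d<..real (Suc i) * d}" by blast
          have "f s = a i"
            unfolding f_def
            by (rule sum_mult_indicator_eq[where I = "\<lambda>i. {real i * d<..real (Suc i) * d}"])
              (fact i, fact i, rule disj[OF _ i(2)])
          also have "\<dots> \<le> \<gamma> s" unfolding a_def using s i by (intro \<gamma>(2)) auto
          finally show ?thesis using a \<gamma> by (simp add: f_def sum_nonneg)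
        next
          case False
          then have "f s = 0" unfolding f_def by (intro sum.neutral) (auto simp: indicator_def)
          then show ?thesis by simp
        qed
      qed
    qed (auto intro!: measurable_half_line)
    moreover have "ennreal (\<Sum>i<m. a i) * Nbar (indicator {0<..t}) \<le> of_nat m * Nbar f"
      using norm_cyclic_average_le[OF ri m(1,2), of a] a m(3) by (simp add: f_def[abs_def])
    moreover have "Nbar (indicator {0<..t}) = Nbar (indicator {0<..<t})"
    proof (rule norm_cong_AE)
      show "AE s in half_line. \<bar>indicator {0<..t} s\<bar> = \<bar>indicator {0<..<t} s :: real\<bar>"
        unfolding AE_half_line using AE_lborel_singleton[of t]
        by eventually_elim (auto simp: indicator_def)
    qed (auto intro!: measurable_half_line)
    ultimately have 1: "ennreal (\<Sum>i<m. a i) * Nbar (indicator {0<..<t}) \<le> of_nat m * Nbar \<gamma>"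
      by (metis mult_left_mono order_trans zero_le)
    have "J n \<le> (\<integral>\<^sup>+s. (\<Sum>i<m. ennreal (a i) * indicator {real (Suc i) * d<..real (Suc (Suc i)) * d} s) \<partial>lborel)"
      unfolding J_def
    proof (rule nn_integral_mono)
      fix s
      show "ennreal (\<gamma> s) * indicator {t / real (Suc n)<..<t} s \<le>
          (\<Sum>i<m. ennreal (a i) * indicator {real (Suc i) * d<..real (Suc (Suc i)) * d} s)"
      proof (cases "d < s \<and> s < t")
        case True
        \<comment> \<open>\<open>s / d\<close> lies in \<open>(j + 1, j + 2]\<close>, the
          subinterval following the one with index \<open>j\<close>; hence the 2.\<close>
        define j where "j = nat (\<lceil>s / d\<rceil> - 2)"
        have sd: "1 < s / d" using True m by (simp add: field_simps)
        then have "2 \<le> \<lceil>s / d\<rceil>" by (simp add: le_ceiling_iff)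
        then have jc: "real_of_int \<lceil>s / d\<rceil> = real j + 2" by (simp add: j_def)
        have "real j + 1 < s / d" "s / d \<le> real j + 2"
          using ceiling_correct[of "s / d"] jc by auto
        then have j: "real (Suc j) * d < s" "s \<le> real (Suc (Suc j)) * d"
          using m by (auto simp: field_simps)
        have "real (Suc j) * d < real m * d" using j(1) True m(3) by linarith
        then have "j < m" using m(2) by (simp only: mult_less_cancel_right_pos of_nat_less_iff Suc_lessD)
        have "ennreal (\<gamma> s) \<le> ennreal (a j) * indicator {real (Suc j) * d<..real (Suc (Suc j)) * d} s"
          using j gt[OF j(1)] by (simp add: ennreal_leI)
        also have "\<dots> \<le> (\<Sum>i<m. ennreal (a i) * indicator {real (Suc i) * d<..real (Suc (Suc i)) * d} s)"
          using \<open>j < m\<close> by (intro member_le_sum) auto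
        finally show ?thesis by (simp add: indicator_def)
      qed (auto simp: d_def m_def indicator_def)
    qed
    also have "\<dots> = (\<Sum>i<m. ennreal (a i) * ennreal d)"
    proof (subst nn_integral_sum)
      have "emeasure lborel {real (Suc i) * d<..real (Suc (Suc i)) * d} = ennreal d" for i
        using m by (subst emeasure_lborel_Ioc) (auto simp: algebra_simps)
      then show "(\<Sum>i<m. \<integral>\<^sup>+s. ennreal (a i) * indicator {real (Suc i) * d<..real (Suc (Suc i)) * d} s \<partial>lborel) =
          (\<Sum>i<m. ennreal (a i) * ennreal d)"
        by (simp add: nn_integral_cmult_indicator)
    qed simp
    also have "\<dots> = ennreal ((\<Sum>i<m. a i) * d)"
      using a m by (simp add: sum_distrib_right[symmetric] sum_nonneg ennreal_mult flip: sum_ennreal)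
    finally have "J n / ennreal t \<le> ennreal ((\<Sum>i<m. a i) * d) / ennreal t"
      by (rule divide_right_mono_ennreal)
    also have "\<dots> = ennreal ((\<Sum>i<m. a i) * (1 / real m))"
      using t m a by (simp add: divide_ennreal sum_nonneg d_def)
    finally have "Nbar (indicator {0<..<t}) * (J n / ennreal t) \<le>
        Nbar (indicator {0<..<t}) * ennreal ((\<Sum>i<m. a i) * (1 / real m))"
      by (rule mult_left_mono) simp
    also have "\<dots> = ennreal (1 / real m) * (ennreal (\<Sum>i<m. a i) * Nbar (indicator {0<..<t}))"
      by (subst ennreal_mult) (use a in \<open>auto simp: sum_nonneg mult_ac\<close>)
    also have "\<dots> \<le> ennreal (1 / real m) * (of_nat m * Nbar \<gamma>)"
      using 1 by (rule mult_left_mono) simp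
    also have "\<dots> = Nbar \<gamma>"
      using m by (simp add: mult.assoc[symmetric] ennreal_of_nat_eq_real_of_nat ennreal_mult[symmetric])
    finally show ?thesis .
  qed
  have inc: "incseq (\<lambda>n s. ennreal (\<gamma> s) * indicator {t / real (Suc n)<..<t} s)"
  proof (rule incseq_SucI, rule le_funI)
    fix n s
    have "t / real (Suc (Suc n)) \<le> t / real (Suc n)" using t by (simp add: frac_le)
    then show "ennreal (\<gamma> s) * indicator {t / real (Suc n)<..<t} s \<le>
        ennreal (\<gamma> s) * indicator {t / real (Suc (Suc n))<..<t} s"
      by (intro mult_left_mono) (auto simp: indicator_def)
  qed
  have "(\<integral>\<^sup>+s\<in>{0<..<t}. ennreal (\<gamma> s) \<partial>lborel) =
      (\<integral>\<^sup>+s. (SUP n. ennreal (\<gamma> s) * indicator {t / real (Suc n)<..<t} s) \<partial>lborel)"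
  proof (rule nn_integral_cong)
    fix s
    show "ennreal (\<gamma> s) * indicator {0<..<t} s = (SUP n. ennreal (\<gamma> s) * indicator {t / real (Suc n)<..<t} s)"
    proof (cases "0 < s \<and> s < t")
      case True
      then obtain n where n: "1 / real (Suc n) < s / t" using nat_approx_posE[of "s / t"] t by auto
      show ?thesis
      proof (rule antisym)
        show "ennreal (\<gamma> s) * indicator {0<..<t} s \<le> (SUP n. ennreal (\<gamma> s) * indicator {t / real (Suc n)<..<t} s)"
          using n True t by (intro SUP_upper2[of n]) (auto simp: indicator_def field_simps)
        show "(SUP n. ennreal (\<gamma> s) * indicator {t / real (Suc n)<..<t} s) \<le> ennreal (\<gamma> s) * indicator {0<..<t} s"
          using True by (intro SUP_least) (auto simp: indicator_def)
      qed
    next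
      case False
      have "indicator {t / real (Suc n)<..<t} s = (0::ennreal)" for n
      proof -
        have "0 < t / real (Suc n)" using t by simp
        then show ?thesis using False by (auto simp: indicator_def simp del: of_nat_Suc)
      qed
      with False show ?thesis by simp
    qed
  qed
  also have "\<dots> = (SUP n. J n)"
    unfolding J_def using inc by (intro nn_integral_monotone_convergence_SUP) auto
  finally have "Nbar (indicator {0<..<t}) * ((\<integral>\<^sup>+s\<in>{0<..<t}. ennreal (\<gamma> s) \<partial>lborel) / ennreal t) =
      (SUP n. Nbar (indicator {0<..<t}) * (J n / ennreal t))"
    by (simp add: SUP_mult_left_ennreal SUP_divide_ennreal)
  also have "\<dots> \<le> Nbar \<gamma>" using step by (rule SUP_least)
  finally show ?thesis .
qed

section \<open>Oscillation estimates\<close>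

lemma le_suminf_ennreal:
  fixes f :: "nat \<Rightarrow> ennreal"
  shows "f k \<le> (\<Sum>k. f k)"
  using sum_le_suminf[of f "{k}"] by simp

lemma suminf_geometric_ennreal:
  assumes "0 \<le> c" "0 \<le> x" "x < 1"
  shows "(\<Sum>k. ennreal (c * x ^ k)) = ennreal (c / (1 - x))"
proof -
  have "summable (\<lambda>k. c * x ^ k)" using assms by (intro summable_mult summable_geometric) auto
  moreover have "(\<Sum>k. c * x ^ k) = c / (1 - x)"
    using assms by (simp add: suminf_mult suminf_geometric summable_geometric)
  ultimately show ?thesis using assms by (subst suminf_ennreal2) auto
qed

text \<open>Hardy's inequality for \<open>\<eta>\<close>-th powers. The mean over \<open>(0, t)\<close> is split along the sequence
  \<open>t / s ^ k\<close>; for \<open>\<eta> < 1\<close> the geometric weights \<open>\<rho> ^ k\<close> replace the missing triangle inequality.\<close>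

lemma hardy_power:
  assumes ri: "ri_space half_line Nbar" and \<eta>: "0 < \<eta>"
    and boyd: "upper_boyd_index Nbar < ereal (1 / \<eta>)"
  obtains K C where "0 < K" "0 < C"
    "\<And>\<gamma> :: real \<Rightarrow> real. \<lbrakk>\<And>t. 0 \<le> \<gamma> t; \<And>t u. 0 < t \<Longrightarrow> t \<le> u \<Longrightarrow> \<gamma> u \<le> \<gamma> t; \<gamma> \<in> borel_measurable borel\<rbrakk> \<Longrightarrow>
      \<exists>S\<in>borel_measurable half_line.
        (\<forall>t>0. (\<integral>\<^sup>+u\<in>{0<..<t}. ennreal (\<gamma> u powr \<eta>) \<partial>lborel) / ennreal t \<le> ennreal K * epowr (S t) \<eta>) \<and>
        xnorm half_line Nbar S \<le> ennreal C * Nbar \<gamma>"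
proof -
  interpret ri_space half_line Nbar by fact
  obtain s H where s: "1 < s" and H: "0 < H" "H < s powr (1 / \<eta>)" "dilation_norm Nbar s \<le> ennreal H"
    using upper_boyd_index_lessE[OF boyd \<eta>] by blast
  \<comment> \<open>The \<open>\<eta>\<close>-th power of \<open>y ^ k\<close> is
    \<open>1 / s ^ k\<close>, the scale of the \<open>k\<close>-th block, and
    \<open>H * y < 1\<close> restates the strict bound on the dilation norm.\<close>
  define y where "y = s powr (- 1 / \<eta>)"
  have y: "0 < y" using s by (simp add: y_def)
  have "H * y < s powr (1 / \<eta>) * y" using H y by (intro mult_strict_right_mono)
  also have "\<dots> = 1" using s by (simp add: y_def powr_add[symmetric])
  finally have Hy: "0 < H * y" "H * y < 1" using H y by auto
  \<comment> \<open>Any number strictly between \<open>H * y\<close> and 1 would do: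
    \<open>x < 1\<close> makes the norms of the \<open>b k\<close> summable, and
    \<open>z < 1\<close> makes the block weights summable.\<close>
  define \<rho> where "\<rho> = (1 + H * y) / 2"
  have \<rho>: "0 < \<rho>" "\<rho> < 1" "H * y < \<rho>" using Hy by (auto simp: \<rho>_def)
  define x where "x = H * y / \<rho>"
  have x: "0 \<le> x" "x < 1" using \<rho> Hy by (auto simp: x_def)
  define z where "z = \<rho> powr \<eta>"
  have z: "0 < z" "z < 1" using \<rho> \<eta> powr_less_mono2[of \<eta> \<rho> 1] by (auto simp: z_def)
  define K where "K = 1 / (1 - z)"
  define C where "C = H / (1 - x)"
  \<comment> \<open>Normalised so that \<open>c k powr \<eta> * z ^ k\<close> is
    \<open>1 / s ^ k\<close>. The block below \<open>t / s ^ k\<close> then contributes at most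
    \<open>z ^ k * b k t powr \<eta> * t\<close>.\<close>
  define c where "c k = (y / \<rho>) ^ k" for k :: nat
  have c: "0 < c k" for k using y \<rho> by (simp add: c_def)
  have c_powr: "c k powr \<eta> * z ^ k = 1 / s ^ k" for k
  proof -
    have "c k powr \<eta> = ((y / \<rho>) powr \<eta>) ^ k"
      using y \<rho> unfolding c_def by (simp add: powr_realpow[symmetric] powr_powr mult.commute)
    moreover have "(y / \<rho>) powr \<eta> * z = y powr \<eta>" using y \<rho> by (simp add: powr_divide z_def)
    moreover have "y powr \<eta> = 1 / s" using s \<eta> unfolding y_def powr_powr by (simp add: powr_minus_divide)
    ultimately show ?thesis by (simp add: power_mult_distrib[symmetric] power_one_over)
  qed
  show thesis
  proof (rule that[of K C])
    show "0 < K" "0 < C" using z x H by (auto simp: K_def C_def)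
    fix \<gamma> :: "real \<Rightarrow> real"
    assume \<gamma>0: "\<And>t. 0 \<le> \<gamma> t" and anti: "\<And>t u. 0 < t \<Longrightarrow> t \<le> u \<Longrightarrow> \<gamma> u \<le> \<gamma> t"
      and [measurable]: "\<gamma> \<in> borel_measurable borel"
    define b where "b k t = c k * \<gamma> (t / s ^ Suc k)" for k t
    have b0: "0 \<le> b k t" for k t using c[of k] \<gamma>0 by (simp add: b_def)
    have bm: "b k \<in> borel_measurable half_line" for k
      unfolding b_def by (intro measurable_half_line) measurable
    define S where "S t = (\<Sum>k. ennreal (b k t))" for t
    have Sm: "S \<in> borel_measurable half_line" unfolding S_def b_def by (intro measurable_half_line) measurable
    have "Nbar (b k) \<le> ennreal (H * x ^ k) * Nbar \<gamma>" for k
    proof -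
      have gm: "\<gamma> \<in> borel_measurable half_line" by (intro measurable_half_line) measurable
      have "Nbar (b k) = ennreal (c k) * Nbar (\<lambda>t. \<gamma> (t / s ^ Suc k))"
        unfolding b_def using c[of k] s
        by (subst norm_scale) (auto intro!: measurable_half_line)
      also have "\<dots> \<le> ennreal (c k) * (ennreal (H ^ Suc k) * Nbar \<gamma>)"
        using norm_dilate_power_le[OF ri gm _ H(3,1), of "Suc k"] s by (intro mult_left_mono) auto
      also have "\<dots> = ennreal (c k * H ^ Suc k) * Nbar \<gamma>"
        using c[of k] H by (simp add: ennreal_mult mult.assoc)
      also have "c k * H ^ Suc k = H * x ^ k"
        by (simp add: c_def x_def power_mult_distrib power_divide)
      finally show ?thesis .
    qed
    then have "(\<Sum>k. Nbar (b k)) \<le> (\<Sum>k. ennreal (H * x ^ k) * Nbar \<gamma>)"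
      by (intro suminf_le) auto
    also have "\<dots> = ennreal C * Nbar \<gamma>"
      unfolding ennreal_suminf_multc by (subst suminf_geometric_ennreal) (use H x in \<open>auto simp: C_def\<close>)
    finally have "(\<Sum>k. Nbar (b k)) \<le> ennreal C * Nbar \<gamma>" .
    then have "xnorm half_line Nbar S \<le> ennreal C * Nbar \<gamma>"
      unfolding S_def using xnorm_suminf_le[of b] bm b0 by (blast intro: order_trans)
    moreover have "(\<integral>\<^sup>+u\<in>{0<..<t}. ennreal (\<gamma> u powr \<eta>) \<partial>lborel) / ennreal t \<le> ennreal K * epowr (S t) \<eta>"
      if t: "0 < t" for t
    proof -
      define p where "p k = t / s ^ k" for k
      have p: "0 < p k" "p (Suc k) \<le> p k" for k
        using t s by (auto simp: p_def field_simps)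
      have "(\<integral>\<^sup>+u\<in>{0<..<t}. ennreal (\<gamma> u powr \<eta>) \<partial>lborel) \<le>
          (\<integral>\<^sup>+u. (\<Sum>k. ennreal (\<gamma> (p (Suc k)) powr \<eta>) * indicator {p (Suc k)<..p k} u) \<partial>lborel)"
      proof (rule nn_integral_mono)
        fix u
        show "ennreal (\<gamma> u powr \<eta>) * indicator {0<..<t} u \<le>
            (\<Sum>k. ennreal (\<gamma> (p (Suc k)) powr \<eta>) * indicator {p (Suc k)<..p k} u)"
        proof (cases "0 < u \<and> u < t")
          case True
          obtain n where "t / u < s ^ n" using real_arch_pow[OF s] by blast
          then have "p n < u" using True s by (simp add: p_def field_simps)
          moreover have "\<not> p 0 < u" using True by (simp add: p_def)
          ultimately obtain k where k: "\<not> p k < u" "p (Suc k) < u"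
            using ex_least_nat_less[of "\<lambda>n. p n < u" n] by blast
          have "ennreal (\<gamma> u powr \<eta>) \<le> ennreal (\<gamma> (p (Suc k)) powr \<eta>) * indicator {p (Suc k)<..p k} u"
            using k p[of "Suc k"] \<eta> \<gamma>0 by (auto intro!: ennreal_leI powr_mono2 anti)
          also have "\<dots> \<le> (\<Sum>k. ennreal (\<gamma> (p (Suc k)) powr \<eta>) * indicator {p (Suc k)<..p k} u)"
            by (rule le_suminf_ennreal)
          finally show ?thesis using True by simp
        qed (auto simp: indicator_def)
      qed
      also have "\<dots> = (\<Sum>k. ennreal (\<gamma> (p (Suc k)) powr \<eta>) * ennreal (p k - p (Suc k)))"
        by (subst nn_integral_suminf) (auto simp: nn_integral_cmult_indicator emeasure_lborel_Ioc p)
      \<comment> \<open>The factor \<open>K * (1 - z)\<close> equals 1; written this way the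
        geometric series sums to \<open>K\<close>.\<close>
      also have "\<dots> \<le> (\<Sum>k. ennreal (K * (1 - z) * z ^ k) * epowr (S t) \<eta> * ennreal t)"
      proof (rule suminf_le)
        fix k
        have "\<gamma> (p (Suc k)) powr \<eta> * (p k - p (Suc k)) \<le> \<gamma> (p (Suc k)) powr \<eta> * p k"
          using p(1)[of "Suc k"] by (intro mult_left_mono) auto
        also have "\<dots> = \<gamma> (p (Suc k)) powr \<eta> * (c k powr \<eta> * z ^ k) * t"
          unfolding c_powr by (simp add: p_def)
        also have "\<dots> = z ^ k * b k t powr \<eta> * t"
          using c[of k] \<gamma>0 by (simp add: b_def p_def powr_mult)
        finally have "ennreal (\<gamma> (p (Suc k)) powr \<eta>) * ennreal (p k - p (Suc k)) \<le>
            ennreal (z ^ k * b k t powr \<eta> * t)"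
          using p[of k] by (subst ennreal_mult[symmetric]) (auto intro: ennreal_leI)
        also have "\<dots> = ennreal (z ^ k) * epowr (ennreal (b k t)) \<eta> * ennreal t"
          using z t b0 by (simp add: ennreal_mult epowr_ennreal)
        also have "\<dots> \<le> ennreal (z ^ k) * epowr (S t) \<eta> * ennreal t"
        proof -
          have "ennreal (b k t) \<le> S t"
            unfolding S_def by (rule le_suminf_ennreal)
          then show ?thesis using \<eta> by (intro mult_right_mono mult_left_mono epowr_mono) auto
        qed
        also have "z ^ k = K * (1 - z) * z ^ k" using z by (simp add: K_def)
        finally show "ennreal (\<gamma> (p (Suc k)) powr \<eta>) * ennreal (p k - p (Suc k)) \<le>
            ennreal (K * (1 - z) * z ^ k) * epowr (S t) \<eta> * ennreal t" .
      qed auto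
      also have "\<dots> = ennreal K * epowr (S t) \<eta> * ennreal t"
        unfolding ennreal_suminf_multc
        by (subst suminf_geometric_ennreal) (use z \<open>0 < K\<close> in auto)
      finally have "(\<integral>\<^sup>+u\<in>{0<..<t}. ennreal (\<gamma> u powr \<eta>) \<partial>lborel) / ennreal t \<le>
          ennreal K * epowr (S t) \<eta> * ennreal t / ennreal t"
        by (rule divide_right_mono_ennreal)
      then show ?thesis using t by (simp add: ennreal_mult_divide_eq)
    qed
    ultimately show "\<exists>S\<in>borel_measurable half_line.
        (\<forall>t>0. (\<integral>\<^sup>+u\<in>{0<..<t}. ennreal (\<gamma> u powr \<eta>) \<partial>lborel) / ennreal t \<le> ennreal K * epowr (S t) \<eta>) \<and>
        xnorm half_line Nbar S \<le> ennreal C * Nbar \<gamma>"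
      using Sm by blast
  qed
qed

lemma rearr_avg_measurable [measurable]: "rearr_avg M f \<in> borel_measurable borel"
proof -
  define h where "h t = (\<integral>\<^sup>+s\<in>{0<..<t}. rearr M f s \<partial>lborel)" for t
  have "h s \<le> h t" if "s \<le> t" for s t
    unfolding h_def using that by (intro nn_integral_mono mult_left_mono) (auto simp: indicator_def)
  \<comment> \<open>Reflection makes the increasing \<open>h\<close> decreasing, so that the
    measurability of antitone functions applies.\<close>
  then have "(\<lambda>t. h (- t)) \<in> borel_measurable borel"
    by (intro borel_measurable_antimono_ennreal) simp
  then have "(\<lambda>t. (\<lambda>t. h (- t)) (- t)) \<in> borel_measurable borel" by measurable
  then have "(\<lambda>t. h t / ennreal t) \<in> borel_measurable borel" by simp
  then show ?thesis unfolding h_def rearr_avg_def[abs_def] .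
qed

lemma osc_measurable [measurable]: "osc M f \<in> borel_measurable borel"
  unfolding osc_def[abs_def] by measurable

section \<open>The common setting, and oscillation bounds from pointwise estimates\<close>

locale ri_metric_setting =
  metric_measure_space M + X: ri_space M N + Xbar: ri_space half_line Nbar + A0_inverse v
  for M :: "'a::{metric_space, second_countable_topology} measure"
    and N Nbar v +
  assumes rep: "representation_space M N Nbar"
    and h_lower: "\<And>r. 0 < r \<Longrightarrow> ennreal (v r) \<le> h_mu M r"
begin

lemma ball_ge: "0 < r \<Longrightarrow> ennreal (v r) \<le> emeasure M (ball x r)"
  using h_lower[of r] unfolding h_mu_def by (rule order_trans[OF _ INF_lower]) auto

lemma rearr_level_le:
  assumes "F \<in> borel_measurable M" "rearr M F t = ennreal T" "0 \<le> T"
  shows "emeasure M {x. T < \<bar>F x\<bar>} \<le> ennreal t"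
  using rearr_gt_iff[OF assms(1,3), of t] assms(2) by (simp add: not_less)

text \<open>The step shared by (i) and (ii). Integrating over \<open>E\<close>, of measure at most
  \<open>t\<close>, the term with \<open>g\<close> is bounded by Hardy-Littlewood and the constant
  term by \<open>\<gamma> t \<le> \<gamma> s\<close> on \<open>(0, t)\<close>. Each costs one copy
  of the integral, hence the factor 2.\<close>

lemma osc_le_of_pointwise:
  fixes g :: "'a \<Rightarrow> real"
  defines "\<gamma> \<equiv> \<lambda>s. enn2real (rearr M g s)"
  assumes F [measurable]: "F \<in> borel_measurable M" and F0: "\<And>x. 0 \<le> F x"
    and t: "0 < t" and T: "rearr M F t = ennreal T" "0 \<le> T"
    and g [measurable]: "g \<in> borel_measurable M" and g0: "\<And>x. 0 \<le> g x" and Ng: "N g < \<infinity>"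
    and a: "0 < a" and c: "0 \<le> c"
    and le: "AE x in M. T < F x \<longrightarrow> F x - T \<le> c * (g x powr a + \<gamma> t powr a)"
  shows "osc M F t \<le> ennreal (2 * c) * ((\<integral>\<^sup>+s\<in>{0<..<t}. ennreal (\<gamma> s powr a) \<partial>lborel) / ennreal t)"
proof -
  let ?I = "\<integral>\<^sup>+s\<in>{0<..<t}. ennreal (\<gamma> s powr a) \<partial>lborel"
  have \<gamma>: "rearr M g s = ennreal (\<gamma> s)" if "0 < s" for s
    using rearr_eq_real(2)[OF rep g Ng that] by (simp add: \<gamma>_def)
  have \<gamma>0: "0 \<le> \<gamma> s" for s by (simp add: \<gamma>_def)
  define E where "E = {x. T < F x}"
  have [measurable]: "E \<in> sets M"
  proof -
    have "{x\<in>space M. T < F x} \<in> sets M" by measurable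
    then show ?thesis by (simp add: E_def)
  qed
  have E: "emeasure M E \<le> ennreal t"
    using rearr_level_le[OF F T] F0 by (simp add: E_def)
  have "(\<integral>\<^sup>+x\<in>E. ennreal (g x powr a) \<partial>M) \<le> (\<integral>\<^sup>+s\<in>{0<..<t}. epowr (rearr M g s) a \<partial>lborel)"
    by (rule nn_integral_powr_le_rearr[OF sigma_finite g g0 _ t E a]) simp
  also have "\<dots> = ?I"
    using \<gamma> \<gamma>0 by (intro nn_integral_cong) (auto simp: indicator_def epowr_ennreal)
  finally have 1: "(\<integral>\<^sup>+x\<in>E. ennreal (g x powr a) \<partial>M) \<le> ?I" .
  have "ennreal (\<gamma> t powr a) * ennreal t = (\<integral>\<^sup>+s. ennreal (\<gamma> t powr a) * indicator {0<..<t} s \<partial>lborel)"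
    using t by (simp add: nn_integral_cmult_indicator)
  also have "\<dots> \<le> ?I"
  proof (intro nn_integral_mono)
    fix s
    have "\<gamma> t \<le> \<gamma> s" if "0 < s" "s < t"
      using rearr_antimono[of s t M g] \<gamma>[of s] \<gamma>[of t] that \<gamma>0 by simp
    then show "ennreal (\<gamma> t powr a) * indicator {0<..<t} s \<le> ennreal (\<gamma> s powr a) * indicator {0<..<t} s"
      using a \<gamma>0 by (auto simp: indicator_def intro!: ennreal_leI powr_mono2)
  qed
  finally have 2: "ennreal (\<gamma> t powr a) * ennreal t \<le> ?I" .
  have "(\<integral>\<^sup>+x. ennreal (F x - T) \<partial>M) \<le>
      (\<integral>\<^sup>+x. ennreal c * (ennreal (g x powr a) * indicator E x + ennreal (\<gamma> t powr a) * indicator E x) \<partial>M)"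
  proof (rule nn_integral_mono_AE)
    show "AE x in M. ennreal (F x - T) \<le>
        ennreal c * (ennreal (g x powr a) * indicator E x + ennreal (\<gamma> t powr a) * indicator E x)"
      using le
    proof eventually_elim
      fix x assume x: "T < F x \<longrightarrow> F x - T \<le> c * (g x powr a + \<gamma> t powr a)"
      show "ennreal (F x - T) \<le>
          ennreal c * (ennreal (g x powr a) * indicator E x + ennreal (\<gamma> t powr a) * indicator E x)"
      proof (cases "T < F x")
        case True
        then have "ennreal (F x - T) \<le> ennreal (c * (g x powr a + \<gamma> t powr a))"
          using x by (intro ennreal_leI) simp
        also have "\<dots> = ennreal c * (ennreal (g x powr a) + ennreal (\<gamma> t powr a))"
          using c by (simp add: ennreal_mult)
        finally show ?thesis using True by (simp add: E_def)
      next
        case False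
        then show ?thesis by (simp add: ennreal_neg)
      qed
    qed
  qed
  also have "\<dots> = ennreal c * ((\<integral>\<^sup>+x\<in>E. ennreal (g x powr a) \<partial>M) + ennreal (\<gamma> t powr a) * emeasure M E)"
    by (simp add: nn_integral_cmult nn_integral_add nn_integral_cmult_indicator)
  also have "\<dots> \<le> ennreal c * (?I + ennreal (\<gamma> t powr a) * ennreal t)"
    using 1 E by (intro mult_left_mono add_mono) auto
  also have "\<dots> \<le> ennreal c * (?I + ?I)"
    using 2 by (intro mult_left_mono add_mono) auto
  also have "\<dots> = ennreal (2 * c) * ?I"
    using c by (simp add: ennreal_mult mult_ac flip: mult_2)
  finally have "(\<integral>\<^sup>+x. ennreal (F x - T) \<partial>M) / ennreal t \<le> ennreal (2 * c) * ?I / ennreal t"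
    by (rule divide_right_mono_ennreal)
  with osc_le_integral_excess[OF sigma_finite F F0 t T] show ?thesis
    by (simp add: ennreal_times_divide)
qed

end

section \<open>Estimate (i): the Hajlasz seminorm\<close>

lemma powr_add_le:
  fixes x y :: real
  assumes "0 \<le> x" "0 \<le> y" "0 < a" "a \<le> 1"
  shows "(x + y) powr a \<le> x powr a + y powr a"
proof -
  \<comment> \<open>The exponent \<open>a - 1\<close> is at most 0, so replacing
    \<open>x + y\<close> by the smaller \<open>u\<close> increases the power.\<close>
  have *: "u * (x + y) powr (a - 1) \<le> u powr a" if "0 \<le> u" "u \<le> x + y" for u
  proof (cases "u = 0")
    case False
    then have "u * (x + y) powr (a - 1) \<le> u * u powr (a - 1)"
      using that assms by (intro mult_left_mono powr_mono2') auto
    also have "\<dots> = u powr a" using False that by (simp add: powr_diff)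
    finally show ?thesis .
  qed simp
  show ?thesis
  proof (cases "x + y = 0")
    case False
    then have "(x + y) powr a = (x + y) * (x + y) powr (a - 1)"
      using assms by (simp add: powr_diff)
    also have "\<dots> = x * (x + y) powr (a - 1) + y * (x + y) powr (a - 1)" by (rule distrib_right)
    also have "\<dots> \<le> x powr a + y powr a"
      using assms by (intro add_mono *) auto
    finally show ?thesis .
  qed (use assms in \<open>simp add: add_nonneg_eq_0_iff\<close>)
qed

lemma abs_powr_diff_le:
  fixes x y :: real
  assumes "0 < a" "a \<le> 1"
  shows "\<bar>x\<bar> powr a - \<bar>y\<bar> powr a \<le> \<bar>x - y\<bar> powr a"
proof -
  have "\<bar>x\<bar> powr a \<le> (\<bar>x - y\<bar> + \<bar>y\<bar>) powr a" using assms by (intro powr_mono2) auto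
  also have "\<dots> \<le> \<bar>x - y\<bar> powr a + \<bar>y\<bar> powr a" using assms by (intro powr_add_le) auto
  finally show ?thesis by simp
qed

lemma le_mult_INF_ennreal:
  assumes c: "0 < c" and le: "\<And>i. i \<in> A \<Longrightarrow> x \<le> ennreal c * h i"
  shows "x \<le> ennreal c * (INF i\<in>A. h i)"
proof -
  have cc: "ennreal (1 / c) * (ennreal c * y) = y" "ennreal c * (ennreal (1 / c) * y) = y" for y
    using c by (simp_all add: mult.assoc[symmetric] ennreal_mult[symmetric])
  have "ennreal (1 / c) * x \<le> (INF i\<in>A. h i)"
  proof (rule INF_greatest)
    fix i assume "i \<in> A"
    then have "ennreal (1 / c) * x \<le> ennreal (1 / c) * (ennreal c * h i)"
      using le by (intro mult_left_mono) auto
    then show "ennreal (1 / c) * x \<le> h i" by (simp only: cc)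
  qed
  then have "ennreal c * (ennreal (1 / c) * x) \<le> ennreal c * (INF i\<in>A. h i)"
    by (rule mult_left_mono) simp
  then show ?thesis by (simp only: cc)
qed

context ri_metric_setting
begin

text \<open>The radius \<open>w (3 * t)\<close> gives the ball measure at least
  \<open>3 * t\<close>. The sets where \<open>F\<close> exceeds \<open>T\<close> and where
  \<open>g\<close> exceeds its rearrangement at \<open>t\<close> take at most \<open>t\<close> each,
  so the remaining set \<open>P\<close> has positive measure and meets the full-measure set of
  \<open>y\<close> for which the gradient inequality holds.\<close>

lemma hajlasz_pointwise:
  fixes f g :: "'a \<Rightarrow> real" and \<phi> :: "real \<Rightarrow> real" and \<eta> t T :: real
  defines "F \<equiv> \<lambda>x. \<bar>f x\<bar> powr \<eta>"
  assumes \<phi>: "\<phi> \<in> class_A0" and \<eta>: "0 < \<eta>" "\<eta> \<le> 1" and f [measurable]: "f \<in> borel_measurable M"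
    and g: "g \<in> hajlasz_gradients M \<phi> f" and Ng: "N g < \<infinity>"
    and t: "0 < t" and T: "rearr M F t = ennreal T" "0 \<le> T"
  shows "AE x in M. T < F x \<longrightarrow>
    F x - T \<le> \<phi> (w (3 * t)) powr \<eta> * (g x powr \<eta> + enn2real (rearr M g t) powr \<eta>)"
proof -
  define r where "r = w (3 * t)"
  define G where "G = enn2real (rearr M g t)"
  have gm [measurable]: "g \<in> borel_measurable M" and g0: "\<And>x. 0 \<le> g x"
    and hj: "AE x in M. AE y in M. \<bar>f x - f y\<bar> \<le> \<phi> (dist x y) * (g x + g y)"
    using g by (auto simp: hajlasz_gradients_def)
  have G: "rearr M g t = ennreal G" "0 \<le> G"
    using rearr_eq_real(2)[OF rep gm Ng t] by (auto simp: G_def)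
  have [measurable]: "F \<in> borel_measurable M" unfolding F_def by measurable
  have F0: "0 \<le> F x" for x by (simp add: F_def)
  have r: "0 < r" "v r = 3 * t" using t by (auto simp: r_def w_pos v_w)
  have \<phi>r: "0 \<le> \<phi> r" using class_A0_nonneg[OF \<phi>] r by simp
  show ?thesis
    using hj
  proof (eventually_elim, intro impI)
    fix x assume x: "AE y in M. \<bar>f x - f y\<bar> \<le> \<phi> (dist x y) * (g x + g y)" and Tx: "T < F x"
    define P where "P = {y\<in>space M. y \<in> ball x r \<and> F y \<le> T \<and> g y \<le> G}"
    have [measurable]: "ball x r \<in> sets M" by (simp add: sets_eq_borel)
    have [measurable]: "P \<in> sets M" unfolding P_def by measurable
    have E1: "{x. T < \<bar>F x\<bar>} \<in> sets M" "{x. G < \<bar>g x\<bar>} \<in> sets M"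
    proof -
      have "{x\<in>space M. T < \<bar>F x\<bar>} \<in> sets M" "{x\<in>space M. G < \<bar>g x\<bar>} \<in> sets M" by measurable
      then show "{x. T < \<bar>F x\<bar>} \<in> sets M" "{x. G < \<bar>g x\<bar>} \<in> sets M" by simp_all
    qed
    have "ennreal (3 * t) \<le> emeasure M (ball x r)" using ball_ge[OF r(1), of x] r(2) by simp
    also have "\<dots> \<le> emeasure M (P \<union> ({x. T < \<bar>F x\<bar>} \<union> {x. G < \<bar>g x\<bar>}))"
    proof (rule emeasure_mono)
      show "ball x r \<subseteq> P \<union> ({x. T < \<bar>F x\<bar>} \<union> {x. G < \<bar>g x\<bar>})"
        using F0 g0 by (auto simp: P_def)
      show "P \<union> ({x. T < \<bar>F x\<bar>} \<union> {x. G < \<bar>g x\<bar>}) \<in> sets M"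
        by (intro sets.Un E1) measurable
    qed
    also have "\<dots> \<le> emeasure M P + emeasure M ({x. T < \<bar>F x\<bar>} \<union> {x. G < \<bar>g x\<bar>})"
      using E1 by (intro emeasure_subadditive) auto
    also have "\<dots> \<le> emeasure M P + (emeasure M {x. T < \<bar>F x\<bar>} + emeasure M {x. G < \<bar>g x\<bar>})"
      using E1 by (intro add_left_mono emeasure_subadditive) auto
    also have "\<dots> \<le> emeasure M P + (ennreal t + ennreal t)"
      using G T by (intro add_left_mono add_mono rearr_level_le) auto
    finally have "ennreal (3 * t) \<le> emeasure M P + ennreal (2 * t)"
      using t by (simp flip: ennreal_plus)
    then have Ppos: "emeasure M P \<noteq> 0" using t by (auto simp: ennreal_le_iff)
    have "\<exists>y\<in>P. \<bar>f x - f y\<bar> \<le> \<phi> (dist x y) * (g x + g y)"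
    proof (rule ccontr)
      assume *: "\<not> (\<exists>y\<in>P. \<bar>f x - f y\<bar> \<le> \<phi> (dist x y) * (g x + g y))"
      have "AE y in M. y \<notin> P" using x by eventually_elim (use * in blast)
      then have "P \<in> null_sets M" by (subst (asm) AE_iff_null_sets[symmetric]) auto
      with Ppos show False by auto
    qed
    then obtain y where y: "y \<in> P" "\<bar>f x - f y\<bar> \<le> \<phi> (dist x y) * (g x + g y)" by blast
    have "F x - T \<le> F x - F y" using y by (simp add: P_def)
    also have "\<dots> \<le> \<bar>f x - f y\<bar> powr \<eta>" unfolding F_def using \<eta> by (rule abs_powr_diff_le)
    also have "\<dots> \<le> (\<phi> r * (g x + G)) powr \<eta>"
    proof (intro powr_mono2)
      have "\<phi> (dist x y) \<le> \<phi> r" using y by (intro class_A0_mono[OF \<phi>]) (auto simp: P_def)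
      then have "\<phi> (dist x y) * (g x + g y) \<le> \<phi> r * (g x + G)"
        using y g0 \<phi>r by (intro mult_mono) (auto simp: P_def)
      with y show "\<bar>f x - f y\<bar> \<le> \<phi> r * (g x + G)" by linarith
    qed (use \<eta> in auto)
    also have "\<dots> = \<phi> r powr \<eta> * (g x + G) powr \<eta>"
      using g0[of x] G \<phi>r by (simp add: powr_mult)
    also have "\<dots> \<le> \<phi> r powr \<eta> * (g x powr \<eta> + G powr \<eta>)"
      using g0 G \<eta> by (intro mult_left_mono powr_add_le) auto
    finally show "F x - T \<le> \<phi> (w (3 * t)) powr \<eta> * (g x powr \<eta> + enn2real (rearr M g t) powr \<eta>)"
      by (simp add: r_def G_def)
  qed
qed

lemma A0_comp_w_measurable:
  assumes \<phi>: "\<phi> \<in> class_A0"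
  shows "(\<lambda>t. ennreal (\<phi> (w t))) \<in> borel_measurable half_line"
proof -
  \<comment> \<open>\<open>inv_into\<close> is unspecified at negative arguments; cutting them off
    gives a function monotone on the whole line.\<close>
  have "mono (\<lambda>t. \<phi> (w (max 0 t)))"
    by (intro monoI class_A0_mono[OF \<phi>] w_nonneg w_mono) auto
  then have "(\<lambda>t. \<phi> (w (max 0 t))) \<in> borel_measurable borel" by (rule borel_measurable_mono)
  then have "(\<lambda>t. ennreal (\<phi> (w (max 0 t)))) \<in> borel_measurable half_line"
    by (intro measurable_half_line) measurable
  then show ?thesis by (subst measurable_cong[where g = "\<lambda>t. ennreal (\<phi> (w (max 0 t)))"]) auto
qed

lemma hajlasz_estimate:
  assumes \<phi>: "\<phi> \<in> class_A0" and \<eta>: "0 < \<eta>" "\<eta> \<le> 1"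
    and boyd: "upper_boyd_index Nbar < ereal (1 / \<eta>)"
  obtains C :: real where "0 < C"
    "\<And>f. f \<in> Lp_plus_Linf M \<eta> \<Longrightarrow> xnorm half_line Nbar
      (\<lambda>t. epowr (osc M (\<lambda>x. \<bar>f x\<bar> powr \<eta>) t) (1 / \<eta>) / ennreal (\<phi> (w t)))
      \<le> ennreal C * hajlasz_seminorm M N \<phi> f"
proof -
  obtain K C where K: "0 < K" "0 < C" and hardy:
    "\<And>\<gamma> :: real \<Rightarrow> real. \<lbrakk>\<And>t. 0 \<le> \<gamma> t; \<And>t u. 0 < t \<Longrightarrow> t \<le> u \<Longrightarrow> \<gamma> u \<le> \<gamma> t; \<gamma> \<in> borel_measurable borel\<rbrakk> \<Longrightarrow>
      \<exists>S\<in>borel_measurable half_line.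
        (\<forall>t>0. (\<integral>\<^sup>+u\<in>{0<..<t}. ennreal (\<gamma> u powr \<eta>) \<partial>lborel) / ennreal t \<le> ennreal K * epowr (S t) \<eta>) \<and>
        xnorm half_line Nbar S \<le> ennreal C * Nbar \<gamma>"
    by (fact hardy_power[OF Xbar.ri_space_axioms \<eta>(1) boyd])
  obtain k where k: "0 < k" "\<And>t. 0 < t \<Longrightarrow> w (3 * t) \<le> k * w t"
    using w_doubling[of 3] by auto
  \<comment> \<open>Absorbs the passage from \<open>w (3 * t)\<close> to \<open>w t\<close>:
    \<open>k\<close> comes from the doubling of \<open>w\<close>, and \<open>dilation_sup\<close>
    carries it through \<open>\<phi>\<close>.\<close>
  define L where "L = dilation_sup \<phi> k"
  have L: "0 < L" using dilation_sup_pos[OF \<phi> k(1)] by (simp add: L_def)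
  have \<phi>3: "\<phi> (w (3 * t)) \<le> L * \<phi> (w t)" if "0 < t" for t
  proof -
    have "\<phi> (w (3 * t)) \<le> \<phi> (k * w t)"
      using that k(2)[OF that] by (intro class_A0_mono[OF \<phi>]) (auto simp: w_nonneg)
    also have "\<dots> \<le> L * \<phi> (w t)"
      unfolding L_def using that k by (intro class_A0_dilation[OF \<phi>] w_pos)
    finally show ?thesis .
  qed
  \<comment> \<open>The 2 comes from \<open>osc_le_of_pointwise\<close> and \<open>K\<close> from
    Hardy's inequality; both acquire the power \<open>1 / \<eta>\<close> when the root is
    taken.\<close>
  define D where "D = (2 * K) powr (1 / \<eta>) * L"
  have D: "0 < D" using K L by (simp add: D_def)
  show thesis
  proof (rule that[of "D * C"])
    show "0 < D * C" using D K by simp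
    fix f assume f: "f \<in> Lp_plus_Linf M \<eta>"
    define F where "F x = \<bar>f x\<bar> powr \<eta>" for x
    have [measurable]: "f \<in> borel_measurable M" using f by (rule Lp_plus_Linf_measurable)
    have Fm [measurable]: "F \<in> borel_measurable M" unfolding F_def by measurable
    have F0: "0 \<le> F x" for x by (simp add: F_def)
    define h where "h t = epowr (osc M F t) (1 / \<eta>) / ennreal (\<phi> (w t))" for t
    have hm: "h \<in> borel_measurable half_line"
    proof -
      have "(\<lambda>t. epowr (osc M F t) (1 / \<eta>)) \<in> borel_measurable half_line"
        by (intro measurable_half_line) measurable
      with A0_comp_w_measurable[OF \<phi>] show ?thesis unfolding h_def by measurable
    qed
    have "xnorm half_line Nbar h \<le> ennreal (D * C) * N g" if g: "g \<in> hajlasz_gradients M \<phi> f" for g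
    proof (cases "N g < \<infinity>")
      case True
      have gm [measurable]: "g \<in> borel_measurable M" and g0: "\<And>x. 0 \<le> g x"
        using g by (auto simp: hajlasz_gradients_def)
      define \<gamma> where "\<gamma> s = enn2real (rearr M g s)" for s
      have \<gamma>: "rearr M g s = ennreal (\<gamma> s)" if "0 < s" for s
        using rearr_eq_real(2)[OF rep gm True that] by (simp add: \<gamma>_def)
      have \<gamma>0: "0 \<le> \<gamma> s" for s by (simp add: \<gamma>_def)
      have "\<gamma> u \<le> \<gamma> s" if "0 < s" "s \<le> u" for s u
        using rearr_antimono[OF that(2), of M g] \<gamma>[of s] \<gamma>[of u] that \<gamma>0 by simp
      moreover have "\<gamma> \<in> borel_measurable borel" unfolding \<gamma>_def by measurable
      ultimately obtain S where S: "S \<in> borel_measurable half_line"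
        "\<And>t. 0 < t \<Longrightarrow> (\<integral>\<^sup>+u\<in>{0<..<t}. ennreal (\<gamma> u powr \<eta>) \<partial>lborel) / ennreal t \<le> ennreal K * epowr (S t) \<eta>"
        "xnorm half_line Nbar S \<le> ennreal C * Nbar \<gamma>"
        using hardy[of \<gamma>] \<gamma>0 by blast
      have "h t \<le> ennreal D * S t" if t: "0 < t" for t
      proof -
        have "rearr M F t < \<infinity>"
          unfolding F_def using rearr_powr_finite[OF f \<eta>(1) t] .
        then obtain T where T: "rearr M F t = ennreal T" "0 \<le> T" by (cases "rearr M F t") auto
        have pos: "0 < \<phi> (w t)" "0 \<le> \<phi> (w (3 * t))"
          using t w_pos[of t] w_nonneg[of "3 * t"] by (auto intro: class_A0_pos[OF \<phi>] class_A0_nonneg[OF \<phi>])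
        have "osc M F t \<le> ennreal (2 * \<phi> (w (3 * t)) powr \<eta>) *
            ((\<integral>\<^sup>+s\<in>{0<..<t}. ennreal (\<gamma> s powr \<eta>) \<partial>lborel) / ennreal t)"
          unfolding \<gamma>_def
          by (rule osc_le_of_pointwise[OF Fm F0 t T gm g0 True \<eta>(1)])
            (use hajlasz_pointwise[OF \<phi> \<eta> _ g True t T[unfolded F_def]] in \<open>auto simp: F_def\<close>)
        also have "\<dots> \<le> ennreal (2 * \<phi> (w (3 * t)) powr \<eta>) * (ennreal K * epowr (S t) \<eta>)"
          using S(2)[OF t] by (rule mult_left_mono) simp
        finally have "epowr (osc M F t) (1 / \<eta>) \<le>
            epowr (ennreal (2 * \<phi> (w (3 * t)) powr \<eta>) * (ennreal K * epowr (S t) \<eta>)) (1 / \<eta>)"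
          using \<eta> by (intro epowr_mono) auto
        also have "ennreal (2 * \<phi> (w (3 * t)) powr \<eta>) * (ennreal K * epowr (S t) \<eta>) =
            ennreal (2 * K * \<phi> (w (3 * t)) powr \<eta>) * epowr (S t) \<eta>"
          unfolding mult.assoc[symmetric]
          by (subst ennreal_mult[symmetric]) (use K in \<open>auto simp: mult_ac\<close>)
        also have "epowr \<dots> (1 / \<eta>) = epowr (ennreal (2 * K * \<phi> (w (3 * t)) powr \<eta>)) (1 / \<eta>) * S t"
          using \<eta> by (simp add: epowr_mult epowr_epowr)
        also have "epowr (ennreal (2 * K * \<phi> (w (3 * t)) powr \<eta>)) (1 / \<eta>) =
            ennreal ((2 * K) powr (1 / \<eta>) * \<phi> (w (3 * t)))"
          using \<eta> K pos by (simp add: epowr_ennreal powr_mult powr_powr)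
        also have "ennreal ((2 * K) powr (1 / \<eta>) * \<phi> (w (3 * t))) * S t \<le> ennreal (D * \<phi> (w t)) * S t"
          using \<phi>3[OF t] K by (intro mult_right_mono ennreal_leI) (auto simp: D_def mult.assoc)
        finally have "h t \<le> ennreal (D * \<phi> (w t)) * S t / ennreal (\<phi> (w t))"
          unfolding h_def by (rule divide_right_mono_ennreal)
        also have "\<dots> = ennreal D * S t * ennreal (\<phi> (w t)) / ennreal (\<phi> (w t))"
          using D pos by (simp add: ennreal_mult mult_ac)
        also have "\<dots> = ennreal D * S t" using pos by (simp add: ennreal_mult_divide_eq)
        finally show ?thesis .
      qed
      then have "xnorm half_line Nbar h \<le> ennreal D * xnorm half_line Nbar S"
        by (intro Xbar.xnorm_mono hm S D AE_I2) auto
      also have "\<dots> \<le> ennreal D * (ennreal C * Nbar \<gamma>)" using S(3) by (rule mult_left_mono) simp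
      also have "\<dots> = ennreal (D * C) * N g"
        using rearr_eq_real(1)[OF rep gm True] D K
        by (simp add: ennreal_mult mult.assoc \<gamma>_def[abs_def])
      finally show ?thesis .
    next
      case False
      then show ?thesis using D K by (simp add: not_less top_unique ennreal_mult_top)
    qed
    \<comment> \<open>The constant does not depend on \<open>g\<close>, so the infimum over all
      gradients can be taken.\<close>
    then have "xnorm half_line Nbar h \<le> ennreal (D * C) * hajlasz_seminorm M N \<phi> f"
      unfolding hajlasz_seminorm_def using D K by (intro le_mult_INF_ennreal) auto
    then show "xnorm half_line Nbar
      (\<lambda>t. epowr (osc M (\<lambda>x. \<bar>f x\<bar> powr \<eta>) t) (1 / \<eta>) / ennreal (\<phi> (w t)))
      \<le> ennreal (D * C) * hajlasz_seminorm M N \<phi> f" unfolding h_def F_def .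
  qed
qed

end

section \<open>Estimate (ii) at a single level: the averaged gradient\<close>

lemma divide_ennreal_pos: "0 < c \<Longrightarrow> x / ennreal c = x * ennreal (1 / c)"
  by (simp add: divide_ennreal_def inverse_ennreal inverse_eq_divide)

context ri_metric_setting
begin

text \<open>At least half of the ball lies outside \<open>E\<close>, which costs a factor 2, and
  Jensen's inequality with exponent \<open>min 1 p / p\<close> costs another. For
  \<open>p \<le> 1\<close> this exponent is 1, since \<open>F\<close> already carries the power
  \<open>p\<close>.\<close>

lemma besov_pointwise:
  fixes f :: "'a \<Rightarrow> real" and p r t T :: real
  defines "F \<equiv> \<lambda>x. \<bar>f x\<bar> powr min 1 p"
  assumes p: "0 < p" and f [measurable]: "f \<in> borel_measurable M" and t: "0 < t" and r: "w (2 * t) \<le> r"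
    and T: "rearr M F t = ennreal T" "0 \<le> T" and x: "T < F x"
  shows "ennreal (F x - T) \<le> 4 * epowr (avg_gradient M p r f x) (min 1 p)"
proof -
  let ?a = "min 1 p"
  have a: "0 < ?a" "?a \<le> 1" using p by auto
  have r0: "0 < r" using r w_pos[of "2 * t"] t by simp
  have [measurable]: "F \<in> borel_measurable M" unfolding F_def by measurable
  have F0: "0 \<le> F x" for x by (simp add: F_def)
  define B where "B = ball x r"
  define E where "E = {x. T < \<bar>F x\<bar>}"
  have [measurable]: "B \<in> sets M" by (simp add: B_def sets_eq_borel)
  have [measurable]: "E \<in> sets M"
  proof -
    have "{x\<in>space M. T < \<bar>F x\<bar>} \<in> sets M" by measurable
    then show ?thesis by (simp add: E_def)
  qed
  obtain \<beta> where \<beta>: "emeasure M B = ennreal \<beta>" "0 \<le> \<beta>"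
    using ball_finite[OF r0, of x] unfolding B_def by (cases "emeasure M (ball x r)") auto
  have "ennreal (2 * t) \<le> ennreal (v r)"
    using r r0 t by (intro ennreal_leI) (simp add: w_le_iff)
  also have "\<dots> \<le> ennreal \<beta>" using ball_ge[OF r0, of x] \<beta> by (simp add: B_def)
  finally have \<beta>t: "2 * t \<le> \<beta>" using \<beta> by (simp add: ennreal_le_iff)
  have E: "emeasure M E \<le> ennreal t" unfolding E_def using T by (intro rearr_level_le) auto
  have "ennreal \<beta> \<le> emeasure M ((B - E) \<union> E)"
    unfolding \<beta>(1)[symmetric] by (intro emeasure_mono) auto
  also have "\<dots> \<le> emeasure M (B - E) + emeasure M E" by (intro emeasure_subadditive) auto
  also have "\<dots> \<le> emeasure M (B - E) + ennreal (\<beta> / 2)"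
    using \<beta>t by (intro add_left_mono order_trans[OF E] ennreal_leI) simp
  finally have "ennreal (\<beta> / 2) + ennreal (\<beta> / 2) \<le> emeasure M (B - E) + ennreal (\<beta> / 2)"
    using \<beta> by (simp flip: ennreal_plus)
  then have half: "ennreal (\<beta> / 2) \<le> emeasure M (B - E)" by simp
  define h where "h y = ennreal (\<bar>f x - f y\<bar> powr p)" for y
  have [measurable]: "h \<in> borel_measurable M" unfolding h_def by measurable
  have h: "ennreal (\<bar>f x - f y\<bar> powr ?a) = epowr (h y) (?a / p)" for y
    using p by (simp add: h_def epowr_ennreal powr_powr)
  have "ennreal (F x - T) * ennreal (\<beta> / 2) \<le> ennreal (F x - T) * emeasure M (B - E)"
    using half by (rule mult_left_mono) simp
  also have "\<dots> = (\<integral>\<^sup>+y. ennreal (F x - T) * indicator (B - E) y \<partial>M)"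
    by (simp add: nn_integral_cmult_indicator)
  also have "\<dots> \<le> (\<integral>\<^sup>+y\<in>B. epowr (h y) (?a / p) \<partial>M)"
  proof (rule nn_integral_mono)
    fix y
    have "F x - T \<le> \<bar>f x - f y\<bar> powr ?a" if "y \<notin> E"
    proof -
      have "F x - T \<le> F x - F y" using that F0[of y] by (simp add: E_def not_less)
      also have "\<dots> \<le> \<bar>f x - f y\<bar> powr ?a" unfolding F_def using a by (rule abs_powr_diff_le)
      finally show ?thesis .
    qed
    then show "ennreal (F x - T) * indicator (B - E) y \<le> epowr (h y) (?a / p) * indicator B y"
      unfolding h[symmetric] by (auto simp: indicator_def intro!: ennreal_leI)
  qed
  finally have "ennreal (F x - T) * ennreal (\<beta> / 2) / ennreal \<beta> \<le>
      (\<integral>\<^sup>+y\<in>B. epowr (h y) (?a / p) \<partial>M) / ennreal \<beta>"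
    by (rule divide_right_mono_ennreal)
  also have "\<dots> \<le> 2 * epowr ((\<integral>\<^sup>+y\<in>B. h y \<partial>M) / ennreal \<beta>) (?a / p)"
    using t \<beta>t \<beta> p by (intro nn_integral_epowr_average_le) auto
  also have "epowr ((\<integral>\<^sup>+y\<in>B. h y \<partial>M) / ennreal \<beta>) (?a / p) = epowr (avg_gradient M p r f x) ?a"
    unfolding avg_gradient_def epowr_epowr B_def[symmetric] \<beta>(1) h_def[symmetric] by simp
  also have "ennreal (F x - T) * ennreal (\<beta> / 2) / ennreal \<beta> = ennreal ((F x - T) / 2)"
    using t \<beta>t x by (simp add: divide_ennreal flip: ennreal_mult)
  finally have "2 * ennreal ((F x - T) / 2) \<le> 2 * (2 * epowr (avg_gradient M p r f x) ?a)"
    by (rule mult_left_mono) simp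
  moreover have "2 * ennreal ((F x - T) / 2) = ennreal (F x - T)"
    using x by (subst ennreal_numeral[symmetric], subst ennreal_mult[symmetric]) auto
  ultimately show ?thesis by (simp add: mult.assoc[symmetric])
qed

text \<open>Jensen's inequality on \<open>(0, t)\<close> replaces the mean of a power of the
  rearrangement by the power of its mean. Averaging is then bounded in the norm itself, with no
  Hardy inequality, which is why (ii) carries no Boyd index condition.\<close>

lemma besov_level_estimate:
  fixes f :: "'a \<Rightarrow> real"
  assumes p: "0 < p" and f: "f \<in> Lp_plus_Linf M (min 1 p)" and t: "0 < t" and r: "w (2 * t) \<le> r"
  shows "fundamental_function M N t * epowr (osc M (\<lambda>x. \<bar>f x\<bar> powr min 1 p) t) (1 / min 1 p) \<le>
    ennreal (16 powr (1 / min 1 p)) * xnorm M N (avg_gradient M p r f)"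
proof -
  let ?a = "min 1 p"
  define g where "g x = enn2real (avg_gradient M p r f x)" for x
  have a: "0 < ?a" "?a \<le> 1" using p by auto
  show ?thesis
  proof (cases "xnorm M N (avg_gradient M p r f) < \<infinity>")
    case True
    then have fin: "AE x in M. avg_gradient M p r f x < \<infinity>"
      and Ng: "N g < \<infinity>" and Neq: "xnorm M N (avg_gradient M p r f) = N g"
      by (auto simp: xnorm_def g_def[abs_def] split: if_splits)
    \<comment> \<open>Measurability of the averaged gradient is read off from its finite norm, since
      \<open>N\<close> is infinite on functions that are not measurable.\<close>
    have gm [measurable]: "g \<in> borel_measurable M"
    proof (rule ccontr)
      assume "g \<notin> borel_measurable M"
      from X.not_measurable[OF this] Ng show False by simp
    qed
    have g0: "0 \<le> g x" for x by (simp add: g_def)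
    have fm [measurable]: "f \<in> borel_measurable M" using f by (rule Lp_plus_Linf_measurable)
    define F where "F x = \<bar>f x\<bar> powr ?a" for x
    have Fm: "F \<in> borel_measurable M" unfolding F_def by measurable
    have F0: "0 \<le> F x" for x by (simp add: F_def)
    define \<gamma> where "\<gamma> s = enn2real (rearr M g s)" for s
    have \<gamma>0: "0 \<le> \<gamma> s" for s by (simp add: \<gamma>_def)
    have \<gamma>: "rearr M g s = ennreal (\<gamma> s)" if "0 < s" for s
      using rearr_eq_real(2)[OF rep gm Ng that] by (simp add: \<gamma>_def)
    have anti: "\<gamma> u \<le> \<gamma> s" if "0 < s" "s \<le> u" for s u
      using rearr_antimono[OF that(2), of M g] \<gamma>[of s] \<gamma>[of u] that \<gamma>0 by simp
    have \<gamma>m [measurable]: "\<gamma> \<in> borel_measurable borel" unfolding \<gamma>_def by measurable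
    have "rearr M F t < \<infinity>" unfolding F_def using rearr_powr_finite[OF f a(1) t] .
    then obtain T where T: "rearr M F t = ennreal T" "0 \<le> T" by (cases "rearr M F t") auto
    \<comment> \<open>The term with \<open>\<gamma> t\<close> is added only to match the form of
      \<open>osc_le_of_pointwise\<close>.\<close>
    have "AE x in M. T < F x \<longrightarrow> F x - T \<le> 4 * (g x powr ?a + \<gamma> t powr ?a)"
      using fin
    proof (eventually_elim, intro impI)
      fix x assume x: "avg_gradient M p r f x < \<infinity>" "T < F x"
      then have "avg_gradient M p r f x = ennreal (g x)" by (simp add: g_def)
      then have "ennreal (F x - T) \<le> 4 * epowr (ennreal (g x)) ?a"
        using besov_pointwise[OF p fm t r, of T x, folded F_def] T x by simp
      also have "\<dots> = ennreal (4 * g x powr ?a)" using g0 by (simp add: epowr_ennreal ennreal_mult)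
      finally have "F x - T \<le> 4 * g x powr ?a" by (subst (asm) ennreal_le_iff) auto
      then show "F x - T \<le> 4 * (g x powr ?a + \<gamma> t powr ?a)"
        using powr_ge_zero[of "\<gamma> t" ?a] unfolding distrib_left by linarith
    qed
    then have "osc M F t \<le> ennreal (2 * 4) * ((\<integral>\<^sup>+s\<in>{0<..<t}. ennreal (\<gamma> s powr ?a) \<partial>lborel) / ennreal t)"
      unfolding \<gamma>_def by (intro osc_le_of_pointwise[OF Fm F0 t T gm g0 Ng a(1)]) auto
    also have "\<dots> \<le> ennreal (2 * 4) * (2 * epowr ((\<integral>\<^sup>+s\<in>{0<..<t}. ennreal (\<gamma> s) \<partial>lborel) / ennreal t) ?a)"
      using nn_integral_epowr_average_le[of "\<lambda>s. ennreal (\<gamma> s)" lborel "{0<..<t}" t ?a] t a \<gamma>0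
      by (intro mult_left_mono) (auto simp: epowr_ennreal)
    \<comment> \<open>The factors are 2 from the oscillation bound, 4 from the pointwise bound and 2
      from Jensen's inequality.\<close>
    also have "\<dots> = ennreal 16 * epowr ((\<integral>\<^sup>+s\<in>{0<..<t}. ennreal (\<gamma> s) \<partial>lborel) / ennreal t) ?a"
      by (simp add: mult.assoc[symmetric])
    finally have "epowr (osc M F t) (1 / ?a) \<le>
        epowr (ennreal 16 * epowr ((\<integral>\<^sup>+s\<in>{0<..<t}. ennreal (\<gamma> s) \<partial>lborel) / ennreal t) ?a) (1 / ?a)"
      using a by (intro epowr_mono) auto
    also have "\<dots> = epowr (ennreal 16) (1 / ?a) *
        epowr (epowr ((\<integral>\<^sup>+s\<in>{0<..<t}. ennreal (\<gamma> s) \<partial>lborel) / ennreal t) ?a) (1 / ?a)"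
      using a by (intro epowr_mult) auto
    also have "\<dots> = ennreal (16 powr (1 / ?a)) * ((\<integral>\<^sup>+s\<in>{0<..<t}. ennreal (\<gamma> s) \<partial>lborel) / ennreal t)"
      using a unfolding epowr_epowr by (subst epowr_ennreal) auto
    finally have "fundamental_function M N t * epowr (osc M F t) (1 / ?a) \<le>
        fundamental_function M N t *
        (ennreal (16 powr (1 / ?a)) * ((\<integral>\<^sup>+s\<in>{0<..<t}. ennreal (\<gamma> s) \<partial>lborel) / ennreal t))"
      by (rule mult_left_mono) simp
    also have "\<dots> = ennreal (16 powr (1 / ?a)) *
        (Nbar (indicator {0<..<t}) * ((\<integral>\<^sup>+s\<in>{0<..<t}. ennreal (\<gamma> s) \<partial>lborel) / ennreal t))"
      by (simp only: fundamental_function_eq[OF metric_measure_space_axioms rep t] mult.left_commute)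
    also have "\<dots> \<le> ennreal (16 powr (1 / ?a)) * Nbar \<gamma>"
      by (intro mult_left_mono norm_indicator_average_le Xbar.ri_space_axioms t \<gamma>0 anti \<gamma>m) auto
    also have "Nbar \<gamma> = xnorm M N (avg_gradient M p r f)"
      using rearr_eq_real(1)[OF rep gm Ng] by (simp add: Neq \<gamma>_def[abs_def])
    finally show ?thesis unfolding F_def .
  next
    case False
    then show ?thesis by (simp add: not_less top_unique ennreal_mult_top)
  qed
qed

end

section \<open>From level estimates to norms over \<open>dt/t\<close>\<close>

context A0_inverse
begin

text \<open>Both integrals are compared with step functions built from the infima
  \<open>m n\<close>, which bound the left integrand from above and the right one from below. This
  is valid for arbitrary \<open>A\<close> and \<open>B\<close>, in particular for norms of gradients
  as functions of the radius.\<close>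

lemma Lq_haar_le:
  assumes C1: "0 < C1" and \<theta>: "0 < \<theta>" and q: "0 < q"
  obtains C :: real where "0 < C"
    "\<And>A B. (\<And>t r. 0 < t \<Longrightarrow> w (2 * t) \<le> r \<Longrightarrow> A t \<le> ennreal C1 * B r) \<Longrightarrow>
      Lq_haar q (\<lambda>t. A t / ennreal (w t powr \<theta>)) \<le> ennreal C * Lq_haar q (\<lambda>r. ennreal (r powr - \<theta>) * B r)"
proof -
  obtain k where k: "0 < k" "\<And>t. 0 < t \<Longrightarrow> w (2 * t) \<le> k * w t"
    using w_doubling[of 2] by auto
  \<comment> \<open>Comes from \<open>r \<le> 4 * w (2 * t) \<le> 4 * k * w t\<close>, raised to the
    power \<open>\<theta>\<close>.\<close>
  define C2 where "C2 = C1 * (4 * k) powr \<theta>"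
  have C2: "0 < C2" using C1 k by (simp add: C2_def)
  have L: "A t / ennreal (w t powr \<theta>) \<le> ennreal C2 * (ennreal (r powr - \<theta>) * B r)"
    if AB: "\<And>t r. 0 < t \<Longrightarrow> w (2 * t) \<le> r \<Longrightarrow> A t \<le> ennreal C1 * B r"
      and t: "0 < t" and r: "w (2 * t) \<le> r" "r \<le> 4 * w (2 * t)" for A B t r
  proof -
    have wt: "0 < w t" "0 < w (2 * t)" using t by (auto intro: w_pos)
    then have r0: "0 < r" using r by simp
    have "r \<le> 4 * k * w t" using r k(2)[OF t] by simp
    then have "r powr \<theta> \<le> (4 * k * w t) powr \<theta>" using r0 \<theta> by (intro powr_mono2) auto
    also have "\<dots> = (4 * k) powr \<theta> * w t powr \<theta>" using wt k by (simp add: powr_mult)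
    finally have "1 / w t powr \<theta> \<le> (4 * k) powr \<theta> * r powr - \<theta>"
      using wt r0 by (simp add: powr_minus_divide field_simps)
    then have "A t * ennreal (1 / w t powr \<theta>) \<le>
        (ennreal C1 * B r) * ennreal ((4 * k) powr \<theta> * r powr - \<theta>)"
      using AB[OF t r(1)] by (intro mult_mono ennreal_leI) auto
    also have "\<dots> = ennreal C2 * (ennreal (r powr - \<theta>) * B r)"
      using C1 by (simp add: C2_def ennreal_mult mult_ac)
    finally show ?thesis using wt by (subst divide_ennreal_pos) auto
  qed
  show thesis
  proof (cases "q = \<infinity>")
    case True
    show thesis
    proof (rule that[OF C2])
      fix A B assume AB: "\<And>t r. 0 < t \<Longrightarrow> w (2 * t) \<le> r \<Longrightarrow> A t \<le> ennreal C1 * B r"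
      have "A t / ennreal (w t powr \<theta>) \<le> ennreal C2 * (SUP r\<in>{0<..}. ennreal (r powr - \<theta>) * B r)"
        if t: "0 < t" for t
      proof -
        \<comment> \<open>For the supremum the single radius \<open>w (2 * t)\<close>
          suffices.\<close>
        have "0 < w (2 * t)" using t by (intro w_pos) simp
        then have "A t / ennreal (w t powr \<theta>) \<le> ennreal C2 * (ennreal (w (2 * t) powr - \<theta>) * B (w (2 * t)))"
          by (intro L[OF AB t]) auto
        also have "\<dots> \<le> ennreal C2 * (SUP r\<in>{0<..}. ennreal (r powr - \<theta>) * B r)"
          using \<open>0 < w (2 * t)\<close> by (intro mult_left_mono SUP_upper) auto
        finally show ?thesis .
      qed
      then show "Lq_haar q (\<lambda>t. A t / ennreal (w t powr \<theta>)) \<le>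
          ennreal C2 * Lq_haar q (\<lambda>r. ennreal (r powr - \<theta>) * B r)"
        using True by (auto simp: Lq_haar_def intro!: SUP_least)
    qed
  next
    case False
    then obtain Q where Q: "q = ennreal Q" "0 < Q" using q by (cases q) auto
    define D where "D = dilation_sup v 2"
    have D: "0 < D" using dilation_sup_pos[OF v, of 2] by (simp add: D_def)
    \<comment> \<open>All integer powers of 2, enumerated by natural numbers so that sums over
      blocks are series.\<close>
    define e where "e n = 2 powr real_of_int (int_decode n)" for n
    have e: "0 < e n" for n by (simp add: e_def)
    have e_ex: "\<exists>n. e n / 2 < y \<and> y \<le> e n" if "0 < y" for y
    proof -
      define n where "n = int_encode \<lceil>log 2 y\<rceil>"
      have c: "real_of_int \<lceil>log 2 y\<rceil> - 1 < log 2 y" "log 2 y \<le> real_of_int \<lceil>log 2 y\<rceil>"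
        using ceiling_correct[of "log 2 y"] by auto
      have "2 powr (real_of_int \<lceil>log 2 y\<rceil> - 1) < y" using c(1) that by (subst (asm) less_log_iff) auto
      moreover have "y \<le> 2 powr real_of_int \<lceil>log 2 y\<rceil>" using that by (subst log_le_iff[symmetric]) auto
      ultimately show ?thesis by (intro exI[of _ n]) (simp add: e_def n_def powr_diff)
    qed
    have e_uniq: "n = int_encode (\<lceil>log 2 y\<rceil> - 1)" if "e n < y" "y \<le> 2 * e n" for n y
    proof -
      have y: "0 < y" using that e[of n] by linarith
      have "2 * e n = 2 powr (real_of_int (int_decode n) + 1)" by (simp add: e_def powr_add)
      then have "real_of_int (int_decode n) < log 2 y" "log 2 y \<le> real_of_int (int_decode n) + 1"
        using that y by (auto simp: e_def less_log_iff log_le_iff)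
      then have "\<lceil>log 2 y\<rceil> = int_decode n + 1" by (intro ceiling_unique) auto
      then show ?thesis by simp
    qed
    define C where "C = (2 * (C2 powr Q * D)) powr (1 / Q)"
    show thesis
    proof (rule that[of C])
      show "0 < C" using C2 D by (simp add: C_def)
      fix A B assume AB: "\<And>t r. 0 < t \<Longrightarrow> w (2 * t) \<le> r \<Longrightarrow> A t \<le> ennreal C1 * B r"
      define G where "G t = A t / ennreal (w t powr \<theta>)" for t
      define W where "W r = ennreal (r powr - \<theta>) * B r" for r
      \<comment> \<open>If \<open>w (2 * t)\<close> lies in \<open>(e n / 2, e n]\<close>, every
        \<open>r\<close> in \<open>(e n, 2 * e n]\<close> lies between \<open>w (2 * t)\<close> and
        four times that value, so \<open>L\<close> holds for all these radii at once.\<close>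
      define m where "m n = (INF r\<in>{e n<..2 * e n}. W r)" for n
      \<comment> \<open>\<open>a n < t \<le> b n\<close> is the condition
        \<open>e n / 2 < w (2 * t) \<le> e n\<close> read through \<open>v\<close>.\<close>
      define a where "a n = v (e n / 2) / 2" for n
      define b where "b n = v (e n) / 2" for n
      have a: "0 < a n" for n using e[of n] by (simp add: a_def class_A0_pos[OF v])
      have ab: "a n \<le> b n" for n
        using e[of n] unfolding a_def b_def by (simp add: class_A0_mono[OF v])
      have ba: "b n \<le> D * a n" for n
        using class_A0_dilation[OF v, of 2 "e n / 2"] e[of n] by (simp add: a_def b_def D_def)
      have Gm: "G t \<le> ennreal C2 * m n" if "0 < t" "e n / 2 < w (2 * t)" "w (2 * t) \<le> e n" for t n
        unfolding m_def
      proof (rule le_mult_INF_ennreal[OF C2])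
        fix r assume "r \<in> {e n<..2 * e n}"
        then show "G t \<le> ennreal C2 * W r"
          unfolding G_def W_def using that by (intro L[OF AB]) auto
      qed
      have "(\<integral>\<^sup>+t\<in>{0<..}. epowr (G t) Q / ennreal t \<partial>lborel) \<le>
          (\<integral>\<^sup>+t. (\<Sum>n. (ennreal (C2 powr Q) * epowr (m n) Q * ennreal (1 / a n)) * indicator {a n<..b n} t) \<partial>lborel)"
      proof (rule nn_integral_mono)
        fix t
        show "epowr (G t) Q / ennreal t * indicator {0<..} t \<le>
            (\<Sum>n. (ennreal (C2 powr Q) * epowr (m n) Q * ennreal (1 / a n)) * indicator {a n<..b n} t)"
        proof (cases "0 < t")
          case True
          then have "0 < w (2 * t)" by (intro w_pos) simp
          then obtain n where n: "e n / 2 < w (2 * t)" "w (2 * t) \<le> e n" using e_ex by blast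
          have "\<not> w (2 * t) \<le> e n / 2" using n by simp
          then have at: "a n < t" using True e[of n] by (subst (asm) w_le_iff) (auto simp: a_def)
          have tb: "t \<le> b n" using n(2) True e[of n] by (subst (asm) w_le_iff) (auto simp: b_def)
          have "epowr (G t) Q \<le> epowr (ennreal C2 * m n) Q"
            using Q Gm[OF True n] by (intro epowr_mono) auto
          also have "\<dots> = ennreal (C2 powr Q) * epowr (m n) Q"
            using Q C2 by (simp add: epowr_mult epowr_ennreal)
          finally have "epowr (G t) Q * ennreal (1 / t) \<le>
              ennreal (C2 powr Q) * epowr (m n) Q * ennreal (1 / a n)"
            using at a[of n] by (intro mult_mono ennreal_leI) (auto simp: frac_le)
          then have "epowr (G t) Q / ennreal t * indicator {0<..} t \<le>
              (ennreal (C2 powr Q) * epowr (m n) Q * ennreal (1 / a n)) * indicator {a n<..b n} t"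
            using True at tb by (simp add: divide_ennreal_pos)
          also have "\<dots> \<le> (\<Sum>n. (ennreal (C2 powr Q) * epowr (m n) Q * ennreal (1 / a n)) * indicator {a n<..b n} t)"
            by (rule le_suminf_ennreal)
          finally show ?thesis .
        qed simp
      qed
      also have "\<dots> = (\<Sum>n. (ennreal (C2 powr Q) * epowr (m n) Q * ennreal (1 / a n)) * ennreal (b n - a n))"
        by (subst nn_integral_suminf) (auto simp: nn_integral_cmult_indicator emeasure_lborel_Ioc ab)
      also have "\<dots> \<le> (\<Sum>n. ennreal (C2 powr Q * D) * epowr (m n) Q)"
      proof (rule suminf_le)
        fix n
        \<comment> \<open>Doubling of \<open>v\<close> bounds the \<open>dt/t\<close>-measure of
          every block by the same constant.\<close>
        have "1 / a n * (b n - a n) \<le> D" using ba[of n] a[of n] by (simp add: field_simps)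
        then have "ennreal (1 / a n) * ennreal (b n - a n) \<le> ennreal D"
          using a[of n] ab[of n] by (subst ennreal_mult[symmetric]) (auto intro: ennreal_leI)
        then have "(ennreal (C2 powr Q) * epowr (m n) Q) * (ennreal (1 / a n) * ennreal (b n - a n)) \<le>
            (ennreal (C2 powr Q) * epowr (m n) Q) * ennreal D"
          by (rule mult_left_mono) simp
        then show "(ennreal (C2 powr Q) * epowr (m n) Q * ennreal (1 / a n)) * ennreal (b n - a n) \<le>
            ennreal (C2 powr Q * D) * epowr (m n) Q"
          using D by (simp add: ennreal_mult mult_ac)
      qed auto
      also have "\<dots> = ennreal (C2 powr Q * D) * (\<Sum>n. epowr (m n) Q)" by simp
      \<comment> \<open>The interval \<open>(e n, 2 * e n]\<close> has length \<open>e n\<close> and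
        \<open>1 / r \<ge> 1 / (2 * e n)\<close> on it, so its \<open>dr/r\<close>-measure is at
        least \<open>1 / 2\<close>; hence the factor 2.\<close>
      also have "(\<Sum>n. epowr (m n) Q) \<le> 2 * (\<integral>\<^sup>+r\<in>{0<..}. epowr (W r) Q / ennreal r \<partial>lborel)"
      proof -
        have "(\<Sum>n. epowr (m n) Q * ennreal (1 / 2)) =
            (\<Sum>n. \<integral>\<^sup>+r. epowr (m n) Q * ennreal (1 / (2 * e n)) * indicator {e n<..2 * e n} r \<partial>lborel)"
        proof (rule suminf_cong)
          fix n
          have ii: "ennreal (1 / (2 * e n)) * ennreal (2 * e n - e n) = ennreal (1 / 2)"
            using e[of n] by (subst ennreal_mult[symmetric]) auto
          have em: "emeasure lborel {e n<..2 * e n} = ennreal (2 * e n - e n)"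
            using e[of n] by (intro emeasure_lborel_Ioc) simp
          show "epowr (m n) Q * ennreal (1 / 2) =
              (\<integral>\<^sup>+r. epowr (m n) Q * ennreal (1 / (2 * e n)) * indicator {e n<..2 * e n} r \<partial>lborel)"
            unfolding ii[symmetric] em[symmetric] mult.assoc[symmetric]
            by (rule nn_integral_cmult_indicator[symmetric]) simp
        qed
        also have "\<dots> = (\<integral>\<^sup>+r. (\<Sum>n. epowr (m n) Q * ennreal (1 / (2 * e n)) * indicator {e n<..2 * e n} r) \<partial>lborel)"
          by (rule nn_integral_suminf[symmetric]) measurable
        also have "\<dots> \<le> (\<integral>\<^sup>+r\<in>{0<..}. epowr (W r) Q / ennreal r \<partial>lborel)"
        proof (rule nn_integral_mono)
          fix r
          \<comment> \<open>The dyadic intervals are disjoint, so only the term with this index can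
            be nonzero at \<open>r\<close>.\<close>
          define n where "n = int_encode (\<lceil>log 2 r\<rceil> - 1)"
          have "(\<Sum>n. epowr (m n) Q * ennreal (1 / (2 * e n)) * indicator {e n<..2 * e n} r) =
              (\<Sum>n\<in>{n}. epowr (m n) Q * ennreal (1 / (2 * e n)) * indicator {e n<..2 * e n} r)"
          proof (rule suminf_finite)
            fix k assume "k \<notin> {n}"
            then have "r \<notin> {e k<..2 * e k}" using e_uniq[of k r] by (auto simp: n_def)
            then show "epowr (m k) Q * ennreal (1 / (2 * e k)) * indicator {e k<..2 * e k} r = 0" by simp
          qed simp
          also have "\<dots> \<le> epowr (W r) Q / ennreal r * indicator {0<..} r"
          proof (cases "r \<in> {e n<..2 * e n}")
            case True
            then have r: "0 < r" using e[of n] by auto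
            have "m n \<le> W r" unfolding m_def using True by (rule INF_lower)
            then have "epowr (m n) Q * ennreal (1 / (2 * e n)) \<le> epowr (W r) Q * ennreal (1 / r)"
              using Q True r e[of n] by (intro mult_mono epowr_mono ennreal_leI) (auto simp: frac_le)
            then show ?thesis using True r by (simp add: divide_ennreal_pos)
          qed simp
          finally show "(\<Sum>n. epowr (m n) Q * ennreal (1 / (2 * e n)) * indicator {e n<..2 * e n} r) \<le>
              epowr (W r) Q / ennreal r * indicator {0<..} r" .
        qed
        finally have "2 * ((\<Sum>n. epowr (m n) Q) * ennreal (1 / 2)) \<le>
            2 * (\<integral>\<^sup>+r\<in>{0<..}. epowr (W r) Q / ennreal r \<partial>lborel)"
          unfolding ennreal_suminf_multc by (rule mult_left_mono) simp
        moreover have "2 * (y * ennreal (1 / 2)) = y" for y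
        proof -
          have "2 * (y * ennreal (1 / 2)) = y * (ennreal 2 * ennreal (1 / 2))" by (simp add: mult_ac)
          also have "ennreal 2 * ennreal (1 / 2) = 1" by (subst ennreal_mult[symmetric]) auto
          finally show ?thesis by simp
        qed
        ultimately show ?thesis by simp
      qed
      finally have "(\<integral>\<^sup>+t\<in>{0<..}. epowr (G t) Q / ennreal t \<partial>lborel) \<le>
          ennreal (C2 powr Q * D) * (2 * (\<integral>\<^sup>+r\<in>{0<..}. epowr (W r) Q / ennreal r \<partial>lborel))"
        by (simp add: mult_left_mono)
      also have "\<dots> = ennreal (2 * (C2 powr Q * D)) * (\<integral>\<^sup>+r\<in>{0<..}. epowr (W r) Q / ennreal r \<partial>lborel)"
        using D by (simp add: ennreal_mult mult_ac)
      finally have "epowr (\<integral>\<^sup>+t\<in>{0<..}. epowr (G t) Q / ennreal t \<partial>lborel) (1 / Q) \<le>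
          epowr (ennreal (2 * (C2 powr Q * D)) * (\<integral>\<^sup>+r\<in>{0<..}. epowr (W r) Q / ennreal r \<partial>lborel)) (1 / Q)"
        using Q by (intro epowr_mono) auto
      also have "\<dots> = ennreal C * epowr (\<integral>\<^sup>+r\<in>{0<..}. epowr (W r) Q / ennreal r \<partial>lborel) (1 / Q)"
        using Q D by (subst epowr_mult) (auto simp: epowr_ennreal C_def)
      finally show "Lq_haar q (\<lambda>t. A t / ennreal (w t powr \<theta>)) \<le>
          ennreal C * Lq_haar q (\<lambda>r. ennreal (r powr - \<theta>) * B r)"
        using Q by (simp add: Lq_haar_def G_def W_def)
    qed
  qed
qed

end

theorem proposition7:
  fixes M :: "'a::{metric_space, second_countable_topology} measure"
    and N :: "('a \<Rightarrow> real) \<Rightarrow> ennreal"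
    and Nbar :: "(real \<Rightarrow> real) \<Rightarrow> ennreal"
    and \<phi> v :: "real \<Rightarrow> real"
  assumes "metric_measure_space M"
    and "ri_space M N"
    and "representation_space M N Nbar"
    and "\<phi> \<in> class_A0"
    and "v \<in> class_A0"
    and "strict_mono_on {0..} v"
    and "\<forall>r>0. h_mu M r \<ge> ennreal (v r)"
  shows "(\<exists>\<eta>::real. 0 < \<eta> \<and> \<eta> < 1 \<and> upper_boyd_index Nbar < ereal (1 / \<eta>)) \<and>
    (\<forall>\<eta>::real. 0 < \<eta> \<and> \<eta> \<le> 1 \<and> upper_boyd_index Nbar < ereal (1 / \<eta>) \<longrightarrow>
      (\<exists>C::real>0. \<forall>f\<in>Lp_plus_Linf M \<eta>.
        xnorm half_line Nbar
          (\<lambda>t. epowr (osc M (\<lambda>x. \<bar>f x\<bar> powr \<eta>) t) (1 / \<eta>) / ennreal (\<phi> (inv_into {0..} v t)))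
        \<le> ennreal C * hajlasz_seminorm M N \<phi> f)) \<and>
    (\<forall>(p::real) (q::ennreal) (\<theta>::real). 0 < p \<and> 0 < q \<and> 0 < \<theta> \<longrightarrow>
      (\<exists>C::real>0. \<forall>f\<in>Lp_loc M p \<inter> Lp_plus_Linf M (min 1 p).
        Lq_haar q
          (\<lambda>t. fundamental_function M N t *
                epowr (osc M (\<lambda>x. \<bar>f x\<bar> powr min 1 p) t) (1 / min 1 p) /
                ennreal (inv_into {0..} v t powr \<theta>))
        \<le> ennreal C * besov_seminorm M N \<theta> p q f))"
proof (intro conjI allI impI; (elim conjE)?)
  have ri: "ri_space half_line Nbar" using assms(3) by (simp add: representation_space_def)
  interpret ri_metric_setting M N Nbar v
    by (intro ri_metric_setting.intro ri_metric_setting_axioms.intro A0_inverse.intro assms ri)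
      (use assms(7) in auto)
  have "upper_boyd_index Nbar \<le> ereal 1"
    using upper_boyd_index_le_1[OF ri] by (simp add: one_ereal_def)
  \<comment> \<open>With \<open>\<eta> = 1 / 2\<close> the required bound is 2, above the bound 1
    for the index.\<close>
  then show "\<exists>\<eta>::real. 0 < \<eta> \<and> \<eta> < 1 \<and> upper_boyd_index Nbar < ereal (1 / \<eta>)"
    by (intro exI[of _ "1 / 2"]) (auto intro: le_less_trans)
  show "\<exists>C::real>0. \<forall>f\<in>Lp_plus_Linf M \<eta>.
        xnorm half_line Nbar
          (\<lambda>t. epowr (osc M (\<lambda>x. \<bar>f x\<bar> powr \<eta>) t) (1 / \<eta>) / ennreal (\<phi> (inv_into {0..} v t)))
        \<le> ennreal C * hajlasz_seminorm M N \<phi> f"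
    if "0 < \<eta>" "\<eta> \<le> 1" "upper_boyd_index Nbar < ereal (1 / \<eta>)" for \<eta> :: real
    by (rule hajlasz_estimate[OF assms(4) that]) blast
  show "\<exists>C::real>0. \<forall>f\<in>Lp_loc M p \<inter> Lp_plus_Linf M (min 1 p).
        Lq_haar q
          (\<lambda>t. fundamental_function M N t *
                epowr (osc M (\<lambda>x. \<bar>f x\<bar> powr min 1 p) t) (1 / min 1 p) /
                ennreal (inv_into {0..} v t powr \<theta>))
        \<le> ennreal C * besov_seminorm M N \<theta> p q f"
    if p: "0 < p" and q: "0 < q" and \<theta>: "0 < \<theta>" for p :: real and q :: ennreal and \<theta> :: real
  proof -
    have C1: "0 < 16 powr (1 / min 1 p)" by simp
    obtain C :: real where C: "0 < C"
      "\<And>A B. (\<And>t r. 0 < t \<Longrightarrow> w (2 * t) \<le> r \<Longrightarrow> A t \<le> ennreal (16 powr (1 / min 1 p)) * B r) \<Longrightarrow>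
        Lq_haar q (\<lambda>t. A t / ennreal (w t powr \<theta>)) \<le> ennreal C * Lq_haar q (\<lambda>r. ennreal (r powr - \<theta>) * B r)"
      by (fact Lq_haar_le[OF C1 \<theta> q])
    show ?thesis
    proof (intro exI[of _ C] conjI ballI)
      fix f assume "f \<in> Lp_loc M p \<inter> Lp_plus_Linf M (min 1 p)"
      then have "f \<in> Lp_plus_Linf M (min 1 p)" by simp
      then show "Lq_haar q
          (\<lambda>t. fundamental_function M N t *
                epowr (osc M (\<lambda>x. \<bar>f x\<bar> powr min 1 p) t) (1 / min 1 p) /
                ennreal (w t powr \<theta>))
        \<le> ennreal C * besov_seminorm M N \<theta> p q f"
        unfolding besov_seminorm_def by (intro C(2) besov_level_estimate[OF p])
    qed (fact C(1))
  qed
qed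

end
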